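(* Assume the Riemann hypothesis. Let $a\geqslant 1$ and suppose that \[ S_{0}=\frac{1}{\pi}\sum_{\substack{n=p^{2k+1}\\ p \text{ prime},\,k\geqslant 0}}(-1)^{k}\,\frac{\Lambda_{1}(n)}{\sqrt{n}}\,\widehat{K}_{a}\Bigl(\frac{\ln n}{\pi}\Bigr)=\frac{1}{\pi}\,\Im\sum_{n=2}^{\infty}i^{\,\Omega(n)}\frac{\Lambda_{1}(n)}{\sqrt{n}}\,\widehat{K}_{a}\Bigl(\frac{\ln n}{\pi}\Bigr) \] is positive. Then for every fixed $\varepsilon$ with $0<\varepsilon<\min(0.5,S_{0})$ there exist constants $c_{0}$ and $T_{0}$ depending only on $a$ and $\varepsilon$ such that for every $T\geqslant T_{0}$, with $H=\frac{1}{\pi}\ln\ln\ln T+c_{0}$, both inequalities \[ \max_{|t-T|\leqslant H}S(t)>\frac{S_{0}-\varepsilon}{\pi\widehat{K}_{a}(0)},\qquad \max_{|t-T|\leqslant H}\bigl(-S(t)\bigr)>\frac{S_{0}-\varepsilon}{\pi\widehat{K}_{a}(0)} \] hold.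
   Context: For $a>0$, $K_{a}(z)=\exp(-a\cosh z)$, and $\widehat{f}(u)=\int_{-\infty}^{+\infty}f(x)e^{-iux}\,dx$ is the Fourier transform. $\Lambda(n)$ is the von Mangoldt function ($\ln p$ if $n=p^k$, $k\ge1$, and $0$ otherwise), $\Lambda_{1}(n)=\Lambda(n)/\ln n$ for $n\geqslant 2$, and $\Omega(n)$ is the number of prime factors of $n$ counted with multiplicity. $S(t)=\frac{1}{\pi}\arg\zeta(0.5+it)$: for $t$ not the ordinate of a zero of $\zeta$, the argument is obtained by continuous variation along the horizontal half-line $\{\sigma+it:\sigma\geqslant 0.5\}$ starting from the value $0$ at $\sigma=+\infty$; at ordinates of zeros, $S(t)=\frac12(S(t+0)+S(t-0))$. *)

theory Defs
  imports
    "HOL-Complex_Analysis.Complex_Analysis"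
    "HOL-Number_Theory.Number_Theory"
    "HOL-Number_Theory.Prime_Powers"
    "HOL-Real_Asymp.Real_Asymp"
begin

text \<open>
  Analytic continuation of the Dirichlet series to the plane punctured at \<open>1\<close>; the value at the
  pole is normalised to \<open>0\<close> only to make the function unique. Existence and uniqueness are
  \<open>is_zeta_ex1\<close>.
\<close>

definition is_zeta :: "(complex \<Rightarrow> complex) \<Rightarrow> bool" where
  "is_zeta f \<longleftrightarrow>
     f holomorphic_on (- {1}) \<and>
     (\<forall>s. Re s > 1 \<longrightarrow> (\<lambda>n. 1 / of_nat (Suc n) powr s) sums f s) \<and>
     f 1 = 0"

lemma holomorphic_series_halfplane:
  fixes f :: "nat \<Rightarrow> complex \<Rightarrow> complex" and B :: "complex \<Rightarrow> real" and c :: real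
  assumes hol: "\<And>n. f n holomorphic_on {s. Re s > c}"
    and B: "continuous_on {s. Re s > c} B"
    and bd: "\<And>n s. Re s > c \<Longrightarrow> norm (f n s) \<le> B s * real (Suc n) powr (c - Re s - 1)"
  shows "(\<lambda>s. \<Sum>n. f n s) holomorphic_on {s. Re s > c}"
    and "\<And>s. Re s > c \<Longrightarrow> summable (\<lambda>n. f n s)"
proof -
  have op: "open {s. Re s > c}"
    by (simp add: open_halfspace_Re_gt)
  have ul: "\<exists>d>0. cball z d \<subseteq> {s. Re s > c} \<and>
      uniform_limit (cball z d) (\<lambda>n s. \<Sum>i<n. f i s) (\<lambda>s. \<Sum>i. f i s) sequentially \<and>
      (\<forall>s\<in>cball z d. summable (\<lambda>n. f n s))"
    if z: "Re z > c" for z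
  proof -
    define d where "d = (Re z - c) / 2"
    have d: "d > 0" using z by (simp add: d_def)
    have Re: "Re s \<ge> c + d" if "s \<in> cball z d" for s
    proof -
      have "\<bar>Re (z - s)\<bar> \<le> d"
        using that abs_Re_le_cmod[of "z - s"] by (simp add: dist_norm)
      hence "Re z - Re s \<le> d" using abs_le_D1 by fastforce
      moreover have "Re z = c + 2 * d" by (simp add: d_def field_simps)
      ultimately show ?thesis by linarith
    qed
    have sub: "cball z d \<subseteq> {s. Re s > c}"
      using Re d by force
    have "compact (B ` cball z d)"
      using continuous_on_subset[OF B sub] by (intro compact_continuous_image) auto
    then obtain M where M: "\<And>s. s \<in> cball z d \<Longrightarrow> \<bar>B s\<bar> \<le> M"
      using compact_imp_bounded bounded_iff by (metis imageI real_norm_def)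
    have M0: "M \<ge> 0" using M[of z] d by force
    have sm: "summable (\<lambda>n. M * real (Suc n) powr (- d - 1))"
      using summable_real_powr_iff[of "- d - 1"] d
      by (intro summable_mult) (subst summable_Suc_iff, simp)
    have le: "norm (f n s) \<le> M * real (Suc n) powr (- d - 1)" if s: "s \<in> cball z d" for n s
    proof -
      have "norm (f n s) \<le> B s * real (Suc n) powr (c - Re s - 1)"
        using bd sub s by blast
      also have "\<dots> \<le> M * real (Suc n) powr (- d - 1)"
        using M[OF s] M0 Re[OF s] by (intro mult_mono powr_mono) auto
      finally show ?thesis .
    qed
    have "uniform_limit (cball z d) (\<lambda>n s. \<Sum>i<n. f i s) (\<lambda>s. \<Sum>i. f i s) sequentially"
      using le by (intro Weierstrass_m_test[OF _ sm])
    moreover have "summable (\<lambda>n. f n s)" if "s \<in> cball z d" for s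
      using le[OF that] sm by (intro summable_comparison_test[OF _ sm]) auto
    ultimately show ?thesis using d sub by blast
  qed
  show "(\<lambda>s. \<Sum>n. f n s) holomorphic_on {s. Re s > c}"
  proof (rule holomorphic_uniform_sequence[OF op, where f = "\<lambda>n s. \<Sum>i<n. f i s"])
    show "(\<lambda>s. \<Sum>i<n. f i s) holomorphic_on {s. Re s > c}" for n
      by (intro holomorphic_intros hol)
    show "\<exists>d. 0 < d \<and> cball z d \<subseteq> {s. Re s > c} \<and>
        uniform_limit (cball z d) (\<lambda>n s. \<Sum>i<n. f i s) (\<lambda>s. \<Sum>n. f n s) sequentially"
      if "z \<in> {s. Re s > c}" for z
      using ul[of z] that by simp metis
  qed
  show "summable (\<lambda>n. f n s)" if "Re s > c" for s
    using ul[OF that] by (meson centre_in_cball less_imp_le)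
qed

text \<open>
  Continuation by Landau's recursion: expand \<open>(n+1)^(1-s)\<close> around \<open>n\<close> to order \<open>m\<close> and sum over \<open>n\<close>.
  The remainders sum to a holomorphic function for \<open>Re s > 1 - m\<close>.
\<close>

definition ffac :: "nat \<Rightarrow> complex \<Rightarrow> complex" where
  "ffac i s = (\<Prod>j<i. 1 - s - of_nat j)"

definition zrem :: "nat \<Rightarrow> nat \<Rightarrow> complex \<Rightarrow> complex" where
  "zrem m n s = of_nat (Suc (Suc n)) powr (1 - s) -
     (\<Sum>i\<le>m. ffac i s * of_nat (Suc n) powr (1 - s - of_nat i) / fact i)"

lemma ffac_holomorphic [holomorphic_intros]: "ffac i holomorphic_on A"
  unfolding ffac_def by (intro holomorphic_intros)

lemma zrem_bound:
  assumes "Re s > 1 - real m"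
  shows "norm (zrem m n s) \<le> norm (ffac (Suc m) s) / fact m * real (Suc n) powr (1 - real m - Re s - 1)"
proof -
  define N where "N = real (Suc n)"
  have N: "N \<ge> 1" by (simp add: N_def)
  define A where "A = (of_real ` {N..N+1} :: complex set)"
  have conv: "convex A"
    unfolding A_def by (rule convex_linear_image) (auto intro: linearI simp: scaleR_conv_of_real)
  define f where "f = (\<lambda>i z. ffac i s * z powr (1 - s - of_nat i))"
  have A: "\<exists>x. z = of_real x \<and> x \<ge> N \<and> x > 0 \<and> z \<notin> \<real>\<^sub>\<le>\<^sub>0" if "z \<in> A" for z
    using that N by (auto simp: A_def complex_nonpos_Reals_iff)
  have "norm (f 0 (of_real (N+1)) - (\<Sum>i\<le>m. f i (of_real N) * (of_real (N+1) - of_real N) ^ i / fact i))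
     \<le> (norm (ffac (Suc m) s) * N powr (- Re s - real m)) * norm (of_real (N+1) - of_real N :: complex) ^ Suc m / fact m"
  proof (rule complex_Taylor[OF conv])
    fix i z assume z: "z \<in> A"
    have "(f i has_field_derivative ffac i s * ((1 - s - of_nat i) * z powr (1 - s - of_nat i - 1))) (at z within A)"
      unfolding f_def using A[OF z]
      by (auto intro!: derivative_eq_intros)
    also have "ffac i s * ((1 - s - of_nat i) * z powr (1 - s - of_nat i - 1)) = f (Suc i) z"
      by (simp add: f_def ffac_def algebra_simps)
    finally show "(f i has_field_derivative f (Suc i) z) (at z within A)" .
  next
    fix z assume z: "z \<in> A"
    then obtain x where x: "z = of_real x" "x \<ge> N" "x > 0" using A by blast
    have "norm (f (Suc m) z) = norm (ffac (Suc m) s) * x powr (- Re s - real m)"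
      using x by (simp add: f_def norm_mult norm_powr_real_powr algebra_simps)
    also have "\<dots> \<le> norm (ffac (Suc m) s) * N powr (- Re s - real m)"
      using x N assms by (intro mult_left_mono powr_mono2') auto
    finally show "norm (f (Suc m) z) \<le> norm (ffac (Suc m) s) * N powr (- Re s - real m)" .
  next
    show "of_real (N+1) \<in> A" unfolding A_def by (rule imageI) simp
  qed (auto simp: A_def)
  also have "f 0 (of_real (N+1)) - (\<Sum>i\<le>m. f i (of_real N) * (of_real (N+1) - of_real N) ^ i / fact i) = zrem m n s"
    by (simp add: f_def zrem_def N_def ffac_def add_ac)
  finally show ?thesis
    by (simp add: N_def field_simps)
qed

lemma zrem_series:
  shows "(\<lambda>s. \<Sum>n. zrem m n s) holomorphic_on {s. Re s > 1 - real m}"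
    and "\<And>s. Re s > 1 - real m \<Longrightarrow> summable (\<lambda>n. zrem m n s)"
proof -
  have 1: "zrem m n holomorphic_on {s. Re s > 1 - real m}" for n
    unfolding zrem_def by (intro holomorphic_intros) auto
  have 2: "continuous_on {s. Re s > 1 - real m} (\<lambda>s. norm (ffac (Suc m) s) / fact m)"
    by (intro continuous_intros holomorphic_on_imp_continuous_on holomorphic_intros) auto
  note * = holomorphic_series_halfplane[OF 1 2 zrem_bound]
  show "(\<lambda>s. \<Sum>n. zrem m n s) holomorphic_on {s. Re s > 1 - real m}"
    by (rule *(1))
  show "summable (\<lambda>n. zrem m n s)" if "Re s > 1 - real m" for s
    by (rule *(2)[OF _ that])
qed

definition dzeta :: "complex \<Rightarrow> complex" where
  "dzeta s = (\<Sum>n. 1 / of_nat (Suc n) powr s)"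

lemma dzeta:
  shows "dzeta holomorphic_on {s. Re s > 1}"
    and "\<And>s. Re s > 1 \<Longrightarrow> (\<lambda>n. 1 / of_nat (Suc n) powr s) sums dzeta s"
proof -
  have 1: "(\<lambda>s. 1 / of_nat (Suc n) powr s :: complex) holomorphic_on {s. Re s > 1}" for n
    by (intro holomorphic_intros) (auto simp del: of_nat_Suc)
  have 2: "norm (1 / of_nat (Suc n) powr s :: complex) \<le> 1 * real (Suc n) powr (1 - Re s - 1)" for n s
    using norm_powr_real_powr[of "of_nat (Suc n)" s]
    by (simp add: norm_divide norm_inverse powr_minus divide_inverse del: of_nat_Suc)
  note * = holomorphic_series_halfplane[OF 1 _ 2]
  show "dzeta holomorphic_on {s. Re s > 1}"
    unfolding dzeta_def by (rule *(1)) auto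
  show "(\<lambda>n. 1 / of_nat (Suc n) powr s) sums dzeta s" if "Re s > 1" for s
    unfolding dzeta_def using *(2)[OF _ that] by (intro summable_sums) auto
qed

lemma zrem_dzeta:
  assumes s: "Re s > 1"
  shows "(\<Sum>n. zrem m n s) = - 1 - (\<Sum>i=1..m. ffac i s / fact i * dzeta (s + of_nat i - 1))"
proof -
  have "((\<lambda>n. of_nat n powr (1 - s) :: complex) \<longlongrightarrow> 0) sequentially"
  proof (rule tendsto_norm_zero_cancel, rule Lim_transform_eventually)
    show "((\<lambda>n. real n powr (1 - Re s)) \<longlongrightarrow> 0) sequentially"
      using s by real_asymp
    show "\<forall>\<^sub>F n in sequentially. real n powr (1 - Re s) = norm (of_nat n powr (1 - s) :: complex)"
      using eventually_gt_at_top[of 0]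
    proof eventually_elim
      case (elim n)
      show ?case using norm_powr_real_powr[of "of_nat n" "1 - s"] elim by simp
    qed
  qed
  hence lim: "(\<lambda>n. of_nat (Suc n) powr (1 - s) :: complex) \<longlonglongrightarrow> 0"
    by (rule LIMSEQ_Suc)
  have tel: "(\<lambda>n. of_nat (Suc (Suc n)) powr (1 - s) - of_nat (Suc n) powr (1 - s) :: complex) sums (0 - of_nat (Suc 0) powr (1 - s))"
    by (rule telescope_sums[OF lim])
  have each: "(\<lambda>n. ffac i s / fact i * (1 / of_nat (Suc n) powr (s + of_nat i - 1))) sums
      (ffac i s / fact i * dzeta (s + of_nat i - 1))" if "i \<in> {1..m}" for i
    using that s by (intro sums_mult dzeta(2)) auto
  have "(\<lambda>n. of_nat (Suc (Suc n)) powr (1 - s) - of_nat (Suc n) powr (1 - s)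
           - (\<Sum>i=1..m. ffac i s / fact i * (1 / of_nat (Suc n) powr (s + of_nat i - 1))))
        sums (0 - of_nat (Suc 0) powr (1 - s) - (\<Sum>i=1..m. ffac i s / fact i * dzeta (s + of_nat i - 1)))"
    by (intro sums_diff[OF tel] sums_sum each)
  also have "(\<lambda>n. of_nat (Suc (Suc n)) powr (1 - s) - of_nat (Suc n) powr (1 - s)
           - (\<Sum>i=1..m. ffac i s / fact i * (1 / of_nat (Suc n) powr (s + of_nat i - 1)))) = (\<lambda>n. zrem m n s)"
  proof
    fix n
    have "{..m} = insert 0 {1..m}" by auto
    moreover have "1 / of_nat (Suc n) powr (s + of_nat i - 1) = (of_nat (Suc n) powr (1 - s - of_nat i) :: complex)" for i
      using powr_minus[of "of_nat (Suc n) :: complex" "s + of_nat i - 1"]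
      by (simp add: divide_inverse algebra_simps del: of_nat_Suc)
    ultimately show "of_nat (Suc (Suc n)) powr (1 - s) - of_nat (Suc n) powr (1 - s)
           - (\<Sum>i=1..m. ffac i s / fact i * (1 / of_nat (Suc n) powr (s + of_nat i - 1))) = zrem m n s"
      by (simp add: zrem_def ffac_def del: of_nat_Suc)
  qed
  finally show ?thesis
    by (simp add: sums_iff)
qed

lemma zeta_continuation_step:
  "\<exists>F. F holomorphic_on {s. Re s > 1 - real m} \<and> (\<forall>s. Re s > 1 \<longrightarrow> F s = (s - 1) * dzeta s)"
proof (induction m)
  case 0
  show ?case using dzeta(1)
    by (intro exI[of _ "\<lambda>s. (s - 1) * dzeta s"]) (auto intro!: holomorphic_intros)
next
  case (Suc m)
  then obtain F where F: "F holomorphic_on {s. Re s > 1 - real m}"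
      "\<And>s. Re s > 1 \<Longrightarrow> F s = (s - 1) * dzeta s" by blast
  define G where "G = (\<lambda>s. 1 + (\<Sum>n. zrem (Suc m) n s) - (\<Sum>i=2..Suc m. ffac (i - 1) s / fact i * F (s + of_nat i - 1)))"
  have comp: "(\<lambda>s. F (s + of_nat i - 1)) holomorphic_on {s. Re s > 1 - real (Suc m)}" if "i \<ge> 2" for i
  proof -
    have "F \<circ> (\<lambda>s. s + of_nat i - 1) holomorphic_on {s. Re s > 1 - real (Suc m)}"
      using that by (intro holomorphic_on_compose_gen[OF _ F(1)] holomorphic_intros) auto
    thus ?thesis by (simp add: o_def)
  qed
  have "G holomorphic_on {s. Re s > 1 - real (Suc m)}"
    unfolding G_def by (intro holomorphic_intros zrem_series comp) auto
  moreover have "G s = (s - 1) * dzeta s" if s: "Re s > 1" for s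
  proof -
    have t: "ffac i s / fact i * dzeta (s + of_nat i - 1) = - (ffac (i - 1) s / fact i * F (s + of_nat i - 1))"
      if i: "i \<ge> 1" for i
    proof -
      obtain j where j: "i = Suc j" using i by (cases i) auto
      have "F (s + of_nat i - 1) = (s + of_nat j - 1) * dzeta (s + of_nat i - 1)"
        using s j by (subst F(2)) auto
      moreover have "ffac i s = ffac (i - 1) s * - (s + of_nat j - 1)"
        by (simp add: ffac_def j algebra_simps)
      moreover have "A * - y / B * D = - (A / B * (y * D))" for A B D y :: complex
        by simp
      ultimately show ?thesis by metis
    qed
    have "{1..Suc m} = insert 1 {2..Suc m}" by auto
    moreover have "(\<Sum>i=1..Suc m. ffac i s / fact i * dzeta (s + of_nat i - 1)) =
        (\<Sum>i=1..Suc m. - (ffac (i - 1) s / fact i * F (s + of_nat i - 1)))"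
      by (rule sum.cong[OF refl t]) simp
    moreover have "ffac 0 s = 1" by (simp add: ffac_def)
    ultimately have "(\<Sum>i=1..Suc m. ffac i s / fact i * dzeta (s + of_nat i - 1)) =
        - F s - (\<Sum>i=2..Suc m. ffac (i - 1) s / fact i * F (s + of_nat i - 1))"
      by (simp add: sum_negf del: sum.cl_ivl_Suc)
    hence "G s = F s"
      unfolding G_def zrem_dzeta[OF s] by simp
    thus ?thesis using F(2)[OF s] by simp
  qed
  ultimately show ?case by blast
qed

lemma zeta_continuation:
  "\<exists>F. F holomorphic_on UNIV \<and> (\<forall>s. Re s > 1 \<longrightarrow> F s = (s - 1) * dzeta s)"
proof -
  obtain F where F: "\<And>m. F m holomorphic_on {s. Re s > 1 - real m}"
      "\<And>m s. Re s > 1 \<Longrightarrow> F m s = (s - 1) * dzeta s"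
    using zeta_continuation_step by metis
  have eq: "F m s = F k s" if "m \<le> k" "Re s > 1 - real m" for m k s
  proof (rule analytic_continuation_open[of "{s. Re s > 1}" "{s. Re s > 1 - real m}" "F m" "F k"])
    show "{s. Re s > 1} \<noteq> {}" by (auto intro!: exI[of _ 2])
    show "F k holomorphic_on {s. Re s > 1 - real m}"
      using that by (intro holomorphic_on_subset[OF F(1)]) auto
    show "connected {s. Re s > 1 - real m}"
      by (intro convex_connected convex_halfspace_Re_gt)
    show "F m z = F k z" if "z \<in> {s. Re s > 1}" for z
      using that F(2)[of z] by simp
    show "F m holomorphic_on {s. Re s > 1 - real m}" by (rule F(1))
    show "{s. Re s > 1} \<subseteq> {s. Re s > 1 - real m}" by auto
  qed (use that in \<open>simp_all add: open_halfspace_Re_gt\<close>)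
  define N where "N = (\<lambda>s. nat \<lceil>2 - Re s\<rceil>)"
  define G where "G = (\<lambda>s. F (N s) s)"
  have N: "Re s > 1 - real (N s)" for s
    unfolding N_def using real_nat_ceiling_ge[of "2 - Re s"] by linarith
  have G: "G s = F m s" if "Re s > 1 - real m" for s m
    unfolding G_def using eq[OF _ N, of s m] eq[OF _ that, of "N s"] by (metis nle_le)
  have "G holomorphic_on (\<Union>m. {s. Re s > 1 - real m})"
  proof (rule holomorphic_on_UN_open)
    show "G holomorphic_on {s. Re s > 1 - real m}" for m
      using F(1)[of m] by (rule holomorphic_transform) (simp add: G)
  qed (auto simp: open_halfspace_Re_gt)
  moreover have "(\<Union>m. {s. Re s > 1 - real m}) = UNIV"
    using N by blast
  moreover have "G s = (s - 1) * dzeta s" if "Re s > 1" for s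
    using that F(2) by (simp add: G_def)
  ultimately show ?thesis by auto
qed

lemma is_zeta_ex1: "\<exists>!f. is_zeta f"
proof (rule ex_ex1I)
  obtain F where F: "F holomorphic_on UNIV" "\<And>s. Re s > 1 \<Longrightarrow> F s = (s - 1) * dzeta s"
    using zeta_continuation by blast
  have "is_zeta (\<lambda>s. F s / (s - 1))"
    unfolding is_zeta_def
  proof (intro conjI allI impI)
    show "(\<lambda>s. F s / (s - 1)) holomorphic_on - {1}"
      using F(1) by (intro holomorphic_intros) (auto intro: holomorphic_on_subset)
    show "(\<lambda>n. 1 / of_nat (Suc n) powr s) sums (F s / (s - 1))" if "Re s > 1" for s
      using dzeta(2)[OF that] that by (simp add: F(2)[OF that]) (auto split: if_splits)
  qed auto
  thus "\<exists>f. is_zeta f" by blast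
next
  fix f g assume f: "is_zeta f" and g: "is_zeta g"
  have "f s = g s" if "s \<noteq> 1" for s
  proof (rule analytic_continuation_open[of "{s. Re s > 1}" "- {1}" f g])
    show "{s. Re s > 1} \<noteq> {}" by (auto intro!: exI[of _ 2])
    show "connected (- {1 :: complex})"
      by (rule connected_punctured_universe) simp
    show "f z = g z" if "z \<in> {s. Re s > 1}" for z
      using f g that unfolding is_zeta_def by (meson mem_Collect_eq sums_unique2)
  qed (use f g that in \<open>auto simp: is_zeta_def open_halfspace_Re_gt\<close>)
  thus "f = g"
    using f g unfolding is_zeta_def by (metis ext)
qed

definition zeta :: "complex \<Rightarrow> complex" where
  "zeta = (THE f. is_zeta f)"

lemma is_zeta_zeta: "is_zeta zeta"
  unfolding zeta_def using is_zeta_ex1 by (rule theI')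

definition riemann_hypothesis :: bool where
  "riemann_hypothesis \<longleftrightarrow> (\<forall>s. 0 < Re s \<and> Re s < 1 \<and> zeta s = 0 \<longrightarrow> Re s = 1 / 2)"

text \<open>
  Ordinates of all zeros; because of the trivial zeros this includes \<open>0\<close>, the only height at which
  the half-line meets the pole.
\<close>

definition zeta_ordinates :: "real set" where
  "zeta_ordinates = {Im \<rho> | \<rho>. \<rho> \<noteq> 1 \<and> zeta \<rho> = 0}"

definition is_zeta_arg_along :: "real \<Rightarrow> (real \<Rightarrow> real) \<Rightarrow> bool" where
  "is_zeta_arg_along t g \<longleftrightarrow>
     continuous_on {1 / 2..} g \<and>
     (\<forall>\<sigma>\<ge>1 / 2. zeta (Complex \<sigma> t) = of_real (cmod (zeta (Complex \<sigma> t))) * cis (g \<sigma>)) \<and>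
     (g \<longlongrightarrow> 0) at_top"

definition arg_zeta :: "real \<Rightarrow> real" where
  "arg_zeta t = (THE y. \<exists>g. is_zeta_arg_along t g \<and> y = g (1 / 2))"

lemma is_zeta_arg_along_unique:
  assumes g: "is_zeta_arg_along t g" and h: "is_zeta_arg_along t h"
    and t: "t \<notin> zeta_ordinates" "t \<noteq> 0" and \<sigma>: "\<sigma> \<ge> 1 / 2"
  shows "g \<sigma> = h \<sigma>"
proof -
  define d where "d = (\<lambda>x. (g x - h x) / (2 * pi))"
  have cont: "continuous_on {1 / 2..} d"
    using g h unfolding d_def is_zeta_arg_along_def by (intro continuous_intros) auto
  have int: "d x \<in> \<int>" if x: "x \<in> {1 / 2..}" for x
  proof -
    have "Complex x t \<noteq> 1" using t by (simp add: complex_eq_iff)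
    hence nz: "zeta (Complex x t) \<noteq> 0"
      using t unfolding zeta_ordinates_def by force
    have "of_real (cmod (zeta (Complex x t))) * cis (g x) = of_real (cmod (zeta (Complex x t))) * cis (h x)"
      using g h x unfolding is_zeta_arg_along_def by (metis atLeast_iff)
    hence "cis (g x) = cis (h x)" using nz by simp
    hence "cis (g x - h x) = 1" by (simp flip: cis_divide)
    hence "cos (g x - h x) = 1" by (simp add: complex_eq_iff)
    then obtain k :: int where "g x - h x = of_int k * (2 * pi)"
      unfolding cos_one_2pi_int by (auto simp: mult_ac)
    thus ?thesis by (simp add: d_def)
  qed
  have "d constant_on {1 / 2..}"
  proof (rule continuous_discrete_range_constant[OF _ cont])
    fix x :: real assume x: "x \<in> {1 / 2..}"
    show "\<exists>e>0. \<forall>y. y \<in> {1 / 2..} \<and> d y \<noteq> d x \<longrightarrow> e \<le> norm (d y - d x)"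
    proof (intro exI[of _ 1] conjI allI impI)
      fix y assume y: "y \<in> {1 / 2..} \<and> d y \<noteq> d x"
      have "d y - d x \<in> \<int>" "d y - d x \<noteq> 0" using int x y by auto
      thus "1 \<le> norm (d y - d x)" by (metis Ints_nonzero_abs_ge1 real_norm_def)
    qed simp
  qed simp
  then obtain c where c: "\<And>x. x \<ge> 1 / 2 \<Longrightarrow> d x = c"
    unfolding constant_on_def by auto
  have "((\<lambda>x. (g x - h x) / (2 * pi)) \<longlongrightarrow> (0 - 0) / (2 * pi)) at_top"
    using g h unfolding is_zeta_arg_along_def by (intro tendsto_intros) auto
  hence "(d \<longlongrightarrow> 0) at_top" by (simp add: d_def)
  moreover have "(d \<longlongrightarrow> c) at_top"
    using eventually_ge_at_top[of "1 / 2 :: real"]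
    by (intro tendsto_eventually) (auto elim: eventually_mono simp: c)
  ultimately have "c = 0" using tendsto_unique trivial_limit_at_top_linorder by blast
  thus ?thesis using c[OF \<sigma>] by (simp add: d_def)
qed

definition S_zeta :: "real \<Rightarrow> real" where
  "S_zeta t = (if t \<notin> zeta_ordinates then arg_zeta t / pi
     else (Lim (at t within {t<..} - zeta_ordinates) (\<lambda>u. arg_zeta u / pi) +
           Lim (at t within {..<t} - zeta_ordinates) (\<lambda>u. arg_zeta u / pi)) / 2)"

definition fourier :: "(real \<Rightarrow> complex) \<Rightarrow> real \<Rightarrow> complex" where
  "fourier f u = (LINT x|lborel. f x * exp (- (\<i> * of_real u * of_real x)))"

definition K_ker :: "real \<Rightarrow> complex \<Rightarrow> complex" where
  "K_ker a z = exp (- (of_real a * cosh z))"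

definition K_hat :: "real \<Rightarrow> real \<Rightarrow> complex" where
  "K_hat a = fourier (\<lambda>x. K_ker a (of_real x))"

text \<open>The kernel is even, so its transform is real and taking \<open>Re\<close> below loses nothing.\<close>

lemma K_hat_real: "of_real (Re (K_hat a u)) = K_hat a u"
proof -
  have cosh: "K_ker a (of_real (- x)) = K_ker a (of_real x)" "cnj (K_ker a (of_real x)) = K_ker a (of_real x)" for x
    by (simp_all add: K_ker_def exp_cnj cosh_def scaleR_conv_of_real add.commute)
  have "cnj (K_hat a u) = (LINT x|lborel. cnj (K_ker a (of_real x) * exp (- (\<i> * of_real u * of_real x))))"
    unfolding K_hat_def fourier_def by (rule Bochner_Integration.integral_cnj [symmetric])
  also have "\<dots> = (LINT x|lborel. K_ker a (of_real x) * exp (\<i> * of_real u * of_real x))"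
    by (simp add: cosh exp_cnj)
  also have "\<dots> = (LINT x|lborel. K_ker a (of_real (- x)) * exp (\<i> * of_real u * of_real (- x)))"
    by (subst lborel_integral_real_affine[of "-1" _ 0]) simp_all
  also have "\<dots> = K_hat a u"
    by (simp add: K_hat_def fourier_def cosh del: of_real_minus) simp
  finally have "Im (K_hat a u) = 0"
    by (simp add: complex_eq_iff)
  thus ?thesis by (simp add: complex_eq_iff)
qed

definition Lambda1 :: "nat \<Rightarrow> real" where
  "Lambda1 n = mangoldt n / ln (real n)"

definition Omega :: "nat \<Rightarrow> nat" where
  "Omega n = size (prime_factorization n)"

text \<open>An odd prime power \<open>n = p ^ (2 * k + 1)\<close> determines \<open>(p, k)\<close>, so the sum runs over these pairs.\<close>

definition S0 :: "real \<Rightarrow> real" where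
  "S0 a = 1 / pi * (\<Sum>\<^sub>\<infinity>(p, k)\<in>{p. prime p} \<times> (UNIV :: nat set).
     let n = p ^ (2 * k + 1)
     in (-1) ^ k * Lambda1 n / sqrt (real n) * Re (K_hat a (ln (real n) / pi)))"

end

theory Submission
  imports Defs "HOL-Probability.Sinc_Integral" "HOL-Analysis.Kronecker_Approximation_Theorem"
begin

text \<open>
  Put \<open>k u = exp (- a cosh (\<pi> u))\<close>. Averaging \<open>log \<zeta>\<close> over a vertical line against \<open>k\<close> turns its Dirichlet
  series into the one with coefficients \<open>c n = \<Lambda>\<^sub>1 n * K_hat a (ln n / \<pi>) / \<pi>\<close>, and this new series still
  converges absolutely on the critical line. Under the Riemann hypothesis the averaged \<open>log \<zeta>\<close> is
  analytic to the right of that line apart from the effect of the pole of \<open>\<zeta>\<close>, so by analytic continuation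
  \<open>\<integral> k u * \<pi> * S (t + u) du\<close> equals the imaginary part of the new series at \<open>1/2 + i t\<close> up to an
  error that tends to \<open>0\<close> as \<open>t\<close> grows. By Kronecker's theorem every \<open>T\<close> has, at bounded distance, a \<open>t\<close>
  with \<open>p ^ (- i t)\<close> close to \<open>i\<close> (or to \<open>- i\<close>) for all small primes \<open>p\<close>, which makes the series
  close to \<open>S0 a\<close> (or to \<open>- S0 a\<close>). Since \<open>S t = O (log t)\<close> and \<open>k\<close> decays doubly exponentially, the part
  of the integral outside a window of radius \<open>(ln ln ln T) / \<pi> + O(1)\<close> is negligible, so \<open>S\<close>
  takes a large value inside the window. The argument yields the larger bound \<open>S0 a / K_hat a 0\<close> up
  to an arbitrarily small loss, hence no care with \<open>\<epsilon>\<close> is needed.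
\<close>

section \<open>Dirichlet series and the nonvanishing of the zeta function\<close>

text \<open>The scale \<open>pi\<close> in the kernel is tied to the pole. Seen from the line
  through 1/2 + i t, the pole of zeta sits at the complex parameter u = - t - i/2, and at - t - i v
  the entire kernel has norm exp (- a cosh (pi t) cos (pi v)): it decays for |v| < 1/2 and is still
  bounded at |v| = 1/2. So the pole costs only O(1 / cosh (pi t)), and the same \<open>pi\<close>
  reappears in the radius of the window. That radius makes cosh (pi h) at least 4 ln ln T; half of
  the exponent then already yields (ln T)^(-2) outside the window, against a growth ln T of S, and
  the other half stays available for integration. Zeros are the second obstacle. On the critical
  line the real part of log zeta is unbounded while its imaginary part is not. Hence the convolution
  identity is proved at Re z = 1/2 + w with w > 0, and only its imaginary part is carried to w =
  0.\<close>

definition dser :: "(nat \<Rightarrow> real) \<Rightarrow> complex \<Rightarrow> complex" where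
  "dser c s = (\<Sum>n. of_real (c (Suc n)) * of_nat (Suc n) powr (- s))"

lemma norm_dser_term:
  "norm (of_real (c (Suc n)) * of_nat (Suc n) powr (- s) :: complex) = \<bar>c (Suc n)\<bar> * real (Suc n) powr (- Re s)"
  using norm_powr_real_powr[of "of_nat (Suc n)" "- s"] by (simp add: norm_mult del: of_nat_Suc)

lemma summable_powr_Suc: "\<sigma> > 1 \<Longrightarrow> summable (\<lambda>n. real (Suc n) powr (- \<sigma>))"
  using summable_real_powr_iff[of "- \<sigma>"] by (subst summable_Suc_iff) simp

lemma summable_ln_powr_Suc:
  assumes "\<sigma> > 1"
  shows "summable (\<lambda>n. ln (real (Suc n)) * real (Suc n) powr (- \<sigma>))"
proof (rule summable_comparison_test)
  define \<epsilon> where "\<epsilon> = (\<sigma> - 1) / 2"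
  have e: "\<epsilon> > 0" using assms by (simp add: \<epsilon>_def)
  show "summable (\<lambda>n. 1 / \<epsilon> * real (Suc n) powr (- (\<sigma> - \<epsilon>)))"
    using assms by (intro summable_mult summable_powr_Suc) (simp add: \<epsilon>_def field_simps)
  have "ln x * x powr (- \<sigma>) \<le> 1 / \<epsilon> * x powr (- (\<sigma> - \<epsilon>))" if "x \<ge> 1" for x
  proof -
    have "ln x * x powr (- \<sigma>) \<le> (x powr \<epsilon> / \<epsilon>) * x powr (- \<sigma>)"
      using ln_powr_bound[OF that e] by (intro mult_right_mono) auto
    also have "\<dots> = 1 / \<epsilon> * x powr (- (\<sigma> - \<epsilon>))"
      using that by (simp add: powr_add[symmetric])
    finally show ?thesis .
  qed
  from this[of "real (Suc n)" for n]
  show "\<exists>N. \<forall>n\<ge>N. norm (ln (real (Suc n)) * real (Suc n) powr - \<sigma>) \<le> 1 / \<epsilon> * real (Suc n) powr (- (\<sigma> - \<epsilon>))"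
    by (intro exI[of _ 0]) (auto simp: abs_mult)
qed

lemma dser_bounded_coeffs:
  assumes c: "\<And>n. \<bar>c n\<bar> \<le> 1" and s: "Re s > 1"
  shows "summable (\<lambda>n. norm (of_real (c (Suc n)) * of_nat (Suc n) powr (- s) :: complex))"
    and "summable (\<lambda>n. norm (of_real (- c (Suc n) * ln (Suc n)) * of_nat (Suc n) powr (- s) :: complex))"
    and "(dser c has_field_derivative dser (\<lambda>n. - c n * ln n) s) (at s)"
proof -
  have sm: "summable (\<lambda>n. \<bar>c (Suc n)\<bar> * real (Suc n) powr (- Re z))" if "Re z > 1" for z
    by (rule summable_comparison_test'[OF summable_powr_Suc[OF that], of 0])
       (use c in \<open>auto simp: abs_mult intro!: mult_left_le_one_le\<close>)
  show 1: "summable (\<lambda>n. norm (of_real (c (Suc n)) * of_nat (Suc n) powr (- s) :: complex))"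
    unfolding norm_dser_term by (rule sm[OF s])
  have bd: "\<bar>- c (Suc n) * ln (Suc n)\<bar> * real (Suc n) powr (- \<sigma>) \<le> ln (Suc n) * real (Suc n) powr (- \<sigma>)" for n \<sigma>
    using c[of "Suc n"] by (intro mult_right_mono) (auto simp: abs_mult intro!: mult_left_le_one_le)
  show "summable (\<lambda>n. norm (of_real (- c (Suc n) * ln (Suc n)) * of_nat (Suc n) powr (- s) :: complex))"
    unfolding norm_dser_term[of "\<lambda>n. - c n * ln n"]
    by (rule summable_comparison_test'[OF summable_ln_powr_Suc[OF s], of 0])
       (use bd in \<open>auto simp: abs_mult\<close>)
  \<comment> \<open>An abscissa strictly between 1 and \<open>Re s\<close>: on
    \<open>Re z > \<sigma>\<close> the series of derivatives has one summable majorant, and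
    \<open>s\<close> stays interior.\<close>
  define \<sigma> where "\<sigma> = (1 + Re s) / 2"
  have \<sigma>: "\<sigma> > 1" "Re s > \<sigma>" using s by (auto simp: \<sigma>_def field_simps)
  show "(dser c has_field_derivative dser (\<lambda>n. - c n * ln n) s) (at s)"
    unfolding dser_def [abs_def]
  proof (rule has_field_derivative_series'(2)[where S = "{z. Re z > \<sigma>}" and ?x0.0 = s])
    show "convex {z. Re z > \<sigma>}" by (rule convex_halfspace_Re_gt)
    show "((\<lambda>a. of_real (c (Suc n)) * of_nat (Suc n) powr - a) has_field_derivative
            of_real (- c (Suc n) * ln (real (Suc n))) * of_nat (Suc n) powr - z) (at z within {z. \<sigma> < Re z})" for n z
    proof -
      have "(of_nat (Suc n) :: complex) \<noteq> 0" by (simp del: of_nat_Suc)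
      moreover have "Ln (of_nat (Suc n)) = of_real (ln (real (Suc n)))"
        using Ln_of_nat[of "Suc n"] by simp
      ultimately have eq: "of_nat (Suc n) powr - a = exp (- a * of_real (ln (real (Suc n))))" for a :: complex
        by (simp add: powr_def)
      show ?thesis unfolding eq
        by (auto intro!: derivative_eq_intros simp del: of_nat_Suc)
    qed
    show "uniformly_convergent_on {z. Re z > \<sigma>} (\<lambda>n z. \<Sum>i<n. of_real (- c (Suc i) * ln (real (Suc i))) * of_nat (Suc i) powr - z)"
    proof (rule Weierstrass_m_test'[OF _ summable_ln_powr_Suc[OF \<sigma>(1)]])
      fix n z assume z: "z \<in> {z. Re z > \<sigma>}"
      have "norm (of_real (- c (Suc n) * ln (real (Suc n))) * of_nat (Suc n) powr - z :: complex) \<le> ln (Suc n) * real (Suc n) powr (- Re z)"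
        unfolding norm_dser_term[of "\<lambda>n. - c n * ln n"] by (rule bd)
      also have "\<dots> \<le> ln (Suc n) * real (Suc n) powr (- \<sigma>)"
        using z by (intro mult_left_mono powr_mono) auto
      finally show "norm (of_real (- c (Suc n) * ln (real (Suc n))) * of_nat (Suc n) powr - z :: complex) \<le> ln (real (Suc n)) * real (Suc n) powr (- \<sigma>)" .
    qed
    show "summable (\<lambda>n. of_real (c (Suc n)) * of_nat (Suc n) powr - s :: complex)"
      using 1 by (rule summable_norm_cancel)
    show "s \<in> interior {z. Re z > \<sigma>}"
      using \<sigma> by (subst interior_open) (auto simp: open_halfspace_Re_gt)
  qed (use \<sigma> in auto)
qed

text \<open>Both series converge absolutely, so the double series over pairs of indices may be
  regrouped along the product of the two indices.\<close>

lemma dirichlet_convolution_sums: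
  fixes f g :: "nat \<Rightarrow> complex"
  assumes f: "summable (\<lambda>n. norm (f (Suc n)))" and g: "summable (\<lambda>n. norm (g (Suc n)))"
  shows "(\<lambda>n. \<Sum>d | d dvd Suc n. f d * g (Suc n div d)) sums ((\<Sum>n. f (Suc n)) * (\<Sum>n. g (Suc n)))"
proof -
  have nn: "(\<lambda>n. h (Suc n)) summable_on UNIV" "(\<lambda>n. norm (h (Suc n))) summable_on UNIV" 
      "(\<Sum>\<^sub>\<infinity>n. h (Suc n)) = (\<Sum>n. h (Suc n))"
    if "summable (\<lambda>n. norm (h (Suc n)))" for h :: "nat \<Rightarrow> complex"
  proof -
    show *: "(\<lambda>n. h (Suc n)) summable_on UNIV" using that by (rule norm_summable_imp_summable_on)
    show "(\<lambda>n. norm (h (Suc n))) summable_on UNIV"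
      using that by (intro norm_summable_imp_summable_on) simp
    show "(\<Sum>\<^sub>\<infinity>n. h (Suc n)) = (\<Sum>n. h (Suc n))"
      using * by (metis has_sum_imp_sums has_sum_infsum sums_unique)
  qed
  define P where "P = (\<lambda>(m, n). f (Suc m) * g (Suc n))"
  have P: "(\<lambda>x. norm (P x)) summable_on UNIV \<times> UNIV"
  proof -
    have "(\<lambda>x. norm ((\<lambda>(m, n). f (Suc m) * g (Suc n)) x)) summable_on UNIV \<times> UNIV"
      using nn(2)[OF f] nn(2)[OF g]
      by (subst Infinite_Sum.abs_summable_on_Sigma_iff)
         (auto simp: norm_mult abs_mult infsum_cmult_right' intro!: summable_on_cmult_right summable_on_cmult_left)
    thus ?thesis by (simp add: P_def)
  qed
  have Ps: "P summable_on UNIV \<times> UNIV" using P by (rule abs_summable_summable)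
  have "infsum P (UNIV \<times> UNIV) = (\<Sum>\<^sub>\<infinity>m. \<Sum>\<^sub>\<infinity>n. f (Suc m) * g (Suc n))"
    using Ps unfolding P_def by (subst infsum_Sigma'_banach[symmetric]) auto
  also have "\<dots> = (\<Sum>n. f (Suc n)) * (\<Sum>n. g (Suc n))"
    by (simp add: infsum_cmult_right' infsum_cmult_left' nn(3)[OF f] nn(3)[OF g])
  finally have prod: "infsum P (UNIV \<times> UNIV) = (\<Sum>n. f (Suc n)) * (\<Sum>n. g (Suc n))" .
  define Q where "Q = (\<lambda>(n, d). f d * g (Suc n div d))"
  \<comment> \<open>The factors \<open>Suc m\<close> and \<open>Suc n\<close> are sent to their
    product together with the divisor \<open>Suc m\<close>; the subtraction of 1 undoes the
    convention that index \<open>n\<close> stands for \<open>Suc n\<close>.\<close>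
  define j where "j = (\<lambda>(m, n). ((Suc m * Suc n) - 1, Suc m))"
  have inj: "inj_on j (UNIV \<times> UNIV)"
  proof (rule inj_onI)
    fix x y :: "nat \<times> nat" assume "j x = j y"
    then obtain a b c d where xy: "x = (a, b)" "y = (c, d)" 
      and "a = c" "Suc a * Suc b - 1 = Suc c * Suc d - 1" by (cases x, cases y) (auto simp: j_def)
    hence "a = c" "Suc a * Suc b = Suc a * Suc d" by auto
    thus "x = y" using xy by (auto simp del: mult_Suc mult_Suc_right)
  qed
  have img: "j ` (UNIV \<times> UNIV) = Sigma UNIV (\<lambda>n. {d. d dvd Suc n})"
  proof (intro equalityI subsetI)
    fix x assume "x \<in> j ` (UNIV \<times> UNIV)"
    then obtain a b where "x = (Suc a * Suc b - 1, Suc a)" by (auto simp: j_def)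
    moreover have "Suc (Suc a * Suc b - 1) = Suc a * Suc b" by simp
    ultimately show "x \<in> Sigma UNIV (\<lambda>n. {d. d dvd Suc n})" by (metis SigmaI UNIV_I dvd_triv_left mem_Collect_eq)
  next
    fix x assume "x \<in> Sigma UNIV (\<lambda>n. {d. d dvd Suc n})"
    then obtain n d where x: "x = (n, d)" "d dvd Suc n" by auto
    then obtain e where e: "Suc n = d * e" by (elim dvdE)
    have de: "d > 0" "e > 0" using e by (auto intro!: Nat.gr0I)
    hence "Suc (d - 1) = d" "Suc (e - 1) = e" by auto
    hence "j (d - 1, e - 1) = (d * e - 1, d)" by (simp only: j_def prod.case)
    hence "x = j (d - 1, e - 1)" using e x by (metis diff_Suc_1)
    thus "x \<in> j ` (UNIV \<times> UNIV)" by blast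
  qed
  have Qj: "Q (j x) = P x" for x
  proof -
    obtain a b where x: "x = (a, b)" by (cases x)
    have "Suc (Suc a * Suc b - 1) = Suc a * Suc b" by simp
    thus ?thesis by (simp add: x j_def Q_def P_def del: mult_Suc mult_Suc_right)
  qed
  have Qs: "Q summable_on Sigma UNIV (\<lambda>n. {d. d dvd Suc n})"
    using Ps unfolding img[symmetric] by (subst summable_on_reindex[OF inj]) (simp add: o_def Qj)
  have Qi: "infsum Q (Sigma UNIV (\<lambda>n. {d. d dvd Suc n})) = infsum P (UNIV \<times> UNIV)"
    unfolding img[symmetric] by (subst infsum_reindex[OF inj]) (simp add: o_def Qj)
  have fin: "finite {d. d dvd Suc n}" for n by simp
  have Qs': "(\<lambda>(n, d). f d * g (Suc n div d)) summable_on (Sigma UNIV (\<lambda>n. {d. d dvd Suc n}))"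
    using Qs by (simp add: Q_def)
  have "((\<lambda>n. \<Sum>\<^sub>\<infinity>d\<in>{d. d dvd Suc n}. f d * g (Suc n div d)) has_sum
      (\<Sum>\<^sub>\<infinity>n. \<Sum>\<^sub>\<infinity>d\<in>{d. d dvd Suc n}. f d * g (Suc n div d))) UNIV"
    by (rule has_sum_infsum[OF summable_on_Sigma_banach[OF Qs']])
  also have "(\<Sum>\<^sub>\<infinity>n. \<Sum>\<^sub>\<infinity>d\<in>{d. d dvd Suc n}. f d * g (Suc n div d)) = infsum P (UNIV \<times> UNIV)"
    using infsum_Sigma'_banach[OF Qs'] Qi by (simp add: Q_def)
  finally have "((\<lambda>n. \<Sum>\<^sub>\<infinity>d\<in>{d. d dvd Suc n}. f d * g (Suc n div d)) has_sum infsum P (UNIV \<times> UNIV)) UNIV" .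
  hence "(\<lambda>n. \<Sum>\<^sub>\<infinity>d\<in>{d. d dvd Suc n}. f d * g (Suc n div d)) sums infsum P (UNIV \<times> UNIV)"
    by (rule has_sum_imp_sums)
  thus ?thesis using fin unfolding prod by simp
qed

lemma Lambda1_nonneg: "Lambda1 n \<ge> 0"
  unfolding Lambda1_def by (cases "n = 0") (auto intro!: divide_nonneg_nonneg mangoldt_nonneg)

lemma Lambda1_le_1: "Lambda1 n \<le> 1"
proof (cases "n \<le> 1")
  case True
  hence "n = 0 \<or> n = Suc 0" by auto
  thus ?thesis by (auto simp: Lambda1_def)
next
  case False thus ?thesis using mangoldt_le[of n] by (auto simp: Lambda1_def divide_simps)
qed

lemma abs_Lambda1_le_1: "\<bar>Lambda1 n\<bar> \<le> 1"
  using Lambda1_nonneg[of n] Lambda1_le_1[of n] by simp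

lemma Lambda1_times_ln: "n > 0 \<Longrightarrow> Lambda1 n * ln n = mangoldt n"
  by (cases "n = 1") (auto simp: Lambda1_def)

lemma zeta_dser: assumes "Re s > 1" shows "zeta s = dser (\<lambda>_. 1) s"
proof -
  have "(\<lambda>n. 1 / of_nat (Suc n) powr s) sums zeta s"
    using is_zeta_zeta assms by (auto simp: is_zeta_def)
  moreover have "1 / of_nat (Suc n) powr s = (of_nat (Suc n) powr (- s) :: complex)" for n
    by (simp add: powr_minus divide_inverse)
  ultimately show ?thesis by (simp add: dser_def sums_iff)
qed

lemma holomorphic_zeta: "zeta holomorphic_on (- {1})"
  using is_zeta_zeta by (simp add: is_zeta_def)

text \<open>This is zeta' = (zeta' / zeta) zeta: the von Mangoldt function summed over the divisors
  of n gives ln n, and \<open>Lambda1 n * ln n\<close> is the von Mangoldt function.\<close>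

lemma dser_log_deriv:
  assumes s: "Re s > 1"
  shows "dser (\<lambda>n. - 1 * ln n) s = dser (\<lambda>n. - Lambda1 n * ln n) s * dser (\<lambda>_. 1) s"
proof -
  define f where "f = (\<lambda>n. of_real (- Lambda1 n * ln n) * of_nat n powr (- s) :: complex)"
  define g where "g = (\<lambda>n. of_nat n powr (- s) :: complex)"
  have sf: "summable (\<lambda>n. norm (f (Suc n)))" unfolding f_def
    using dser_bounded_coeffs(2)[OF abs_Lambda1_le_1 s] by simp
  have sg: "summable (\<lambda>n. norm (g (Suc n)))" unfolding g_def
    using dser_bounded_coeffs(1)[OF _ s, of "\<lambda>_. 1"] by simp
  have "(\<Sum>d | d dvd Suc n. f d * g (Suc n div d)) = of_real (- 1 * ln (Suc n)) * of_nat (Suc n) powr (- s)" for n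
  proof -
    have "(\<Sum>d | d dvd Suc n. f d * g (Suc n div d)) = (\<Sum>d | d dvd Suc n. mangoldt d * (- (of_nat (Suc n) powr (- s))))"
    proof (rule sum.cong[OF refl])
      fix d assume "d \<in> {d. d dvd Suc n}"
      then obtain e where e: "Suc n = d * e" by (auto elim: dvdE)
      have d: "d > 0" using e by (auto intro!: Nat.gr0I)
      have "complex_of_real (- Lambda1 d * ln d) = - mangoldt d"
        using Lambda1_times_ln[OF d] by (metis mult_minus_left of_real_mangoldt of_real_minus)
      moreover have "of_nat (Suc n) powr (- s) = of_nat d powr (- s) * (of_nat e powr (- s) :: complex)"
        unfolding e by (subst powr_times_real[symmetric]) auto
      moreover have "Suc n div d = e" using e d by simp
      ultimately show "f d * g (Suc n div d) = mangoldt d * (- (of_nat (Suc n) powr (- s)))"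
        by (simp add: f_def g_def del: of_nat_Suc)
    qed
    also have "\<dots> = of_real (ln (Suc n)) * (- (of_nat (Suc n) powr (- s)))"
      by (subst sum_distrib_right[symmetric], subst mangoldt_sum) simp_all
    finally show ?thesis by simp
  qed
  with dirichlet_convolution_sums[OF sf sg] show ?thesis
    by (simp add: sums_iff dser_def f_def g_def)
qed

lemma norm_dser_le:
  assumes "\<And>n. \<bar>c n\<bar> \<le> 1" "Re s > 1"
  shows "norm (dser c s) \<le> (\<Sum>n. \<bar>c (Suc n)\<bar> * real (Suc n) powr (- Re s))"
  unfolding dser_def norm_dser_term[symmetric]
  by (rule summable_norm[OF dser_bounded_coeffs(1)[OF assms]])

text \<open>Beyond n = 1 the terms are compared with those at abscissa 2, which gains the factor
  \<open>2 powr (2 - \<sigma>)\<close>. The limit serves to fix constants of integration and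
  branches at plus infinity.\<close>

lemma dser_tendsto_at_top:
  assumes c: "\<And>n. \<bar>c n\<bar> \<le> 1"
  shows "((\<lambda>\<sigma>. dser c (Complex \<sigma> t)) \<longlongrightarrow> of_real (c 1)) at_top"
proof -
  define B where "B = (\<Sum>n. real (Suc (Suc n)) powr (- 2))"
  have sB: "summable (\<lambda>n. real (Suc (Suc n)) powr (- 2))"
    using summable_powr_Suc[of 2] by (subst summable_Suc_iff) simp
  have "norm (dser c (Complex \<sigma> t) - of_real (c 1)) \<le> 2 powr (2 - \<sigma>) * B" if \<sigma>: "\<sigma> \<ge> 2" for \<sigma>
  proof -
    define s where "s = Complex \<sigma> t"
    have sm: "summable (\<lambda>n. norm (of_real (c (Suc n)) * of_nat (Suc n) powr (- s) :: complex))"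
      using dser_bounded_coeffs(1)[OF c, of s] \<sigma> by (simp add: s_def)
    have "dser c s - of_real (c 1) = (\<Sum>n. of_real (c (Suc (Suc n))) * of_nat (Suc (Suc n)) powr (- s))"
      unfolding dser_def by (subst suminf_split_head[OF summable_norm_cancel[OF sm]]) simp
    also have "norm \<dots> \<le> (\<Sum>n. 2 powr (2 - \<sigma>) * real (Suc (Suc n)) powr (- 2))"
    proof (rule norm_suminf_le)
      fix n
      have "norm (of_real (c (Suc (Suc n))) * of_nat (Suc (Suc n)) powr (- s) :: complex) = \<bar>c (Suc (Suc n))\<bar> * real (Suc (Suc n)) powr (- \<sigma>)"
        by (subst norm_dser_term) (simp add: s_def)
      also have "\<dots> \<le> 1 * real (Suc (Suc n)) powr (- \<sigma>)"
        using c by (intro mult_right_mono) auto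
      also have "\<dots> = real (Suc (Suc n)) powr (2 - \<sigma>) * real (Suc (Suc n)) powr (- 2)"
        by (simp add: powr_add[symmetric])
      also have "\<dots> \<le> 2 powr (2 - \<sigma>) * real (Suc (Suc n)) powr (- 2)"
        using \<sigma> by (intro mult_right_mono powr_mono2') auto
      finally show "norm (of_real (c (Suc (Suc n))) * of_nat (Suc (Suc n)) powr (- s) :: complex) \<le> 2 powr (2 - \<sigma>) * real (Suc (Suc n)) powr (- 2)" .
    qed (intro summable_mult sB)
    also have "\<dots> = 2 powr (2 - \<sigma>) * B" unfolding B_def by (rule suminf_mult[OF sB])
    finally show ?thesis by (simp add: s_def)
  qed
  hence "\<forall>\<^sub>F \<sigma> in at_top. norm (dser c (Complex \<sigma> t) - of_real (c 1)) \<le> 2 powr (2 - \<sigma>) * B"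
    using eventually_ge_at_top by (rule eventually_mono[rotated]) auto
  moreover have "((\<lambda>\<sigma>::real. 2 powr (2 - \<sigma>) * B) \<longlongrightarrow> 0) at_top" by real_asymp
  ultimately have "((\<lambda>\<sigma>. dser c (Complex \<sigma> t) - of_real (c 1)) \<longlongrightarrow> 0) at_top"
    by (rule Lim_null_comparison)
  thus ?thesis by (simp add: Lim_null[symmetric])
qed

text \<open>By \<open>dser_log_deriv\<close> the quotient \<open>h\<close> of the two sides has
  derivative 0. Letting the abscissa grow identifies the constant as 1, because
  \<open>Lambda1 1 = 0\<close>.\<close>

lemma zeta_eq_exp:
  assumes s: "Re s > 1"
  shows "zeta s = exp (dser Lambda1 s)"
proof -
  define h where "h = (\<lambda>s. dser (\<lambda>_. 1) s * exp (- dser Lambda1 s))"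
  have "(h has_field_derivative 0) (at z)" if z: "Re z > 1" for z
  proof -
    have 1: "(dser (\<lambda>_. 1) has_field_derivative dser (\<lambda>n. - 1 * ln n) z) (at z)"
      by (rule dser_bounded_coeffs(3)[OF _ z]) simp
    have 2: "(dser Lambda1 has_field_derivative dser (\<lambda>n. - Lambda1 n * ln n) z) (at z)"
      by (rule dser_bounded_coeffs(3)[OF abs_Lambda1_le_1 z])
    show ?thesis unfolding h_def
      by (rule derivative_eq_intros refl 1 2)+ (use dser_log_deriv[OF z] in simp)
  qed
  hence "\<exists>c. \<forall>x\<in>{z. Re z > 1}. h x = c"
    by (intro has_field_derivative_zero_constant convex_halfspace_Re_gt) (auto intro: has_field_derivative_at_within)
  then obtain c where c: "\<And>z. Re z > 1 \<Longrightarrow> h z = c" by auto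
  have "((\<lambda>\<sigma>. h (Complex \<sigma> 0)) \<longlongrightarrow> of_real 1 * exp (- of_real (Lambda1 1))) at_top"
    unfolding h_def
    by (intro tendsto_intros tendsto_exp dser_tendsto_at_top[of "\<lambda>_. 1"] dser_tendsto_at_top abs_Lambda1_le_1) simp
  moreover have "Lambda1 1 = 0" by (simp add: Lambda1_def)
  ultimately have "((\<lambda>\<sigma>. h (Complex \<sigma> 0)) \<longlongrightarrow> 1) at_top" by simp
  moreover have "((\<lambda>\<sigma>. h (Complex \<sigma> 0)) \<longlongrightarrow> c) at_top"
    by (rule tendsto_eventually, rule eventually_mono[OF eventually_gt_at_top[of 1]]) (simp add: c)
  ultimately have "c = 1" using tendsto_unique trivial_limit_at_top_linorder by blast
  with c[OF s] show ?thesis by (simp add: h_def zeta_dser[OF s] exp_minus field_simps)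
qed


section \<open>The zeta function with its pole removed\<close>

definition zeta_reg :: "complex \<Rightarrow> complex" where
  "zeta_reg s = (if s = 1 then 1 else (s - 1) * zeta s)"

text \<open>One step of Landau's recursion: for \<open>Re s > 1\<close> the identity
  \<open>zrem_dzeta\<close> at \<open>m = 1\<close> rearranges to this, and both sides continue
  analytically. At \<open>s = 1\<close> every remainder vanishes, which agrees with the value 1, the
  residue of zeta.\<close>

lemma zeta_reg_series:
  assumes "Re s > 0"
  shows "zeta_reg s = 1 + (\<Sum>n. zrem 1 n s)"
proof -
  define G where "G = (\<lambda>s. 1 + (\<Sum>n. zrem 1 n s))"
  have hG: "G holomorphic_on {s. Re s > 0}"
    unfolding G_def using zrem_series(1)[of 1] by (intro holomorphic_intros) simp
  have op: "open ({s. Re s > 0} - {1::complex})"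
    by (intro open_Diff open_halfspace_Re_gt) auto
  have G: "G s = (s - 1) * zeta s" if s: "Re s > 1" for s
  proof -
    have "dzeta s = zeta s" using dzeta(2)[OF s] is_zeta_zeta s sums_unique2 by (fastforce simp: is_zeta_def)
    thus ?thesis unfolding G_def zrem_dzeta[OF s] by (simp add: ffac_def algebra_simps)
  qed
  show ?thesis
  proof (cases "s = 1")
    case True
    have "zrem 1 n 1 = 0" for n
    proof -
      have "{..1::nat} = {0, 1}" by auto
      thus ?thesis by (simp add: zrem_def ffac_def del: of_nat_Suc)
    qed
    thus ?thesis using True by (simp add: zeta_reg_def)
  next
    case False
    have "G s = (s - 1) * zeta s"
    proof (rule analytic_continuation_open[of "{s. Re s > 1}" "{s. Re s > 0} - {1}" G "\<lambda>s. (s - 1) * zeta s"])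
      show "{s. Re s > 1} \<noteq> {}" by (auto intro!: exI[of _ 2])
      show "connected ({s. Re s > 0} - {1::complex})"
        by (intro connected_open_delete open_halfspace_Re_gt convex_connected convex_halfspace_Re_gt) simp
      show "(\<lambda>s. (s - 1) * zeta s) holomorphic_on {s. Re s > 0} - {1}"
        by (intro holomorphic_intros holomorphic_on_subset[OF holomorphic_zeta]) auto
      show "G holomorphic_on {s. Re s > 0} - {1}" using hG by (rule holomorphic_on_subset) auto
    qed (use op assms False G in \<open>auto simp: open_halfspace_Re_gt\<close>)
    thus ?thesis using False by (simp add: zeta_reg_def G_def)
  qed
qed

lemma holomorphic_zeta_reg: "zeta_reg holomorphic_on A"
proof -
  have "zeta_reg holomorphic_on (- {1} \<union> {s. Re s > 0})"
  proof (rule holomorphic_on_Un)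
    have "(\<lambda>s. (s - 1) * zeta s) holomorphic_on (- {1})"
      by (intro holomorphic_intros holomorphic_zeta)
    thus "zeta_reg holomorphic_on (- {1})"
      by (rule holomorphic_transform) (auto simp: zeta_reg_def)
    have "(\<lambda>s. 1 + (\<Sum>n. zrem 1 n s)) holomorphic_on {s. Re s > 0}"
      using zrem_series(1)[of 1] by (intro holomorphic_intros) simp
    thus "zeta_reg holomorphic_on {s. Re s > 0}"
      by (rule holomorphic_transform) (auto simp: zeta_reg_series)
  qed (auto simp: open_halfspace_Re_gt)
  moreover have "- {1} \<union> {s. Re s > 0} = (UNIV :: complex set)" by auto
  ultimately have "zeta_reg holomorphic_on UNIV" by simp
  thus ?thesis by (rule holomorphic_on_subset) simp
qed

lemma continuous_zeta_reg: "isCont zeta_reg s"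
  using holomorphic_on_imp_continuous_on[OF holomorphic_zeta_reg[of UNIV]]
  by (simp add: continuous_on_eq_continuous_at)

text \<open>The remainders are bounded termwise by \<open>zrem_bound\<close>. The abscissa 1/8 is
  the left end 2 - 15/8 of the discs about 2 + i\<tau> in which the logarithm is estimated
  later.\<close>

lemma zeta_reg_growth:
  "\<exists>B>0. \<forall>s. Re s \<ge> 1 / 8 \<longrightarrow> norm (zeta_reg s) \<le> 1 + B * norm s * norm (s - 1)"
proof -
  define B where "B = (\<Sum>n. real (Suc n) powr (- (9 / 8)))"
  have sB: "summable (\<lambda>n. real (Suc n) powr (- (9 / 8)))" by (rule summable_powr_Suc) simp
  have B: "B > 0" unfolding B_def by (rule suminf_pos[OF sB]) simp
  have "norm (zeta_reg s) \<le> 1 + B * norm s * norm (s - 1)" if s: "Re s \<ge> 1 / 8" for s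
  proof -
    have "norm (\<Sum>n. zrem 1 n s) \<le> (\<Sum>n. norm s * norm (s - 1) * real (Suc n) powr (- (9 / 8)))"
    proof (rule norm_suminf_le)
      fix n
      have "norm (zrem 1 n s) \<le> norm (ffac (Suc 1) s) / fact 1 * real (Suc n) powr (1 - real 1 - Re s - 1)"
        using s by (intro zrem_bound) simp
      also have "norm (ffac (Suc 1) s) = norm s * norm (s - 1)"
        by (simp add: ffac_def norm_mult norm_minus_commute)
      also have "norm s * norm (s - 1) / fact 1 * real (Suc n) powr (1 - real 1 - Re s - 1) \<le>
          norm s * norm (s - 1) * real (Suc n) powr (- (9 / 8))"
        using s by (auto intro!: mult_left_mono powr_mono)
      finally show "norm (zrem 1 n s) \<le> norm s * norm (s - 1) * real (Suc n) powr (- (9 / 8))" .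
    qed (intro summable_mult sB)
    also have "\<dots> = B * norm s * norm (s - 1)"
      unfolding B_def by (subst suminf_mult[OF sB]) (simp add: mult_ac)
    finally show ?thesis
      using norm_triangle_ineq[of 1 "\<Sum>n. zrem 1 n s"] zeta_reg_series[of s] s by simp
  qed
  with B show ?thesis by blast
qed

section \<open>Nonvanishing on the line Re s = 1\<close>

lemma norm_zeta: "Re s > 1 \<Longrightarrow> norm (zeta s) = exp (Re (dser Lambda1 s))"
  by (simp add: zeta_eq_exp)

text \<open>The logarithm of the left side is a series whose terms are nonnegative weights times 3 +
  4 cos x + cos 2x = 2 (1 + cos x)^2.\<close>

lemma zeta_341:
  assumes \<sigma>: "\<sigma> > 1"
  shows "norm (zeta (of_real \<sigma>)) ^ 3 * norm (zeta (Complex \<sigma> t)) ^ 4 * norm (zeta (Complex \<sigma> (2 * t))) \<ge> 1"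
proof -
  define f where "f = (\<lambda>t n. of_real (Lambda1 (Suc n)) * of_nat (Suc n) powr (- Complex \<sigma> t) :: complex)"
  have sm: "summable (\<lambda>n. Re (f t n))" for t
    unfolding f_def using dser_bounded_coeffs(1)[OF abs_Lambda1_le_1, of "Complex \<sigma> t"] \<sigma>
    by (intro summable_Re, intro summable_norm_cancel[where f = "\<lambda>n. of_real (Lambda1 (Suc n)) * of_nat (Suc n) powr (- Complex \<sigma> t) :: complex"]) auto
  have d: "Re (dser Lambda1 (Complex \<sigma> t)) = (\<Sum>n. Re (f t n))" for t
    unfolding f_def dser_def
    using dser_bounded_coeffs(1)[OF abs_Lambda1_le_1, of "Complex \<sigma> t"] \<sigma>
    by (intro Re_suminf, intro summable_norm_cancel[where f = "\<lambda>n. of_real (Lambda1 (Suc n)) * of_nat (Suc n) powr (- Complex \<sigma> t) :: complex"]) auto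
  have "0 \<le> (\<Sum>n. 3 * Re (f 0 n) + 4 * Re (f t n) + Re (f (2 * t) n))"
  proof (rule suminf_nonneg)
    show "summable (\<lambda>n. 3 * Re (f 0 n) + 4 * Re (f t n) + Re (f (2 * t) n))"
      by (intro summable_add summable_mult sm)
    fix n
    have L: "Ln (of_nat (Suc n)) = complex_of_real (ln (real (Suc n)))" using Ln_of_nat[of "Suc n"] by simp
    have nz: "(of_nat (Suc n) :: complex) \<noteq> 0" by (simp del: of_nat_Suc)
    define x where "x = t * ln (real (Suc n))"
    have Re: "Re (f t n) = Lambda1 (Suc n) * real (Suc n) powr (- \<sigma>) * cos (t * ln (real (Suc n)))" for t
      using nz L by (simp add: f_def powr_def Re_exp mult_ac del: of_nat_Suc)
    have "3 + 4 * cos x + cos (2 * x) = 2 * (1 + cos x)\<^sup>2"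
      using cos_double_cos[of x] by (simp add: power2_eq_square algebra_simps)
    hence "3 + 4 * cos x + cos (2 * x) \<ge> 0" by simp
    hence "0 \<le> Lambda1 (Suc n) * real (Suc n) powr (- \<sigma>) * (3 + 4 * cos x + cos (2 * x))"
      using Lambda1_nonneg[of "Suc n"] by simp
    also have "\<dots> = 3 * Re (f 0 n) + 4 * Re (f t n) + Re (f (2 * t) n)"
      by (simp add: Re x_def algebra_simps)
    finally show "0 \<le> 3 * Re (f 0 n) + 4 * Re (f t n) + Re (f (2 * t) n)" .
  qed
  also have "\<dots> = 3 * Re (dser Lambda1 (Complex \<sigma> 0)) + 4 * Re (dser Lambda1 (Complex \<sigma> t)) + Re (dser Lambda1 (Complex \<sigma> (2 * t)))"
    unfolding d by (simp add: suminf_add[symmetric] suminf_mult sm summable_add summable_mult)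
  finally have *: "0 \<le> 3 * Re (dser Lambda1 (Complex \<sigma> 0)) + 4 * Re (dser Lambda1 (Complex \<sigma> t)) + Re (dser Lambda1 (Complex \<sigma> (2 * t)))" .
  have "norm (zeta (of_real \<sigma>)) ^ 3 * norm (zeta (Complex \<sigma> t)) ^ 4 * norm (zeta (Complex \<sigma> (2 * t))) =
    exp (3 * Re (dser Lambda1 (Complex \<sigma> 0)) + 4 * Re (dser Lambda1 (Complex \<sigma> t)) + Re (dser Lambda1 (Complex \<sigma> (2 * t))))"
    using \<sigma> by (simp add: norm_zeta complex_of_real_def exp_add exp_of_nat_mult[symmetric])
  thus ?thesis using * by simp
qed

lemma zeta_reg_nonzero_Re_gt_1: "Re s > 1 \<Longrightarrow> zeta_reg s \<noteq> 0"
  by (auto simp: zeta_reg_def zeta_eq_exp)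

text \<open>\<open>riemann_hypothesis\<close> speaks of the open strip, so its right edge is treated
  here. With a zero at 1 + it, the triple pole in \<open>zeta_341\<close> would be outweighed by a
  zero of order at least four, and the product would tend to 0.\<close>

lemma zeta_reg_nonzero_Re_1: "zeta_reg (Complex 1 t) \<noteq> 0"
proof (cases "t = 0")
  case True thus ?thesis by (simp add: zeta_reg_def complex_eq_iff)
next
  case t: False
  show ?thesis
  proof
    assume z: "zeta_reg (Complex 1 t) = 0"
    define q where "q = (\<lambda>\<sigma>. zeta_reg (Complex \<sigma> t) / of_real (\<sigma> - 1))"
    have "(zeta_reg has_field_derivative deriv zeta_reg (Complex 1 t)) (at (Complex 1 t))"
      by (rule holomorphic_derivI[OF holomorphic_zeta_reg[of UNIV]]) auto
    hence "((\<lambda>h. (zeta_reg (Complex 1 t + h) - zeta_reg (Complex 1 t)) / h) \<longlongrightarrow> deriv zeta_reg (Complex 1 t)) (at 0)"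
      by (simp add: DERIV_def)
    hence 0: "((\<lambda>h. zeta_reg (Complex 1 t + h) / h) \<longlongrightarrow> deriv zeta_reg (Complex 1 t)) (at 0)"
      using z by simp
    have f: "filterlim (\<lambda>\<sigma>::real. complex_of_real (\<sigma> - 1)) (at 0) (at_right 1)"
      unfolding filterlim_at
    proof
      show "\<forall>\<^sub>F x in at_right 1. complex_of_real (x - 1) \<in> UNIV \<and> complex_of_real (x - 1) \<noteq> 0"
        using eventually_at_right_less[of "1::real"] by eventually_elim auto
      have "((\<lambda>\<sigma>::real. complex_of_real (\<sigma> - 1)) \<longlongrightarrow> of_real (1 - 1)) (at_right 1)"
        by (intro tendsto_intros)
      thus "((\<lambda>\<sigma>::real. complex_of_real (\<sigma> - 1)) \<longlongrightarrow> 0) (at_right 1)" by simp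
    qed
    have "((\<lambda>\<sigma>. zeta_reg (Complex 1 t + of_real (\<sigma> - 1)) / of_real (\<sigma> - 1)) \<longlongrightarrow> deriv zeta_reg (Complex 1 t)) (at_right 1)"
      by (rule filterlim_compose[OF 0 f])
    moreover have "Complex 1 t + of_real (\<sigma> - 1) = Complex \<sigma> t" for \<sigma> by (simp add: complex_eq_iff)
    ultimately have q: "(q \<longlongrightarrow> deriv zeta_reg (Complex 1 t)) (at_right 1)" by (simp add: q_def del: of_real_diff)
    have c: "((\<lambda>\<sigma>. zeta_reg (Complex \<sigma> u)) \<longlongrightarrow> zeta_reg (Complex 1 u)) (at_right 1)" for u
      by (rule isCont_tendsto_compose[OF continuous_zeta_reg]) (intro tendsto_intros)
    \<comment> \<open>Written with \<open>zeta_reg\<close> and \<open>q\<close>, the product of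
      \<open>zeta_341\<close> carries a single factor \<open>\<sigma> - 1\<close>, which forces the
      limit 0; the distances to 1 that are left over give the lower bound
      \<open>2 * \<bar>t\<bar> ^ 5\<close> below.\<close>
    have "((\<lambda>\<sigma>. (\<sigma> - 1) * norm (zeta_reg (of_real \<sigma>)) ^ 3 * norm (q \<sigma>) ^ 4 * norm (zeta_reg (Complex \<sigma> (2 * t)))) \<longlongrightarrow>
       (1 - 1) * norm (zeta_reg (Complex 1 0)) ^ 3 * norm (deriv zeta_reg (Complex 1 t)) ^ 4 * norm (zeta_reg (Complex 1 (2 * t)))) (at_right 1)"
      using c[of 0] by (intro tendsto_intros q c) (simp add: complex_of_real_def)
    hence lim0: "((\<lambda>\<sigma>. (\<sigma> - 1) * norm (zeta_reg (of_real \<sigma>)) ^ 3 * norm (q \<sigma>) ^ 4 * norm (zeta_reg (Complex \<sigma> (2 * t)))) \<longlongrightarrow> 0) (at_right 1)"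
      by simp
    have "\<forall>\<^sub>F \<sigma> in at_right 1. 2 * \<bar>t\<bar> ^ 5 \<le> (\<sigma> - 1) * norm (zeta_reg (of_real \<sigma>)) ^ 3 * norm (q \<sigma>) ^ 4 * norm (zeta_reg (Complex \<sigma> (2 * t)))"
      using eventually_at_right_less[of "1::real"]
    proof eventually_elim
      case (elim \<sigma>)
      have im: "norm (Complex \<sigma> u - 1) \<ge> \<bar>u\<bar>" for u using abs_Im_le_cmod[of "Complex \<sigma> u - 1"] by simp
      have z0: "norm (zeta_reg (of_real \<sigma>)) = (\<sigma> - 1) * norm (zeta (of_real \<sigma>))"
        using elim norm_of_real[of "\<sigma> - 1", where ?'a = complex] by (simp add: zeta_reg_def norm_mult)
      have zt: "norm (zeta_reg (Complex \<sigma> u)) = norm (Complex \<sigma> u - 1) * norm (zeta (Complex \<sigma> u))" for u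
        using elim by (auto simp: zeta_reg_def norm_mult complex_eq_iff)
      have q': "norm (q \<sigma>) = norm (Complex \<sigma> t - 1) * norm (zeta (Complex \<sigma> t)) / (\<sigma> - 1)"
        using elim by (simp add: q_def norm_divide zt del: of_real_diff)
      define A where "A = norm (zeta (of_real \<sigma>)) ^ 3 * norm (zeta (Complex \<sigma> t)) ^ 4 * norm (zeta (Complex \<sigma> (2 * t)))"
      have A: "A \<ge> 1" unfolding A_def by (rule zeta_341[OF elim])
      have "2 * \<bar>t\<bar> ^ 5 = \<bar>t\<bar> ^ 4 * \<bar>2 * t\<bar> * 1" by (simp add: numeral_eq_Suc abs_mult)
      also have "\<dots> \<le> norm (Complex \<sigma> t - 1) ^ 4 * norm (Complex \<sigma> (2 * t) - 1) * A"
        using im A by (intro mult_mono power_mono) auto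
      also have "\<dots> = (\<sigma> - 1) * norm (zeta_reg (of_real \<sigma>)) ^ 3 * norm (q \<sigma>) ^ 4 * norm (zeta_reg (Complex \<sigma> (2 * t)))"
      proof -
        have alg: "X ^ 4 * Y * (a ^ 3 * b ^ 4 * c) = w * (w * a) ^ 3 * (X * b / w) ^ 4 * (Y * c)" if "w \<noteq> 0" for X Y a b c w :: real
        proof -
          have 1: "w * w ^ 3 / w ^ 4 = 1" using that by (simp add: eval_nat_numeral)
          have 2: "w * (w * a) ^ 3 * (X * b / w) ^ 4 * (Y * c) = (w * w ^ 3 / w ^ 4) * (X ^ 4 * Y * (a ^ 3 * b ^ 4 * c))"
            by (simp add: power_mult_distrib power_divide)
          show ?thesis unfolding 2 1 by simp
        qed
        show ?thesis unfolding z0 zt q' A_def using elim by (intro alg) simp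
      qed
      finally show ?case .
    qed
    hence "2 * \<bar>t\<bar> ^ 5 \<le> 0"
      by (rule tendsto_lowerbound[OF lim0]) simp
    thus False using t by (simp add: zero_less_power not_le[symmetric]) 
  qed
qed

lemma RH_zeta_reg_nonzero:
  assumes "riemann_hypothesis" "Re s > 1 / 2"
  shows "zeta_reg s \<noteq> 0"
proof -
  consider "Re s > 1" | "Re s = 1" | "Re s < 1" by linarith
  thus ?thesis
  proof cases
    case 2 thus ?thesis using zeta_reg_nonzero_Re_1[of "Im s"] by (metis complex.collapse)
  next
    case 3
    hence "zeta s \<noteq> 0" using assms by (force simp: riemann_hypothesis_def)
    moreover have "s \<noteq> 1" using 3 by auto
    ultimately show ?thesis by (simp add: zeta_reg_def)
  qed (rule zeta_reg_nonzero_Re_gt_1)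
qed

section \<open>Logarithms of holomorphic functions in discs\<close>

text \<open>By Schwarz's lemma, dividing out a zero by a Blaschke factor does not increase the sup norm.\<close>

lemma Blaschke_divide:
  assumes f: "f holomorphic_on ball 0 1" and K: "\<And>z. z \<in> ball 0 1 \<Longrightarrow> norm (f z) \<le> K"
    and a: "norm a < 1" "f a = 0"
  obtains h where "h holomorphic_on ball 0 1" "\<And>z. z \<in> ball 0 1 \<Longrightarrow> norm (h z) \<le> K"
    "\<And>z. z \<in> ball 0 1 \<Longrightarrow> f z = Moebius_function 0 a z * h z"
proof -
  have nz: "1 - cnj a * z \<noteq> 0" if "norm z < 1" for z
  proof
    assume "1 - cnj a * z = 0"
    hence "norm (cnj a * z) = 1" by (metis eq_iff_diff_eq_0 norm_one)
    moreover have "norm (cnj a * z) < 1" using a that norm_mult_less[of "cnj a" 1 z 1] by simp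
    ultimately show False by simp
  qed
  define g where "g = (\<lambda>z. if z = a then deriv f a else (f z - f a) / (z - a))"
  have g: "g holomorphic_on ball 0 1" unfolding g_def by (rule pole_lemma_open[OF f]) simp
  define h where "h = (\<lambda>z. (1 - cnj a * z) * g z)"
  have h: "h holomorphic_on ball 0 1" unfolding h_def by (intro holomorphic_intros g)
  have fh: "f z = Moebius_function 0 a z * h z" if "z \<in> ball 0 1" for z
    using nz[of z] that a by (auto simp: h_def g_def Moebius_function_def)
  \<comment> \<open>Schwarz's lemma asks for norms strictly below 1, hence the slack
    \<open>K' > K\<close>; it is removed below by letting \<open>K'\<close> tend to
    \<open>K\<close>.\<close>
  have le: "norm (f z) \<le> K' * norm (Moebius_function 0 a z)" if z: "z \<in> ball 0 1" and K': "K' > K" for z K'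
  proof -
    have K'0: "K' > 0" using K[of 0] K' norm_ge_zero[of "f 0"] by (simp del: norm_ge_zero)
    define F where "F = (\<lambda>z. f (Moebius_function 0 (- a) z) / of_real K')"
    have M: "Moebius_function 0 (- a) holomorphic_on ball 0 1" using a by (intro Moebius_function_holomorphic) simp
    have "f \<circ> Moebius_function 0 (- a) holomorphic_on ball 0 1"
      using a by (intro holomorphic_on_compose_gen[OF M f]) (auto intro!: Moebius_function_norm_lt_1)
    hence F: "F holomorphic_on ball 0 1"
      unfolding F_def o_def using K'0 by (intro holomorphic_intros) auto
    have F0: "F 0 = 0" using a by (simp add: F_def Moebius_function_def)
    have F1: "norm (F z) < 1" if "norm z < 1" for z
    proof -
      have "norm (f (Moebius_function 0 (- a) z)) \<le> K"
        using that a by (intro K) (auto intro!: Moebius_function_norm_lt_1)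
      thus ?thesis using K' K'0 by (simp add: F_def norm_divide)
    qed
    define w where "w = Moebius_function 0 a z"
    have w: "norm w < 1" unfolding w_def using z a by (intro Moebius_function_norm_lt_1) auto
    have "norm (F w) \<le> norm w" by (rule Schwarz_Lemma(1)[OF F F0 F1 w])
    moreover have "Moebius_function 0 (- a) w = z"
      unfolding w_def using z a by (intro Moebius_function_compose) auto
    ultimately show ?thesis using K'0 by (simp add: F_def norm_divide w_def field_simps)
  qed
  have hb': "norm (h z) \<le> K" if z: "z \<in> ball 0 1" "z \<noteq> a" for z
  proof (rule field_le_epsilon)
    fix e :: real assume e: "e > 0"
    have "norm (f z) \<le> (K + e) * norm (Moebius_function 0 a z)" using le[OF z(1), of "K + e"] e by simp
    moreover have "Moebius_function 0 a z \<noteq> 0" using z nz[of z] by (simp add: Moebius_function_def)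
    ultimately show "norm (h z) \<le> K + e" using fh[OF z(1)] by (simp add: norm_mult mult.commute)
  qed
  \<comment> \<open>At \<open>a\<close> itself the Moebius factor vanishes and cannot be divided
    out, so the bound comes from continuity.\<close>
  have hb: "norm (h z) \<le> K" if z: "z \<in> ball 0 1" for z
  proof (cases "z = a")
    case True
    have "isCont h a"
      using h a holomorphic_on_imp_continuous_on continuous_on_interior[of "ball 0 1" h a] by simp
    hence "(h \<longlongrightarrow> h a) (at a)" by (simp add: isCont_def)
    hence "((\<lambda>z. norm (h z)) \<longlongrightarrow> norm (h a)) (at a)" by (rule tendsto_norm)
    moreover have "\<forall>\<^sub>F z in at a. norm (h z) \<le> K"
    proof -
      have "\<forall>\<^sub>F z in at a. z \<in> ball 0 1 \<and> z \<noteq> a"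
        using a eventually_at_in_open[of "ball 0 1" a] by (auto elim!: eventually_mono)
      thus ?thesis by eventually_elim (use hb' in auto)
    qed
    ultimately show ?thesis using True tendsto_upperbound[of "\<lambda>z. norm (h z)" "norm (h a)" "at a" K] by auto
  qed (use hb' z in auto)
  show ?thesis using that[OF h hb fh] by simp
qed

text \<open>The map w / (2 M' - w) takes the half-plane Re w < M' into the unit disc and fixes 0, so
  Schwarz's lemma applies to its composition with \<open>g\<close>; solving for
  \<open>norm (g z)\<close> gives the bound.\<close>

lemma Borel_Caratheodory_unit:
  assumes g: "g holomorphic_on ball 0 1" "g 0 = 0" and M: "\<And>z. z \<in> ball 0 1 \<Longrightarrow> Re (g z) \<le> M"
    and z: "norm z < 1"
  shows "norm (g z) \<le> 2 * M * norm z / (1 - norm z)"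
proof -
  have M0: "M \<ge> 0" using M[of 0] g by simp
  have main: "norm (g z) \<le> 2 * M' * norm z / (1 - norm z)" if M': "M' > M" for M'
  proof -
    have M'0: "M' > 0" using M' M0 by simp
    define \<psi> where "\<psi> = (\<lambda>z. g z / (2 * of_real M' - g z))"
    have nz: "2 * of_real M' - g z \<noteq> 0" if "z \<in> ball 0 1" for z
    proof
      assume "2 * of_real M' - g z = 0"
      hence "Re (g z) = 2 * M'" by (simp add: complex_eq_iff)
      thus False using M[OF that] M' M'0 by simp
    qed
    have h: "\<psi> holomorphic_on ball 0 1" unfolding \<psi>_def by (intro holomorphic_intros g nz)
    have l: "norm (\<psi> z) < 1" if "norm z < 1" for z
    proof -
      define x y where "x = Re (g z)" and "y = Im (g z)"
      have x: "x < M'" using M[of z] M' that by (simp add: x_def)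
      have "(norm (g z))\<^sup>2 < (norm (2 * of_real M' - g z))\<^sup>2"
      proof -
        have "(norm (2 * of_real M' - g z))\<^sup>2 - (norm (g z))\<^sup>2 = 4 * M' * (M' - x)"
          unfolding cmod_power2 by (simp add: x_def power2_eq_square algebra_simps)
        thus ?thesis using x M'0 by (smt (verit) mult_pos_pos)
      qed
      hence "norm (g z) < norm (2 * of_real M' - g z)" by (rule power2_less_imp_less) simp
      thus ?thesis using nz[of z] that by (simp add: \<psi>_def norm_divide)
    qed
    have "norm (\<psi> z) \<le> norm z"
      by (rule Schwarz_Lemma(1)[OF h _ l z]) (simp add: \<psi>_def g)
    hence "norm (g z) \<le> norm z * norm (2 * of_real M' - g z)"
      using nz[of z] z by (simp add: \<psi>_def norm_divide field_simps)
    also have "norm (2 * of_real M' - g z) \<le> 2 * M' + norm (g z)"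
      using norm_triangle_ineq4[of "2 * of_real M'" "g z"] M'0 by simp
    finally have "norm (g z) \<le> norm z * (2 * M' + norm (g z))" by (simp add: mult_left_mono)
    thus ?thesis using z by (simp add: field_simps)
  qed
  show ?thesis
  proof (rule field_le_epsilon)
    fix e :: real assume e: "e > 0"
    \<comment> \<open>Chosen so that the excess of \<open>M'\<close> over \<open>M\<close> adds at
      most \<open>e\<close> to the bound.\<close>
    define M' where "M' = M + e * (1 - norm z) / (2 * (norm z + 1))"
    have "e * (1 - norm z) / (2 * (norm z + 1)) > 0" using e z by (intro divide_pos_pos mult_pos_pos) (auto intro: add_nonneg_pos)
    hence "M' > M" by (simp add: M'_def)
    from main[OF this] have "norm (g z) \<le> 2 * M' * norm z / (1 - norm z)" .
    also have "\<dots> = 2 * M * norm z / (1 - norm z) + e * (norm z / (norm z + 1))"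
    proof -
      have *: "2 * (M + e * w / (2 * v)) * x / w = 2 * M * x / w + e * (x / v)" if "w \<noteq> 0" "v \<noteq> 0" for w v x :: real
        using that by (simp add: field_simps)
      have "norm z + 1 \<noteq> 0" using norm_ge_zero[of z] by linarith
      thus ?thesis unfolding M'_def using z by (intro *) auto
    qed
    also have "\<dots> \<le> 2 * M * norm z / (1 - norm z) + e * 1"
      using e by (intro add_left_mono mult_left_mono) (auto simp: divide_simps add_nonneg_pos)
    finally show "norm (g z) \<le> 2 * M * norm z / (1 - norm z) + e" by simp
  qed
qed

text \<open>Zeros are divided out one at a time. Each factor has norm at most \<open>q\<close> at 0
  while the quotient stays bounded by \<open>K\<close>, so the number of factors is bounded, as in
  Jensen's formula. A list of maximal length therefore exists, and maximality leaves
  \<open>h\<close> without zeros in the closed disc of radius \<open>q\<close>; repetitions in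
  \<open>xs\<close> account for multiplicities.\<close>

lemma Blaschke_list:
  assumes f: "f holomorphic_on ball 0 1" and K: "\<And>z. z \<in> ball 0 1 \<Longrightarrow> norm (f z) \<le> K"
    and f0: "f 0 \<noteq> 0" and q: "0 < q" "q < 1"
  obtains xs h where "set xs \<subseteq> {z. norm z \<le> q \<and> f z = 0}" "h holomorphic_on ball 0 1"
    "\<And>z. z \<in> ball 0 1 \<Longrightarrow> norm (h z) \<le> K"
    "\<And>z. z \<in> ball 0 1 \<Longrightarrow> f z = (\<Prod>a\<leftarrow>xs. Moebius_function 0 a z) * h z"
    "\<And>z. norm z \<le> q \<Longrightarrow> h z \<noteq> 0" "norm (f 0) \<le> norm (h 0)"
    "real (length xs) * ln (1 / q) \<le> ln (K / norm (f 0))"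
proof -
  define P where "P = (\<lambda>xs h. set xs \<subseteq> {z. norm z \<le> q \<and> f z = 0} \<and> h holomorphic_on ball 0 1 \<and>
    (\<forall>z\<in>ball 0 1. norm (h z) \<le> K) \<and> (\<forall>z\<in>ball 0 1. f z = (\<Prod>a\<leftarrow>xs. Moebius_function 0 a z) * h z))"
  have P0: "P [] f" using f K by (simp add: P_def)
  have h0: "norm (f 0) \<le> q ^ length xs * norm (h 0)" if "P xs h" for xs h
  proof -
    have "norm (\<Prod>a\<leftarrow>xs. Moebius_function 0 a 0) \<le> q ^ length xs" if "set xs \<subseteq> {z. norm z \<le> q}" for xs
      using that
    proof (induction xs)
      case (Cons a xs)
      thus ?case using q by (auto simp: norm_mult Moebius_function_of_zero intro!: mult_mono)
    qed simp
    from this[of xs] have "norm (\<Prod>a\<leftarrow>xs. Moebius_function 0 a 0) \<le> q ^ length xs"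
      using \<open>P xs h\<close> by (auto simp: P_def)
    moreover have "f 0 = (\<Prod>a\<leftarrow>xs. Moebius_function 0 a 0) * h 0" using \<open>P xs h\<close> by (simp add: P_def)
    ultimately show ?thesis by (simp add: norm_mult mult_right_mono)
  qed
  have K0: "K > 0" using K[of 0] f0 by (metis centre_in_ball dual_order.strict_trans1 zero_less_norm_iff zero_less_one)
  have len: "real (length xs) * ln (1 / q) \<le> ln (K / norm (f 0))" if "P xs h" for xs h
  proof -
    have "norm (f 0) \<le> q ^ length xs * K"
      using that q by (intro order_trans[OF h0[OF that]] mult_left_mono) (auto simp: P_def)
    hence "(1 / q) ^ length xs \<le> K / norm (f 0)"
      using q f0 by (simp add: field_simps)
    hence "ln ((1 / q) ^ length xs) \<le> ln (K / norm (f 0))"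
      using q K0 f0 by (subst ln_le_cancel_iff) auto
    thus ?thesis using q by (simp add: ln_realpow)
  qed
  define N where "N = nat \<lceil>ln (K / norm (f 0)) / ln (1 / q)\<rceil>"
  have lq: "ln (1 / q) > 0" using q by simp
  have bnd: "length xs \<le> N" if "P xs h" for xs h
  proof -
    have "real (length xs) \<le> ln (K / norm (f 0)) / ln (1 / q)"
      using len[OF that] lq by (simp add: field_simps)
    thus ?thesis unfolding N_def by linarith
  qed
  have "\<exists>m. (\<exists>xs h. P xs h \<and> length xs = m) \<and> (\<forall>y. (\<exists>xs h. P xs h \<and> length xs = y) \<longrightarrow> y \<le> m)"
    by (rule Nat.ex_has_greatest_nat[of "\<lambda>m. \<exists>xs h. P xs h \<and> length xs = m" 0 N]) (use P0 bnd in auto)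
  then obtain xs h where P: "P xs h" and mx: "\<And>ys k. P ys k \<Longrightarrow> length ys \<le> length xs" by blast
  have nz: "h z \<noteq> 0" if z: "norm z \<le> q" for z
  proof
    assume hz: "h z = 0"
    have z1: "norm z < 1" using z q by simp
    obtain k where k: "k holomorphic_on ball 0 1" "\<And>z. z \<in> ball 0 1 \<Longrightarrow> norm (k z) \<le> K"
      "\<And>w. w \<in> ball 0 1 \<Longrightarrow> h w = Moebius_function 0 z w * k w"
      using Blaschke_divide[of h K z] P z1 hz by (auto simp: P_def)
    have "f z = 0" using P hz z1 by (auto simp: P_def)
    hence "P (z # xs) k" using P k z by (auto simp: P_def mult_ac)
    from mx[OF this] show False by simp
  qed
  have "norm (f 0) \<le> 1 * norm (h 0)"
    using q by (intro order_trans[OF h0[OF P]] mult_right_mono power_le_one) auto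
  thus ?thesis using that[of xs h] P nz len[OF P] by (auto simp: P_def)
qed


text \<open>The difference takes values in the multiples of 2 pi i, a discrete set. This matches
  branches of a logarithm that are built by different means.\<close>

lemma exp_eq_imp_diff_constant:
  fixes f g :: "'a::topological_space \<Rightarrow> complex"
  assumes S: "connected S" and f: "continuous_on S f" and g: "continuous_on S g"
    and eq: "\<And>z. z \<in> S \<Longrightarrow> exp (f z) = exp (g z)"
  obtains c where "\<And>z. z \<in> S \<Longrightarrow> f z = g z + c"
proof -
  have n: "\<exists>n::int. f z - g z = of_int (2 * n) * of_real pi * \<i>" if "z \<in> S" for z
    using eq[OF that] by (auto simp: exp_eq)
  have "(\<lambda>z. f z - g z) constant_on S"
  proof (rule continuous_discrete_range_constant[OF S])
    show "continuous_on S (\<lambda>z. f z - g z)" by (intro continuous_intros f g)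
    fix x assume x: "x \<in> S"
    have "pi \<le> norm ((f y - g y) - (f x - g x))" if y: "y \<in> S" "f y - g y \<noteq> f x - g x" for y
    proof -
      obtain m n :: int where mn: "f x - g x = of_int (2 * n) * of_real pi * \<i>" "f y - g y = of_int (2 * m) * of_real pi * \<i>"
        using n x y by metis
      have eq: "(f y - g y) - (f x - g x) = of_real (2 * of_int (m - n) * pi) * \<i>"
        unfolding mn by (simp add: algebra_simps)
      have "m \<noteq> n" using y mn by auto
      hence "1 \<le> \<bar>real_of_int (m - n)\<bar>" by linarith
      hence "pi * 1 \<le> pi * (2 * \<bar>real_of_int (m - n)\<bar>)" by (intro mult_left_mono) auto
      also have "\<dots> = norm ((f y - g y) - (f x - g x))"
        unfolding eq norm_mult norm_of_real by (simp add: abs_mult del: of_int_diff)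
      finally show ?thesis by simp
    qed
    thus "\<exists>e>0. \<forall>y. y \<in> S \<and> f y - g y \<noteq> f x - g x \<longrightarrow> e \<le> norm ((f y - g y) - (f x - g x))"
      using pi_gt_zero by blast
  qed
  then obtain c where "\<And>z. z \<in> S \<Longrightarrow> f z - g z = c" by (auto simp: constant_on_def)
  thus ?thesis by (intro that[of c]) (metis add.commute diff_add_cancel)
qed

lemma abs_Im_Ln_le_pi: "z \<noteq> 0 \<Longrightarrow> \<bar>Im (Ln z)\<bar> \<le> pi"
  using mpi_less_Im_Ln[of z] Im_Ln_le_pi[of z] by linarith

lemma norm_Ln_le:
  assumes "\<delta> \<le> norm z" "norm z \<le> 2" "0 < \<delta>" "\<delta> \<le> 1 / 2"
  shows "norm (Ln z) \<le> ln (1 / \<delta>) + pi"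
proof -
  have z: "z \<noteq> 0" using assms by auto
  have "ln \<delta> \<le> ln (norm z)" "ln (norm z) \<le> ln 2" using assms z by (simp_all add: ln_le_cancel_iff)
  moreover have "ln \<delta> \<le> ln (1 / 2)" using assms by (subst ln_le_cancel_iff) auto
  hence "ln 2 \<le> - ln \<delta>" by (simp add: ln_div)
  ultimately have "\<bar>Re (Ln z)\<bar> \<le> ln (1 / \<delta>)" using assms by (simp add: Re_Ln[OF z] ln_div)
  thus ?thesis using cmod_le[of "Ln z"] abs_Im_Ln_le_pi[OF z] by linarith
qed

text \<open>
  All zeros lie to the left of the line \<open>Re z = b\<close>, so to its right every factor \<open>z - a\<close> has a
  principal logarithm, whose imaginary part is bounded however close \<open>z\<close> comes to \<open>a\<close>.
\<close>

lemma log_disc_bound: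
  assumes f: "f holomorphic_on ball 0 1" and K: "\<And>z. z \<in> ball 0 1 \<Longrightarrow> norm (f z) \<le> K"
    and b: "b < 0" and zeros: "\<And>a. norm a < 1 \<Longrightarrow> f a = 0 \<Longrightarrow> Re a \<le> b"
    and l: "continuous_on {z. norm z < 1 \<and> Re z > b} l" 
    and fl: "\<And>z. norm z < 1 \<Longrightarrow> Re z > b \<Longrightarrow> f z = exp (l z)"
    and z: "norm z \<le> 4 / 5" "Re z > b"
  shows "\<bar>Im (l z) - Im (l 0)\<bar> \<le> (16 + 3 * pi / ln (10 / 9)) * ln (K / norm (f 0))"
    and "\<And>\<delta>. 0 < \<delta> \<Longrightarrow> \<delta> \<le> 1 / 10 \<Longrightarrow> \<delta> \<le> - b \<Longrightarrow> \<delta> \<le> Re z - b \<Longrightarrow>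
      norm (l z - l 0) \<le> (16 + 3 * (ln (1 / \<delta>) + pi) / ln (10 / 9)) * ln (K / norm (f 0))"
proof -
  define M where "M = ln (K / norm (f 0))"
  have f0: "f 0 \<noteq> 0" using fl[of 0] b by simp
  have K0: "K \<ge> norm (f 0)" "norm (f 0) > 0" using K[of 0] f0 by auto
  obtain xs h where xs: "set xs \<subseteq> {z. norm z \<le> 9 / 10 \<and> f z = 0}" and h: "h holomorphic_on ball 0 1"
    "\<And>z. z \<in> ball 0 1 \<Longrightarrow> norm (h z) \<le> K"
    and fh: "\<And>z. z \<in> ball 0 1 \<Longrightarrow> f z = (\<Prod>a\<leftarrow>xs. Moebius_function 0 a z) * h z"
    and hnz: "\<And>z. norm z \<le> 9 / 10 \<Longrightarrow> h z \<noteq> 0" and h0: "norm (f 0) \<le> norm (h 0)"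
    and len: "real (length xs) * ln (1 / (9 / 10)) \<le> M"
    using Blaschke_list[OF f K f0, of "9 / 10"] unfolding M_def by auto
  have n: "real (length xs) \<le> M / ln (10 / 9)" using len by (simp add: field_simps)
  have M0: "M \<ge> 0" unfolding M_def using K0 by simp
  have hb: "h holomorphic_on ball 0 (9 / 10)" using h(1) by (rule holomorphic_on_subset) auto
  obtain g where g: "g holomorphic_on ball 0 (9 / 10)" "\<And>z. z \<in> ball 0 (9 / 10) \<Longrightarrow> h z = exp (g z)"
    by (rule contractible_imp_holomorphic_log[OF hb convex_imp_contractible[OF convex_ball]]) (use hnz in auto)
  \<comment> \<open>Borel-Caratheodory on the disc of radius 9/10, where \<open>h\<close> has a
    logarithm: \<open>z\<close> has relative radius at most 8/9 there, and 2 * (8/9) / (1 - 8/9) =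
    16.\<close>
  have gb: "norm (g z - g 0) \<le> 16 * M"
  proof -
    define G where "G = (\<lambda>z. g (9 / 10 * z) - g 0)"
    have "g \<circ> (\<lambda>z. 9 / 10 * z) holomorphic_on ball 0 1"
      by (rule holomorphic_on_compose_gen[OF _ g(1)]) (auto intro!: holomorphic_intros simp: norm_mult)
    hence G: "G holomorphic_on ball 0 1" unfolding G_def o_def by (intro holomorphic_intros)
    have ReG: "Re (G w) \<le> M" if w: "w \<in> ball 0 1" for w
    proof -
      have w': "9 / 10 * w \<in> ball 0 (9 / 10)" "9 / 10 * w \<in> ball 0 1" using w by (auto simp: norm_mult)
      have "exp (Re (G w)) = norm (h (9 / 10 * w)) / norm (h 0)"
        using g(2)[OF w'(1)] g(2)[of 0] by (simp add: G_def exp_diff)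
      also have "\<dots> \<le> K / norm (f 0)"
        using h(2)[OF w'(2)] h0 K0 by (intro frac_le) (auto intro: order_trans[OF norm_ge_zero])
      also have "\<dots> = exp M" unfolding M_def using less_le_trans[OF K0(2,1)] K0(2) by (subst exp_ln) (auto intro!: divide_pos_pos)
      finally show ?thesis by simp
    qed
    have z': "norm (10 / 9 * z) \<le> 8 / 9" using z by (simp add: norm_mult)
    have "norm (G (10 / 9 * z)) \<le> 2 * M * norm (10 / 9 * z) / (1 - norm (10 / 9 * z))"
      using z' by (intro Borel_Caratheodory_unit G ReG) (auto simp: G_def)
    also have "\<dots> \<le> 2 * M * (8 / 9) / (1 - 8 / 9)"
      using z' M0 by (intro frac_le mult_left_mono) auto
    finally show ?thesis by (simp add: G_def)
  qed
  define W where "W = {z. norm z < 9 / 10 \<and> Re z > b}"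
  have W: "z \<in> W" "0 \<in> W" using z b by (auto simp: W_def)
  have conv: "convex W"
  proof -
    have "W = ball 0 (9 / 10) \<inter> {z. Re z > b}" by (auto simp: W_def)
    thus ?thesis by (simp add: convex_Int convex_halfspace_Re_gt)
  qed
  have a: "norm a \<le> 9 / 10" "Re a \<le> b" if "a \<in> set xs" for a
    using that xs zeros[of a] by auto
  have ReA: "Re (1 - cnj a * w) > 0" "norm (1 - cnj a * w) \<ge> 1 / 10" if "a \<in> set xs" "norm w < 1" for a w
  proof -
    have "norm (cnj a * w) \<le> 9 / 10" using a(1)[OF that(1)] that(2) 
      by (simp add: norm_mult) (smt (verit) mult_left_le norm_ge_zero)
    moreover have "Re (cnj a * w) \<le> norm (cnj a * w)" by (rule complex_Re_le_cmod)
    ultimately show "Re (1 - cnj a * w) > 0" by simp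
    show "norm (1 - cnj a * w) \<ge> 1 / 10"
      using norm_triangle_ineq2[of 1 "cnj a * w"] \<open>norm (cnj a * w) \<le> 9 / 10\<close> by simp
  qed
  \<comment> \<open>Up to a constant, the logarithm \<open>l\<close> in explicit form on
    \<open>W\<close>. The numerators \<open>w - a\<close> have positive real part there because
    \<open>Re a \<le> b\<close>, the denominators because \<open>cnj a * w\<close> has norm below 1,
    so no branch cut is met.\<close>
  define S where "S = (\<lambda>w. g w + (\<Sum>a\<leftarrow>xs. Ln (w - a) - Ln (1 - cnj a * w)))"
  have notneg: "w \<notin> \<real>\<^sub>\<le>\<^sub>0" if "Re w > 0" for w using that by (auto simp: complex_nonpos_Reals_iff)
  have nzre: "w \<noteq> 0" if "Re w > 0" for w :: complex using that by auto
  have cS: "continuous_on W S"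
  proof -
    have "continuous_on W (\<lambda>w. \<Sum>a\<leftarrow>ys. Ln (w - a) - Ln (1 - cnj a * w))" if "set ys \<subseteq> set xs" for ys
      using that
    proof (induction ys)
      case (Cons c ys)
      have "w - c \<notin> \<real>\<^sub>\<le>\<^sub>0" if "w \<in> W" for w
        using a[of c] Cons.prems that by (intro notneg) (auto simp: W_def)
      moreover have "1 - cnj c * w \<notin> \<real>\<^sub>\<le>\<^sub>0" if "w \<in> W" for w
        using ReA(1)[of c w] Cons.prems that by (intro notneg) (auto simp: W_def)
      ultimately show ?case using Cons by (auto intro!: continuous_intros)
    qed simp
    moreover have "continuous_on W g"
      using holomorphic_on_imp_continuous_on[OF g(1)] by (rule continuous_on_subset) (auto simp: W_def)
    ultimately show ?thesis unfolding S_def by (intro continuous_intros) auto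
  qed
  have eS: "exp (l w) = exp (S w)" if w: "w \<in> W" for w
  proof -
    have "exp (\<Sum>a\<leftarrow>ys. Ln (w - a) - Ln (1 - cnj a * w)) = (\<Prod>a\<leftarrow>ys. Moebius_function 0 a w)" if "set ys \<subseteq> set xs" for ys
      using that
    proof (induction ys)
      case (Cons c ys)
      have "w - c \<noteq> 0" using a[of c] Cons.prems w by (intro nzre) (auto simp: W_def)
      moreover have "1 - cnj c * w \<noteq> 0" using ReA(1)[of c w] Cons.prems w by (intro nzre) (auto simp: W_def)
      ultimately show ?case using Cons by (simp add: exp_add exp_diff Moebius_function_def)
    qed simp
    hence "exp (S w) = f w" using fh[of w] g(2)[of w] w by (simp add: S_def exp_add W_def mult.commute)
    thus ?thesis using fl[of w] w by (simp add: W_def)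
  qed
  have cl: "continuous_on W l" using l by (rule continuous_on_subset) (auto simp: W_def)
  obtain c where c: "\<And>w. w \<in> W \<Longrightarrow> l w = S w + c"
    using exp_eq_imp_diff_constant[OF convex_connected[OF conv] cl cS eS] by blast
  \<comment> \<open>The change of one Blaschke term between 0 and \<open>z\<close>; at 0 the
    denominator is 1 and its logarithm vanishes. Three principal logarithms per zero are the origin
    of the factor 3 in both bounds.\<close>
  define T where "T = (\<lambda>a. Ln (z - a) - Ln (1 - cnj a * z) - Ln (- a))"
  have "(\<Sum>a\<leftarrow>xs. Ln (z - a) - Ln (1 - cnj a * z)) - (\<Sum>a\<leftarrow>xs. Ln (0 - a) - Ln (1 - cnj a * 0)) = (\<Sum>a\<leftarrow>xs. T a)"
    by (simp add: sum_list_subtractf[symmetric] T_def)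
  hence eq: "l z - l 0 = (g z - g 0) + (\<Sum>a\<leftarrow>xs. T a)"
    using c[OF W(1)] c[OF W(2)] by (simp add: S_def algebra_simps)
  \<comment> \<open>\<open>Q\<close> will be the imaginary part in the first bound and the norm in
    the second.\<close>
  have bound: "\<bar>Q (\<Sum>a\<leftarrow>ys. T a)\<bar> \<le> real (length ys) * D"
    if "set ys \<subseteq> set xs" "\<And>a. a \<in> set xs \<Longrightarrow> \<bar>Q (T a)\<bar> \<le> D" "Q 0 = 0" "\<And>x y. \<bar>Q (x + y)\<bar> \<le> \<bar>Q x\<bar> + \<bar>Q y\<bar>"
    for Q :: "complex \<Rightarrow> real" and D ys
    using that(1)
  proof (induction ys)
    case (Cons a ys)
    have "\<bar>Q (\<Sum>a\<leftarrow>a # ys. T a)\<bar> \<le> \<bar>Q (T a)\<bar> + \<bar>Q (\<Sum>a\<leftarrow>ys. T a)\<bar>" using that(4) by simp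
    also have "\<dots> \<le> D + real (length ys) * D" using Cons that(2) by (intro add_mono) auto
    finally show ?case by (simp add: algebra_simps)
  qed (simp add: that(3))
  have nzs: "z - a \<noteq> 0" "1 - cnj a * z \<noteq> 0" "- a \<noteq> 0" if "a \<in> set xs" for a
    using a[OF that] ReA(1)[OF that, of z] z b by (intro nzre; simp)+
  have "\<bar>Im (\<Sum>a\<leftarrow>xs. T a)\<bar> \<le> real (length xs) * (3 * pi)"
  proof (rule bound)
    fix a assume A: "a \<in> set xs"
    show "\<bar>Im (T a)\<bar> \<le> 3 * pi"
      using nzs[OF A] abs_Im_Ln_le_pi[of "z - a"] abs_Im_Ln_le_pi[of "1 - cnj a * z"] abs_Im_Ln_le_pi[of "- a"]
      by (simp add: T_def)
  qed auto
  also have "\<dots> \<le> M / ln (10 / 9) * (3 * pi)" using n by (intro mult_right_mono) auto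
  finally have "\<bar>Im (\<Sum>a\<leftarrow>xs. T a)\<bar> \<le> M / ln (10 / 9) * (3 * pi)" .
  moreover have "\<bar>Im (g z - g 0)\<bar> \<le> 16 * M" using gb abs_Im_le_cmod[of "g z - g 0"] by linarith
  moreover have "Im (l z) - Im (l 0) = Im (g z - g 0) + Im (\<Sum>a\<leftarrow>xs. T a)" using arg_cong[OF eq, of Im] by simp
  ultimately show "\<bar>Im (l z) - Im (l 0)\<bar> \<le> (16 + 3 * pi / ln (10 / 9)) * ln (K / norm (f 0))"
    unfolding M_def[symmetric] by (simp add: algebra_simps)
  fix \<delta> :: real assume \<delta>: "0 < \<delta>" "\<delta> \<le> 1 / 10" "\<delta> \<le> - b" "\<delta> \<le> Re z - b"
  define D where "D = ln (1 / \<delta>) + pi"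
  have "\<bar>norm (\<Sum>a\<leftarrow>xs. T a)\<bar> \<le> real (length xs) * (3 * D)"
  proof (rule bound)
    fix w assume A: "w \<in> set xs"
    have 1: "norm (Ln (z - w)) \<le> D" unfolding D_def
    proof (rule norm_Ln_le)
      show "\<delta> \<le> norm (z - w)" using a[OF A] \<delta> complex_Re_le_cmod[of "z - w"] by simp
      show "norm (z - w) \<le> 2" using a[OF A] z norm_triangle_ineq4[of z w] by simp
    qed (use \<delta> in auto)
    have 2: "norm (Ln (1 - cnj w * z)) \<le> D" unfolding D_def
    proof (rule norm_Ln_le)
      show "\<delta> \<le> norm (1 - cnj w * z)" using ReA(2)[OF A, of z] z \<delta> by simp
      have "norm (cnj w * z) \<le> 1 * 1" unfolding norm_mult using a[OF A] z by (intro mult_mono) auto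
      thus "norm (1 - cnj w * z) \<le> 2" using norm_triangle_ineq4[of 1 "cnj w * z"] by simp
    qed (use \<delta> in auto)
    have 3: "norm (Ln (- w)) \<le> D" unfolding D_def
    proof (rule norm_Ln_le)
      show "\<delta> \<le> norm (- w)" using a[OF A] \<delta> complex_Re_le_cmod[of "- w"] by simp
      show "norm (- w) \<le> 2" using a[OF A] by simp
    qed (use \<delta> in auto)
    have "norm (T w) \<le> norm (Ln (z - w)) + norm (Ln (1 - cnj w * z)) + norm (Ln (- w))"
      unfolding T_def by (meson add_mono norm_triangle_ineq4 order_refl order_trans)
    thus "\<bar>norm (T w)\<bar> \<le> 3 * D" using 1 2 3 by simp
  qed (auto intro: norm_triangle_ineq)
  also have "\<dots> \<le> M / ln (10 / 9) * (3 * D)" 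
  proof (intro mult_right_mono n)
    have "ln (1 / \<delta>) \<ge> 0" using \<delta> by simp
    thus "3 * D \<ge> 0" by (simp add: D_def)
  qed
  finally have "norm (\<Sum>a\<leftarrow>xs. T a) \<le> M / ln (10 / 9) * (3 * D)" by simp
  hence "norm (l z - l 0) \<le> 16 * M + M / ln (10 / 9) * (3 * D)"
    unfolding eq using gb norm_triangle_ineq[of "g z - g 0" "\<Sum>a\<leftarrow>xs. T a"] by linarith
  thus "norm (l z - l 0) \<le> (16 + 3 * (ln (1 / \<delta>) + pi) / ln (10 / 9)) * ln (K / norm (f 0))"
    unfolding M_def[symmetric] D_def by (simp add: algebra_simps add_divide_distrib)
qed

section \<open>Simultaneous approximation for logarithms of primes\<close>

text \<open>Separating positive from negative coefficients turns the relation into an equality of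
  two products of prime powers. Unique factorisation gives \<open>nat (u p) = nat (- u p)\<close>,
  which is possible only for 0.\<close>

lemma ln_primes_int_independent:
  fixes u :: "nat \<Rightarrow> int"
  assumes Q: "finite Q" "\<And>q. q \<in> Q \<Longrightarrow> prime (q::nat)" and s: "(\<Sum>q\<in>Q. of_int (u q) * ln (real q)) = 0"
    and p: "p \<in> Q"
  shows "u p = 0"
proof -
  define f g where "f = (\<lambda>q. nat (u q))" and "g = (\<lambda>q. nat (- u q))"
  have pos: "q > 0" if "q \<in> Q" for q using Q(2)[OF that] by (rule prime_gt_0_nat)
  have lnp: "ln (real (\<Prod>q\<in>Q. q ^ h q)) = (\<Sum>q\<in>Q. real (h q) * ln (real q))" for h
    using Q(1) pos
  proof (induction Q rule: finite_induct)
    case (insert x F)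
    have "(\<Prod>q\<in>F. q ^ h q) > 0" using insert.prems by (intro prod_pos) auto
    moreover have "x > 0" using insert.prems by auto
    ultimately have "ln (real (x ^ h x * (\<Prod>q\<in>F. q ^ h q))) = real (h x) * ln (real x) + ln (real (\<Prod>q\<in>F. q ^ h q))"
      unfolding of_nat_mult by (subst ln_mult) (auto simp: ln_realpow simp del: of_nat_prod)
    moreover have "ln (real (\<Prod>q\<in>F. q ^ h q)) = (\<Sum>q\<in>F. real (h q) * ln (real q))"
      using insert.prems by (intro insert.IH) auto
    ultimately show ?case using insert.hyps by (simp del: of_nat_prod of_nat_mult)
  qed simp
  have "(\<Sum>q\<in>Q. real (f q) * ln (real q)) - (\<Sum>q\<in>Q. real (g q) * ln (real q)) = (\<Sum>q\<in>Q. of_int (u q) * ln (real q))"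
    unfolding sum_subtractf[symmetric] by (intro sum.cong) (auto simp: f_def g_def left_diff_distrib[symmetric])
  hence "ln (real (\<Prod>q\<in>Q. q ^ f q)) = ln (real (\<Prod>q\<in>Q. q ^ g q))" by (simp only: lnp s)
  moreover have "real (\<Prod>q\<in>Q. q ^ h q) > 0" for h
    unfolding of_nat_0_less_iff using pos by (intro prod_pos) auto
  ultimately have "(\<Prod>q\<in>Q. q ^ f q) = (\<Prod>q\<in>Q. q ^ g q)"
    by (subst (asm) ln_inj_iff) (auto simp del: of_nat_prod)
  hence "multiplicity p (\<Prod>q\<in>Q. q ^ f q) = multiplicity p (\<Prod>q\<in>Q. q ^ g q)" by simp
  moreover have "multiplicity p (\<Prod>q\<in>Q. q ^ h q) = h p" for h
    using Q p by (subst multiplicity_prod_prime_powers) auto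
  ultimately have "f p = g p" by simp
  thus ?thesis by (simp add: f_def g_def split: if_splits) 
qed

lemma norm_cis_diff_le: "norm (cis x - cis y) \<le> \<bar>x - y\<bar>"
proof -
  have "cis x - cis y = cis y * (cis (x - y) - 1)" by (simp add: cis_mult algebra_simps)
  moreover have "norm (cis t - 1) \<le> \<bar>t\<bar>" for t
    using dist_exp_i_1[of t] abs_sin_x_le_abs_x[of "t / 2"] by (simp add: cis_conv_exp)
  ultimately show ?thesis by (simp add: norm_mult)
qed

text \<open>Kronecker's theorem for the frequencies ln p with one common target phase; the factor 2
  pi converts distances to integers into angles.\<close>

lemma Kronecker_primes:
  assumes A: "finite A" "\<And>q. q \<in> A \<Longrightarrow> prime (q::nat)" and e: "\<epsilon> > 0"
  obtains t where "\<And>p. p \<in> A \<Longrightarrow> norm (cis (t * ln (real p)) - cis \<alpha>) < \<epsilon>"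
proof -
  \<comment> \<open>Linear independence in \<open>Kronecker_thm_1\<close> is over the integers,
    hence this module structure on the reals.\<close>
  interpret Modules.module "(\<lambda>r. (*) (real_of_int r))"
    by (simp add: Modules.module.intro distrib_left mult.commute)
  define n where "n = card A"
  obtain b where b: "bij_betw b {0..<n} A" using ex_bij_betw_nat_finite[OF A(1)] by (auto simp: n_def)
  define \<theta> where "\<theta> = (\<lambda>i. ln (real (b i)))"
  have img: "\<theta> ` {..<n} = (\<lambda>q. ln (real q)) ` A"
    using b unfolding \<theta>_def by (auto simp: bij_betw_def image_image[symmetric] lessThan_atLeast0)
  have injln: "inj_on (\<lambda>q. ln (real q)) A"
  proof (rule inj_onI)
    fix x y assume "x \<in> A" "y \<in> A" "ln (real x) = ln (real y)"
    moreover have "x > 0" "y > 0" using A(2) \<open>x \<in> A\<close> \<open>y \<in> A\<close> prime_gt_0_nat by auto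
    ultimately show "x = y" by (subst (asm) ln_inj_iff) auto
  qed
  have inj: "inj_on \<theta> {..<n}"
    using b injln unfolding \<theta>_def bij_betw_def lessThan_atLeast0
    by (intro comp_inj_on[of b _ "\<lambda>q. ln (real q)", unfolded o_def]) auto
  have ind: "independent (\<theta> ` {..<n})"
    unfolding independent_explicit_module img
  proof (intro allI impI)
    fix t u v assume t: "finite t" "t \<subseteq> (\<lambda>q. ln (real q)) ` A" "(\<Sum>v\<in>t. real_of_int (u v) * v) = 0" "v \<in> t"
    define Q where "Q = {q \<in> A. ln (real q) \<in> t}"
    have tQ: "t = (\<lambda>q. ln (real q)) ` Q" using t by (auto simp: Q_def)
    have "(\<Sum>q\<in>Q. of_int (u (ln (real q))) * ln (real q)) = 0"
      using t(3) unfolding tQ by (subst (asm) sum.reindex) (use injln in \<open>auto simp: Q_def inj_on_def\<close>)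
    moreover obtain q where "q \<in> Q" "v = ln (real q)" using t tQ by auto
    ultimately show "u v = 0" using ln_primes_int_independent[of Q "\<lambda>q. u (ln (real q))" q] A by (auto simp: Q_def)
  qed
  obtain t h where th: "\<And>i. i < n \<Longrightarrow> \<bar>t * \<theta> i - of_int (h i) - \<alpha> / (2 * pi)\<bar> < \<epsilon> / (2 * pi)"
    using Kronecker_thm_1[OF ind inj, of "\<epsilon> / (2 * pi)" "\<lambda>_. \<alpha> / (2 * pi)"] e by auto
  show ?thesis
  proof (rule that[of "2 * pi * t"])
    fix p assume "p \<in> A"
    then obtain i where i: "i < n" "p = b i" using b by (auto simp: bij_betw_def)
    have "cis (2 * pi * t * ln (real p)) = cis (2 * pi * t * ln (real p) - 2 * pi * of_int (h i))"
      by (simp add: cis_divide[symmetric] cis_multiple_2pi)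
    hence "norm (cis (2 * pi * t * ln (real p)) - cis \<alpha>) \<le> \<bar>2 * pi * t * ln (real p) - 2 * pi * of_int (h i) - \<alpha>\<bar>"
      using norm_cis_diff_le by metis
    also have "\<dots> = 2 * pi * \<bar>t * \<theta> i - of_int (h i) - \<alpha> / (2 * pi)\<bar>"
    proof -
      have "2 * pi * t * ln (real p) - 2 * pi * of_int (h i) - \<alpha> = 2 * pi * (t * \<theta> i - of_int (h i) - \<alpha> / (2 * pi))"
        by (simp add: i \<theta>_def field_simps)
      thus ?thesis by (simp add: abs_mult)
    qed
    also have "\<dots> < 2 * pi * (\<epsilon> / (2 * pi))" by (intro mult_strict_left_mono th i) simp
    finally show "norm (cis (2 * pi * t * ln (real p)) - cis \<alpha>) < \<epsilon>" by simp
  qed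
qed

text \<open>Pigeonhole: two reals in the same cell of a partition of the torus differ by an almost period.\<close>

lemma almost_periods_relatively_dense:
  fixes \<theta> :: "'a \<Rightarrow> real"
  assumes A: "finite A" and e: "\<epsilon> > 0"
  obtains c where "\<And>T. \<exists>t. \<bar>t - T\<bar> \<le> c \<and> (\<forall>p\<in>A. norm (cis (t * \<theta> p) - 1) < \<epsilon>)"
proof -
  \<comment> \<open>The number of cells per coordinate: angles in the same cell differ, modulo 2 pi,
    by less than 2 pi / N.\<close>
  obtain N :: nat where N: "2 * pi / \<epsilon> < real N" using reals_Archimedean2 by blast
  have N0: "real N > 0" by (rule le_less_trans[OF _ N]) (use e in simp)
  define g where "g = (\<lambda>x. restrict (\<lambda>p. nat \<lfloor>real N * frac (x * \<theta> p / (2 * pi))\<rfloor>) A)"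
  have "g x \<in> PiE A (\<lambda>_. {..N})" for x
  proof -
    have "real N * frac y \<le> real N * 1" for y using frac_lt_1[of y] by (intro mult_left_mono) auto
    hence "nat \<lfloor>real N * frac y\<rfloor> \<le> N" for y by (simp add: floor_le_iff nat_le_iff) (meson le_less_trans less_add_one)
    thus ?thesis by (auto simp: g_def)
  qed
  hence fin: "finite (range g)"
    using A by (intro finite_subset[of "range g" "PiE A (\<lambda>_. {..N})"] finite_PiE) auto
  \<comment> \<open>One representative for each occupied cell. There are finitely many, so
    \<open>T - r (g T)\<close> stays at bounded distance from \<open>T\<close>.\<close>
  define r where "r = (\<lambda>v. SOME x. g x = v)"
  have r: "g (r (g x)) = g x" for x unfolding r_def by (rule someI[of _ x]) simp
  define c where "c = Max ((\<lambda>v. \<bar>r v\<bar>) ` range g)"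
  have "\<exists>t. \<bar>t - T\<bar> \<le> c \<and> (\<forall>p\<in>A. norm (cis (t * \<theta> p) - 1) < \<epsilon>)" for T
  proof (intro exI[of _ "T - r (g T)"] conjI ballI)
    show "\<bar>T - r (g T) - T\<bar> \<le> c" unfolding c_def using fin by (auto intro!: Max_ge)
    fix p assume p: "p \<in> A"
    define x where "x = r (g T)"
    define a b where "a = T * \<theta> p / (2 * pi)" and "b = x * \<theta> p / (2 * pi)"
    have "g x = g T" unfolding x_def by (rule r)
    hence "g x p = g T p" by simp
    hence eq: "\<lfloor>real N * frac b\<rfloor> = \<lfloor>real N * frac a\<rfloor>"
      using p by (subst eq_nat_nat_iff[symmetric]) (auto simp: g_def a_def b_def)
    have "real N * \<bar>frac a - frac b\<bar> = \<bar>real N * frac a - real N * frac b\<bar>"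
      by (simp add: abs_mult right_diff_distrib[symmetric])
    also have "\<dots> < 1" using eq by linarith
    finally have ab: "\<bar>frac a - frac b\<bar> < 1 / real N" using N0 by (simp add: field_simps)
    have "(T - x) * \<theta> p = 2 * pi * (frac a - frac b) + 2 * pi * of_int (\<lfloor>a\<rfloor> - \<lfloor>b\<rfloor>)"
      by (simp add: frac_def a_def b_def field_simps)
    hence "cis ((T - x) * \<theta> p) = cis (2 * pi * (frac a - frac b))"
      by (simp only: cis_mult[symmetric] cis_multiple_2pi Ints_of_int mult_1_right)
    hence "norm (cis ((T - x) * \<theta> p) - 1) \<le> \<bar>2 * pi * (frac a - frac b)\<bar>"
      using norm_cis_diff_le[of "2 * pi * (frac a - frac b)" 0] by simp
    also have "\<dots> < 2 * pi * (1 / real N)" using mult_strict_left_mono[OF ab, of "2 * pi"] by (simp add: abs_mult)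
    also have "\<dots> \<le> \<epsilon>" using N N0 e by (simp add: field_simps)
    finally show "norm (cis ((T - r (g T)) * \<theta> p) - 1) < \<epsilon>" by (simp add: x_def)
  qed
  thus ?thesis by (rule that)
qed

text \<open>One solution \<open>t0\<close> moved by an almost period is again a solution; each of
  the two contributes half of the tolerance.\<close>

lemma Kronecker_primes_relatively_dense:
  assumes A: "finite A" "\<And>q. q \<in> A \<Longrightarrow> prime (q::nat)" and e: "\<epsilon> > 0"
  obtains c where "\<And>T. \<exists>t. \<bar>t - T\<bar> \<le> c \<and> (\<forall>p\<in>A. norm (cis (t * ln (real p)) - cis \<alpha>) < \<epsilon>)"
proof -
  obtain t0 where t0: "\<And>p. p \<in> A \<Longrightarrow> norm (cis (t0 * ln (real p)) - cis \<alpha>) < \<epsilon> / 2"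
    using Kronecker_primes[OF A, of "\<epsilon> / 2"] e by auto
  obtain c where c: "\<And>T. \<exists>t. \<bar>t - T\<bar> \<le> c \<and> (\<forall>p\<in>A. norm (cis (t * ln (real p)) - 1) < \<epsilon> / 2)"
    using almost_periods_relatively_dense[OF A(1), of "\<epsilon> / 2" "\<lambda>p. ln (real p)"] e by auto
  show ?thesis
  proof (rule that[of "c + \<bar>t0\<bar>"])
    fix T
    obtain t where t: "\<bar>t - T\<bar> \<le> c" "\<And>p. p \<in> A \<Longrightarrow> norm (cis (t * ln (real p)) - 1) < \<epsilon> / 2" using c by blast
    show "\<exists>t. \<bar>t - T\<bar> \<le> c + \<bar>t0\<bar> \<and> (\<forall>p\<in>A. norm (cis (t * ln (real p)) - cis \<alpha>) < \<epsilon>)"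
    proof (intro exI[of _ "t + t0"] conjI ballI)
      show "\<bar>t + t0 - T\<bar> \<le> c + \<bar>t0\<bar>" using t(1) by linarith
      fix p assume p: "p \<in> A"
      have "cis ((t + t0) * ln (real p)) - cis \<alpha> = cis (t0 * ln (real p)) * (cis (t * ln (real p)) - 1) + (cis (t0 * ln (real p)) - cis \<alpha>)"
        by (simp add: cis_mult algebra_simps)
      also have "norm \<dots> \<le> norm (cis (t * ln (real p)) - 1) + norm (cis (t0 * ln (real p)) - cis \<alpha>)"
        by (rule order_trans[OF norm_triangle_ineq]) (simp add: norm_mult)
      also have "\<dots> < \<epsilon>" using t(2)[OF p] t0[OF p] by simp
      finally show "norm (cis ((t + t0) * ln (real p)) - cis \<alpha>) < \<epsilon>" .
    qed
  qed
qed

section \<open>The logarithm of the zeta function\<close>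

text \<open>A logarithm of (s - 1) zeta s rather than of zeta, so that it is holomorphic across
  \<open>s = 1\<close>. The third assumption fixes the branch: to the right,
  \<open>l s - Ln (s - 1)\<close> is the logarithm of zeta given by its Dirichlet series.\<close>

locale zeta_log =
  fixes l :: "complex \<Rightarrow> complex"
  assumes l_holo: "l holomorphic_on {s. Re s > 1 / 2}"
    and l_exp: "Re s > 1 / 2 \<Longrightarrow> zeta_reg s = exp (l s)"
    and l_dser: "Re s > 1 \<Longrightarrow> l s = dser Lambda1 s + Ln (s - 1)"

text \<open>The half-plane is convex and free of zeros of \<open>zeta_reg\<close>, so some logarithm
  exists. On \<open>Re s > 1\<close> it differs from the wanted one by a constant \<open>c\<close>;
  subtracting \<open>c\<close> keeps the exponential intact because
  \<open>exp c = 1\<close>.\<close>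

lemma RH_imp_zeta_log:
  assumes "riemann_hypothesis"
  obtains l where "zeta_log l"
proof -
  let ?S = "{s. Re s > 1 / 2}"
  obtain m where m: "m holomorphic_on ?S" "\<And>z. z \<in> ?S \<Longrightarrow> zeta_reg z = exp (m z)"
    by (rule contractible_imp_holomorphic_log[OF holomorphic_zeta_reg convex_imp_contractible[OF convex_halfspace_Re_gt[of "1 / 2"]]])
       (use RH_zeta_reg_nonzero[OF assms] in auto)
  let ?T = "{s. Re s > 1}"
  have c1: "continuous_on ?T m"
    using holomorphic_on_imp_continuous_on[OF m(1)] by (rule continuous_on_subset) auto
  have hd: "dser Lambda1 holomorphic_on ?T"
    unfolding holomorphic_on_open[OF open_halfspace_Re_gt]
    using dser_bounded_coeffs(3)[of Lambda1, OF abs_Lambda1_le_1] by blast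
  have c2: "continuous_on ?T (\<lambda>s. dser Lambda1 s + Ln (s - 1))"
    by (intro continuous_intros holomorphic_on_imp_continuous_on hd) (auto simp: complex_nonpos_Reals_iff)
  have "exp (m s) = exp (dser Lambda1 s + Ln (s - 1))" if "s \<in> ?T" for s
  proof -
    have "s \<noteq> 1" using that by auto
    thus ?thesis using m(2)[of s] that by (simp add: zeta_reg_def exp_add zeta_eq_exp mult.commute)
  qed
  from exp_eq_imp_diff_constant[OF convex_connected[OF convex_halfspace_Re_gt] c1 c2 this]
  obtain c where c: "\<And>s. Re s > 1 \<Longrightarrow> m s = dser Lambda1 s + Ln (s - 1) + c" by auto
  have "exp c = 1"
  proof -
    have "exp (m 2) = exp (dser Lambda1 2 + Ln (2 - 1)) * exp c" using c[of 2] by (simp add: exp_add)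
    moreover have "exp (m 2) = exp (dser Lambda1 2 + Ln (2 - 1))"
      using m(2)[of 2] by (simp add: zeta_reg_def exp_add zeta_eq_exp)
    ultimately show ?thesis by simp
  qed
  hence "zeta_log (\<lambda>s. m s - c)"
    using m c by unfold_locales (auto intro!: holomorphic_intros simp: exp_diff)
  thus ?thesis by (rule that)
qed

lemma countable_zeta_ordinates: "countable zeta_ordinates"
proof -
  have "countable {z \<in> UNIV. zeta_reg z = 0}"
  proof (rule holomorphic_countable_zeros[OF holomorphic_zeta_reg])
    \<comment> \<open>A constant \<open>zeta_reg\<close> would be 1 everywhere, so zeta would be 1 /
      (s - 1), which tends to 0 to the right, whereas the Dirichlet series tends to 1.\<close>
    show "\<not> zeta_reg constant_on UNIV"
    proof
      assume "zeta_reg constant_on UNIV"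
      then obtain c where c: "\<And>z. zeta_reg z = c" by (auto simp: constant_on_def)
      have z1: "zeta_reg 1 = 1" by (simp add: zeta_reg_def)
      have "((\<lambda>\<sigma>. dser (\<lambda>_. 1) (Complex \<sigma> 0)) \<longlongrightarrow> of_real 1) at_top" by (rule dser_tendsto_at_top) simp
      moreover have "((\<lambda>\<sigma>. dser (\<lambda>_. 1) (Complex \<sigma> 0)) \<longlongrightarrow> 0) at_top"
      proof (rule Lim_transform_eventually)
        show "((\<lambda>\<sigma>::real. complex_of_real (1 / (\<sigma> - 1))) \<longlongrightarrow> 0) at_top"
        proof -
          have "((\<lambda>\<sigma>::real. 1 / (\<sigma> - 1)) \<longlongrightarrow> 0) at_top" by real_asymp
          from tendsto_of_real[OF this, where ?'a = complex] show ?thesis by simp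
        qed
        show "\<forall>\<^sub>F \<sigma> in at_top. complex_of_real (1 / (\<sigma> - 1)) = dser (\<lambda>_. 1) (Complex \<sigma> 0)"
          using eventually_gt_at_top[of "1::real"]
        proof eventually_elim
          case (elim \<sigma>)
          have "Complex \<sigma> 0 = of_real \<sigma>" by (simp add: complex_eq_iff)
          moreover have "complex_of_real \<sigma> - 1 \<noteq> 0" using elim by (auto simp: complex_eq_iff)
          ultimately show ?case
            using c[of "of_real \<sigma>"] c[of 1] z1 elim zeta_dser[of "of_real \<sigma>"]
            by (simp add: zeta_reg_def field_simps split: if_splits)
        qed
      qed
      ultimately show False using tendsto_unique[OF trivial_limit_at_top_linorder] by fastforce
    qed
  qed auto
  hence "countable (Im ` {z. zeta_reg z = 0})" by simp
  moreover have "zeta_ordinates \<subseteq> Im ` {z. zeta_reg z = 0}"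
    by (force simp: zeta_ordinates_def zeta_reg_def)
  ultimately show ?thesis by (rule countable_subset[rotated])
qed

section \<open>Growth of the logarithm of zeta and its limit at the critical line\<close>

context zeta_log
begin

lemma continuous_on_l: "continuous_on {s. Re s > 1 / 2} l"
  using l_holo by (rule holomorphic_on_imp_continuous_on)

text \<open>\<open>log_disc_bound\<close> in the disc of radius 15/8 about 2 + i\<tau>: the critical
  line becomes \<open>Re z = - (4 / 5)\<close>, the zeros lie on it or to its left, and the segment
  from it to the centre lies in \<open>norm z \<le> 4 / 5\<close>. The bound for
  \<open>zeta_reg\<close> divided by its value at the centre is at most polynomial in \<tau>, whence
  the logarithm.\<close>

lemma l_growth_aux:
  obtains C where "C > 0"
    "\<And>\<tau>. norm (l (Complex 2 \<tau>)) \<le> C * ln (\<bar>\<tau>\<bar> + 2)"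
    "\<And>\<sigma> \<tau>. 1 / 2 < \<sigma> \<Longrightarrow> \<sigma> \<le> 2 \<Longrightarrow>
       \<bar>Im (l (Complex \<sigma> \<tau>)) - Im (l (Complex 2 \<tau>))\<bar> \<le> (16 + 3 * pi / ln (10 / 9)) * (C * ln (\<bar>\<tau>\<bar> + 2))"
    "\<And>\<sigma> \<tau> \<delta>. 0 < \<delta> \<Longrightarrow> \<delta> \<le> 1 / 10 \<Longrightarrow> 1 / 2 + 2 * \<delta> \<le> \<sigma> \<Longrightarrow> \<sigma> \<le> 2 \<Longrightarrow>
       norm (l (Complex \<sigma> \<tau>) - l (Complex 2 \<tau>)) \<le> (16 + 3 * (ln (1 / \<delta>) + pi) / ln (10 / 9)) * (C * ln (\<bar>\<tau>\<bar> + 2))"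
proof -
  obtain B where B: "B > 0" "\<And>s. Re s \<ge> 1 / 8 \<Longrightarrow> norm (zeta_reg s) \<le> 1 + B * norm s * norm (s - 1)"
    using zeta_reg_growth by blast
  define A where "A = (\<Sum>n. \<bar>Lambda1 (Suc n)\<bar> * real (Suc n) powr (- 2))"
  have A: "norm (dser Lambda1 (Complex 2 \<tau>)) \<le> A" for \<tau>
    using norm_dser_le[OF abs_Lambda1_le_1, of "Complex 2 \<tau>"] by (simp add: A_def)
  have A0: "A \<ge> 0" using A[of 0] norm_ge_zero order_trans by blast
  \<comment> \<open>Division by \<open>ln 2\<close>, a lower bound of
    \<open>ln (\<bar>\<tau>\<bar> + 2)\<close>, absorbs the constants; the 4 comes from \<open>2 *
    ln (\<bar>\<tau>\<bar> + 4) \<le> 4 * ln (\<bar>\<tau>\<bar> + 2)\<close>.\<close>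
  define C where "C = (ln (1 + B) + A + pi) / ln 2 + 4"
  have lB: "ln (1 + B) \<ge> 0" using B by simp
  have C0: "C > 0" unfolding C_def using lB A0 by (intro add_nonneg_pos divide_nonneg_pos add_nonneg_nonneg) auto
  have ln2: "ln (2::real) \<le> ln (\<bar>\<tau>\<bar> + 2)" for \<tau> by (subst ln_le_cancel_iff) auto
  have Cb: "ln (1 + B) + A + pi + 4 * ln (\<bar>\<tau>\<bar> + 2) \<le> C * ln (\<bar>\<tau>\<bar> + 2)" for \<tau>
  proof -
    define E where "E = ln (1 + B) + A + pi"
    have "E / ln 2 * ln 2 \<le> E / ln 2 * ln (\<bar>\<tau>\<bar> + 2)"
      using ln2 lB A0 unfolding E_def by (intro mult_left_mono divide_nonneg_pos add_nonneg_nonneg) auto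
    hence "E + 4 * ln (\<bar>\<tau>\<bar> + 2) \<le> E / ln 2 * ln (\<bar>\<tau>\<bar> + 2) + 4 * ln (\<bar>\<tau>\<bar> + 2)" by simp
    thus ?thesis unfolding C_def E_def[symmetric] by (simp only: distrib_right)
  qed
  have cen: "norm (l (Complex 2 \<tau>)) \<le> C * ln (\<bar>\<tau>\<bar> + 2)" for \<tau>
  proof -
    have eq: "Complex 2 \<tau> - 1 = Complex 1 \<tau>" by (simp add: complex_eq_iff)
    have nz: "Complex 1 \<tau> \<noteq> 0" by (simp add: complex_eq_iff)
    have "norm (Complex 1 \<tau>) \<ge> 1" using complex_Re_le_cmod[of "Complex 1 \<tau>"] by simp
    moreover have "norm (Complex 1 \<tau>) \<le> \<bar>\<tau>\<bar> + 2" using cmod_le[of "Complex 1 \<tau>"] by simp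
    ultimately have "0 \<le> ln (norm (Complex 1 \<tau>))" "ln (norm (Complex 1 \<tau>)) \<le> ln (\<bar>\<tau>\<bar> + 2)"
      by (auto intro!: ln_mono)
    hence "\<bar>ln (norm (Complex 1 \<tau>))\<bar> \<le> ln (\<bar>\<tau>\<bar> + 2)" by linarith
    hence "norm (Ln (Complex 1 \<tau>)) \<le> ln (\<bar>\<tau>\<bar> + 2) + pi"
      using cmod_le[of "Ln (Complex 1 \<tau>)"] abs_Im_Ln_le_pi[OF nz] by (simp add: Re_Ln[OF nz])
    hence "norm (l (Complex 2 \<tau>)) \<le> A + (ln (\<bar>\<tau>\<bar> + 2) + pi)"
      using A[of \<tau>] l_dser[of "Complex 2 \<tau>"] norm_triangle_ineq[of "dser Lambda1 (Complex 2 \<tau>)" "Ln (Complex 1 \<tau>)"]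
      by (simp add: eq)
    also have "\<dots> \<le> C * ln (\<bar>\<tau>\<bar> + 2)" using Cb[of \<tau>] lB ln2[of \<tau>] by (smt (verit) ln_gt_zero)
    finally show ?thesis .
  qed
  define f where "f = (\<lambda>\<tau> z. zeta_reg (Complex 2 \<tau> + 15 / 8 * z))"
  define l' where "l' = (\<lambda>\<tau> z. l (Complex 2 \<tau> + 15 / 8 * z))"
  define K where "K = (\<lambda>\<tau>. (1 + B) * (\<bar>\<tau>\<bar> + 4)\<^sup>2)"
  have f1: "f \<tau> holomorphic_on ball 0 1" for \<tau>
    unfolding f_def by (rule holomorphic_on_compose_gen[OF _ holomorphic_zeta_reg[of UNIV], unfolded o_def]) (auto intro!: holomorphic_intros)
  have f2: "norm (f \<tau> z) \<le> K \<tau>" if z: "z \<in> ball 0 1" for \<tau> z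
  proof -
    define s where "s = Complex 2 \<tau> + 15 / 8 * z"
    have zn: "norm z < 1" using z by simp
    have "Re z \<ge> - 1" using abs_Re_le_cmod[of z] zn by linarith
    hence "Re s \<ge> 1 / 8" by (simp add: s_def)
    moreover have n1: "norm (Complex 2 \<tau>) \<le> \<bar>\<tau>\<bar> + 2" "norm (Complex 1 \<tau>) \<le> \<bar>\<tau>\<bar> + 1" 
      using cmod_le[of "Complex 2 \<tau>"] cmod_le[of "Complex 1 \<tau>"] by simp_all
    have n2: "norm s \<le> \<bar>\<tau>\<bar> + 4"
      using n1 zn norm_triangle_ineq[of "Complex 2 \<tau>" "15 / 8 * z"] by (simp add: s_def norm_mult)
    have "s - 1 = Complex 1 \<tau> + 15 / 8 * z" by (simp add: s_def complex_eq_iff)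
    hence n3: "norm (s - 1) \<le> \<bar>\<tau>\<bar> + 4"
      using n1 zn norm_triangle_ineq[of "Complex 1 \<tau>" "15 / 8 * z"] by (simp add: norm_mult)
    ultimately have "norm (f \<tau> z) \<le> 1 + B * norm s * norm (s - 1)" using B(2)[of s] by (simp add: f_def s_def)
    also have "B * norm s * norm (s - 1) \<le> B * (\<bar>\<tau>\<bar> + 4) * (\<bar>\<tau>\<bar> + 4)"
      using n2 n3 B by (intro mult_mono) auto
    also have "1 + B * (\<bar>\<tau>\<bar> + 4) * (\<bar>\<tau>\<bar> + 4) \<le> K \<tau>"
    proof -
      have "1 \<le> (\<bar>\<tau>\<bar> + 4)\<^sup>2" by (rule one_le_power) simp
      thus ?thesis by (simp add: K_def power2_eq_square algebra_simps)
    qed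
    finally show ?thesis by simp
  qed
  have lin: "Re (Complex 2 \<tau> + 15 / 8 * z) > 1 / 2 \<longleftrightarrow> Re z > - (4 / 5)" for \<tau> z by auto
  have f3: "Re a \<le> - (4 / 5)" if "f \<tau> a = 0" for \<tau> a
    using that l_exp[of "Complex 2 \<tau> + 15 / 8 * a"] lin[of \<tau> a] by (force simp: f_def)
  have f4: "continuous_on {z. norm z < 1 \<and> Re z > - (4 / 5)} (l' \<tau>)" for \<tau>
    unfolding l'_def by (rule continuous_on_compose2[OF continuous_on_l]) (use lin[of \<tau>] in \<open>auto intro!: continuous_intros\<close>)
  have f5: "f \<tau> z = exp (l' \<tau> z)" if "Re z > - (4 / 5)" for \<tau> z
    using l_exp lin[of \<tau> z] that by (simp add: f_def l'_def)
  have M: "ln (K \<tau> / norm (f \<tau> 0)) \<le> C * ln (\<bar>\<tau>\<bar> + 2)" for \<tau>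
  proof -
    have eq: "Complex 2 \<tau> - 1 = Complex 1 \<tau>" by (simp add: complex_eq_iff)
    have ne: "Complex 2 \<tau> \<noteq> 1" by (simp add: complex_eq_iff)
    have "f \<tau> 0 = Complex 1 \<tau> * exp (dser Lambda1 (Complex 2 \<tau>))"
      using ne by (simp add: f_def zeta_reg_def zeta_eq_exp eq)
    moreover have "1 * exp (- A) \<le> norm (Complex 1 \<tau>) * exp (Re (dser Lambda1 (Complex 2 \<tau>)))"
    proof (intro mult_mono)
      show "1 \<le> norm (Complex 1 \<tau>)" using complex_Re_le_cmod[of "Complex 1 \<tau>"] by simp
      show "exp (- A) \<le> exp (Re (dser Lambda1 (Complex 2 \<tau>)))"
        using A[of \<tau>] abs_Re_le_cmod[of "dser Lambda1 (Complex 2 \<tau>)"] by simp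
    qed auto
    ultimately have f0: "norm (f \<tau> 0) \<ge> exp (- A)" by (simp add: norm_mult)
    hence pos: "norm (f \<tau> 0) > 0" by (rule less_le_trans[rotated]) simp
    have K0: "K \<tau> > 0" using B by (simp add: K_def)
    have 1: "ln (K \<tau> / norm (f \<tau> 0)) = ln (K \<tau>) - ln (norm (f \<tau> 0))" using K0 pos by (simp add: ln_div)
    have 2: "- A \<le> ln (norm (f \<tau> 0))" using f0 pos by (subst ln_ge_iff) auto
    have 3: "ln (K \<tau>) = ln (1 + B) + 2 * ln (\<bar>\<tau>\<bar> + 4)"
      using B by (simp add: K_def ln_mult ln_realpow)
    have "ln (\<bar>\<tau>\<bar> + 4) \<le> ln ((\<bar>\<tau>\<bar> + 2)\<^sup>2)"
      by (intro ln_mono) (auto simp: power2_eq_square algebra_simps)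
    also have "\<dots> = 2 * ln (\<bar>\<tau>\<bar> + 2)" by (simp add: ln_realpow)
    finally have "ln (K \<tau> / norm (f \<tau> 0)) \<le> ln (1 + B) + 4 * ln (\<bar>\<tau>\<bar> + 2) + A" using 1 2 3 by linarith
    thus ?thesis using Cb[of \<tau>] pi_gt_zero by linarith
  qed
  define z where "z = (\<lambda>\<sigma>::real. complex_of_real ((\<sigma> - 2) * (8 / 15)))"
  have z1: "norm (z \<sigma>) \<le> 4 / 5" "Re (z \<sigma>) > - (4 / 5)" if "1 / 2 < \<sigma>" "\<sigma> \<le> 2" for \<sigma>
    using that unfolding z_def norm_of_real by (auto simp: abs_if field_simps)
  have z2: "Complex 2 \<tau> + 15 / 8 * z \<sigma> = Complex \<sigma> \<tau>" for \<sigma> \<tau>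
    by (simp add: z_def complex_eq_iff field_simps)
  have l0: "l' \<tau> 0 = l (Complex 2 \<tau>)" "l' \<tau> (z \<sigma>) = l (Complex \<sigma> \<tau>)" for \<sigma> \<tau>
    by (simp_all only: l'_def z2) simp
  show ?thesis
  proof (rule that[OF C0 cen])
    fix \<sigma> \<tau> :: real assume \<sigma>: "1 / 2 < \<sigma>" "\<sigma> \<le> 2"
    have "\<bar>Im (l' \<tau> (z \<sigma>)) - Im (l' \<tau> 0)\<bar> \<le> (16 + 3 * pi / ln (10 / 9)) * ln (K \<tau> / norm (f \<tau> 0))"
      by (rule log_disc_bound(1)[OF f1 f2 _ f3 f4 f5]) (use z1[OF \<sigma>] in auto)
    also have "\<dots> \<le> (16 + 3 * pi / ln (10 / 9)) * (C * ln (\<bar>\<tau>\<bar> + 2))"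
      by (intro mult_left_mono M) auto
    finally show "\<bar>Im (l (Complex \<sigma> \<tau>)) - Im (l (Complex 2 \<tau>))\<bar> \<le> (16 + 3 * pi / ln (10 / 9)) * (C * ln (\<bar>\<tau>\<bar> + 2))"
      by (simp add: l0)
  next
    fix \<sigma> \<tau> \<delta> :: real assume \<delta>: "0 < \<delta>" "\<delta> \<le> 1 / 10" and \<sigma>: "1 / 2 + 2 * \<delta> \<le> \<sigma>" "\<sigma> \<le> 2"
    have "norm (l' \<tau> (z \<sigma>) - l' \<tau> 0) \<le> (16 + 3 * (ln (1 / \<delta>) + pi) / ln (10 / 9)) * ln (K \<tau> / norm (f \<tau> 0))"
    proof (rule log_disc_bound(2)[OF f1 f2 _ f3 f4 f5])
      \<comment> \<open>The rescaling turns the margin \<open>2 * \<delta>\<close> into 16/15 times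
        \<delta>, still at least \<delta>.\<close>
      have "Re (z \<sigma>) = 8 / 15 * \<sigma> - 16 / 15" by (simp add: z_def)
      thus "\<delta> \<le> Re (z \<sigma>) - - (4 / 5)" using \<sigma> \<delta> by linarith
    qed (use z1[of \<sigma>] \<delta> \<sigma> in auto)
    also have "\<dots> \<le> (16 + 3 * (ln (1 / \<delta>) + pi) / ln (10 / 9)) * (C * ln (\<bar>\<tau>\<bar> + 2))"
    proof (intro mult_left_mono M add_nonneg_nonneg divide_nonneg_nonneg mult_nonneg_nonneg)
      show "0 \<le> ln (1 / \<delta>)" using \<delta> by simp
    qed auto
    finally show "norm (l (Complex \<sigma> \<tau>) - l (Complex 2 \<tau>)) \<le> (16 + 3 * (ln (1 / \<delta>) + pi) / ln (10 / 9)) * (C * ln (\<bar>\<tau>\<bar> + 2))"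
      by (simp add: l0)
  qed
qed

text \<open>Near a zero on the critical line \<open>Re l\<close> is unbounded but
  \<open>Im l\<close> is not. This bound is uniform up to the line and later supplies the majorant
  for the limit under the integral.\<close>

lemma Im_l_growth:
  obtains C where "C > 0"
    "\<And>\<sigma> \<tau>. 1 / 2 < \<sigma> \<Longrightarrow> \<sigma> \<le> 2 \<Longrightarrow> \<bar>Im (l (Complex \<sigma> \<tau>))\<bar> \<le> C * ln (\<bar>\<tau>\<bar> + 2)"
proof -
  obtain C where C: "C > 0" "\<And>\<tau>. norm (l (Complex 2 \<tau>)) \<le> C * ln (\<bar>\<tau>\<bar> + 2)"
    "\<And>\<sigma> \<tau>. 1 / 2 < \<sigma> \<Longrightarrow> \<sigma> \<le> 2 \<Longrightarrow>
       \<bar>Im (l (Complex \<sigma> \<tau>)) - Im (l (Complex 2 \<tau>))\<bar> \<le> (16 + 3 * pi / ln (10 / 9)) * (C * ln (\<bar>\<tau>\<bar> + 2))"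
    using l_growth_aux by metis
  show ?thesis
  proof (rule that[of "C + (16 + 3 * pi / ln (10 / 9)) * C"])
    show "C + (16 + 3 * pi / ln (10 / 9)) * C > 0" using C(1) by (intro add_pos_nonneg mult_nonneg_nonneg) auto
    fix \<sigma> \<tau> :: real assume \<sigma>: "1 / 2 < \<sigma>" "\<sigma> \<le> 2"
    show "\<bar>Im (l (Complex \<sigma> \<tau>))\<bar> \<le> (C + (16 + 3 * pi / ln (10 / 9)) * C) * ln (\<bar>\<tau>\<bar> + 2)"
      using C(2)[of \<tau>] C(3)[OF \<sigma>, of \<tau>] abs_Im_le_cmod[of "l (Complex 2 \<tau>)"]
      by (simp only: distrib_right mult.assoc)
  qed
qed

text \<open>At a fixed distance from the critical line the full norm is controlled as well, with a
  constant depending on \<delta>. The holomorphy of the convolution with \<open>l\<close> rests on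
  this.\<close>

lemma l_growth:
  assumes "\<delta> > 0"
  obtains C where "C > 0"
    "\<And>\<sigma> \<tau>. 1 / 2 + \<delta> \<le> \<sigma> \<Longrightarrow> \<sigma> \<le> 2 \<Longrightarrow> norm (l (Complex \<sigma> \<tau>)) \<le> C * ln (\<bar>\<tau>\<bar> + 2)"
proof -
  define \<eta> where "\<eta> = min (\<delta> / 2) (1 / 10)"
  have \<eta>: "0 < \<eta>" "\<eta> \<le> 1 / 10" "2 * \<eta> \<le> \<delta>" using assms by (auto simp: \<eta>_def)
  define D where "D = 16 + 3 * (ln (1 / \<eta>) + pi) / ln (10 / 9)"
  obtain C where C: "C > 0" "\<And>\<tau>. norm (l (Complex 2 \<tau>)) \<le> C * ln (\<bar>\<tau>\<bar> + 2)"
    "\<And>\<sigma> \<tau>. 1 / 2 + 2 * \<eta> \<le> \<sigma> \<Longrightarrow> \<sigma> \<le> 2 \<Longrightarrow> norm (l (Complex \<sigma> \<tau>) - l (Complex 2 \<tau>)) \<le> D * (C * ln (\<bar>\<tau>\<bar> + 2))"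
    using l_growth_aux \<eta>(1,2) unfolding D_def by metis
  have D: "D > 0" unfolding D_def using \<eta> 
    by (intro add_pos_nonneg divide_nonneg_nonneg mult_nonneg_nonneg add_nonneg_nonneg) auto
  show ?thesis
  proof (rule that[of "C + D * C"])
    show "C + D * C > 0" using C(1) D by (intro add_pos_pos mult_pos_pos)
    fix \<sigma> \<tau> :: real assume \<sigma>: "1 / 2 + \<delta> \<le> \<sigma>" "\<sigma> \<le> 2"
    have "norm (l (Complex \<sigma> \<tau>)) \<le> norm (l (Complex 2 \<tau>)) + norm (l (Complex \<sigma> \<tau>) - l (Complex 2 \<tau>))"
      using norm_triangle_ineq[of "l (Complex 2 \<tau>)" "l (Complex \<sigma> \<tau>) - l (Complex 2 \<tau>)"] by simp
    moreover
    have "1 / 2 + 2 * \<eta> \<le> \<sigma>" using \<sigma> \<eta> by linarith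
    hence "norm (l (Complex \<sigma> \<tau>) - l (Complex 2 \<tau>)) \<le> D * (C * ln (\<bar>\<tau>\<bar> + 2))"
      using \<sigma>(2) by (rule C(3))
    ultimately show "norm (l (Complex \<sigma> \<tau>)) \<le> (C + D * C) * ln (\<bar>\<tau>\<bar> + 2)"
      using C(2)[of \<tau>] by (simp only: distrib_right mult.assoc)
  qed
qed

text \<open>For \<tau> \<noteq> 0 this is the argument of zeta continued from the right: a
  horizontal line at nonzero height does not meet the cut of \<open>Ln (s - 1)\<close>.\<close>

definition arg_line :: "real \<Rightarrow> real \<Rightarrow> real" where
  "arg_line \<sigma> \<tau> = Im (l (Complex \<sigma> \<tau>)) - Im (Ln (Complex (\<sigma> - 1) \<tau>))"

text \<open>At such a height zeta has no zero at the end of the half-line, so a local logarithm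
  \<open>h\<close> carries \<open>l\<close> continuously up to the critical line. The function
  extended by its limit satisfies \<open>is_zeta_arg_along\<close>, and uniqueness identifies the
  end value.\<close>

lemma arg_line_tendsto_S:
  assumes \<tau>: "\<tau> \<noteq> 0" "\<tau> \<notin> zeta_ordinates"
  shows "((\<lambda>\<sigma>. arg_line \<sigma> \<tau>) \<longlongrightarrow> pi * S_zeta \<tau>) (at_right (1 / 2))"
proof -
  define s0 where "s0 = Complex (1 / 2) \<tau>"
  have ne1: "Complex \<sigma> \<tau> \<noteq> 1" for \<sigma> using \<tau> by (simp add: complex_eq_iff)
  have nz: "zeta (Complex \<sigma> \<tau>) \<noteq> 0" for \<sigma>
    using \<tau> ne1[of \<sigma>] by (force simp: zeta_ordinates_def)
  have "zeta_reg s0 \<noteq> 0" using nz[of "1 / 2"] ne1[of "1 / 2"] by (simp add: s0_def zeta_reg_def)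
  then obtain \<rho> where \<rho>: "\<rho> > 0" "\<And>z. dist s0 z < \<rho> \<Longrightarrow> zeta_reg z \<noteq> 0"
    using continuous_at_avoid[OF continuous_zeta_reg, of s0 0] by blast
  obtain h where h: "h holomorphic_on ball s0 \<rho>" "\<And>z. z \<in> ball s0 \<rho> \<Longrightarrow> zeta_reg z = exp (h z)"
    by (rule contractible_imp_holomorphic_log[OF holomorphic_zeta_reg convex_imp_contractible[OF convex_ball]])
       (use \<rho> in auto)
  let ?S = "ball s0 \<rho> \<inter> {s. Re s > 1 / 2}"
  have conn: "connected ?S" by (intro convex_connected convex_Int convex_ball convex_halfspace_Re_gt)
  have c1: "continuous_on ?S l" using continuous_on_l by (rule continuous_on_subset) auto
  have c2: "continuous_on ?S h" using holomorphic_on_imp_continuous_on[OF h(1)] by (rule continuous_on_subset) auto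
  obtain c where c: "\<And>z. z \<in> ?S \<Longrightarrow> l z = h z + c"
    using exp_eq_imp_diff_constant[OF conn c1 c2] h(2) l_exp by (metis IntD1 IntD2 mem_Collect_eq)
  define x where "x = Complex (1 / 2 + \<rho> / 2) \<tau>"
  have xS: "x \<in> ?S"
  proof -
    have "s0 - x = of_real (- \<rho> / 2)" by (simp add: s0_def x_def complex_eq_iff)
    hence "dist s0 x = \<rho> / 2" using \<rho>(1) by (simp only: dist_norm norm_of_real)
    thus ?thesis using \<rho>(1) by (simp add: x_def)
  qed
  have ec: "exp c = 1"
    using c[OF xS] h(2)[of x] l_exp[of x] xS by (auto simp: exp_add)
  define v where "v = Im (h s0 + c) - Im (Ln (s0 - 1))"
  have Lnl: "((\<lambda>\<sigma>. Ln (Complex (\<sigma> - 1) \<tau>)) \<longlongrightarrow> Ln (Complex (\<sigma>' - 1) \<tau>)) (at \<sigma>' within X)" for \<sigma>' X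
    using \<tau> by (intro tendsto_intros) (auto simp: complex_nonpos_Reals_iff)
  have ev: "\<forall>\<^sub>F \<sigma> in at_right (1 / 2). Complex \<sigma> \<tau> \<in> ?S"
  proof -
    have "\<forall>\<^sub>F \<sigma> in at_right (1 / 2). \<sigma> \<in> {1 / 2<..<1 / 2 + \<rho>}"
      using \<rho>(1) by (intro eventually_at_right_real) simp
    thus ?thesis
    proof eventually_elim
      case (elim \<sigma>)
      have "s0 - Complex \<sigma> \<tau> = of_real (1 / 2 - \<sigma>)" by (simp add: s0_def complex_eq_iff)
      hence "dist s0 (Complex \<sigma> \<tau>) = \<bar>1 / 2 - \<sigma>\<bar>" by (simp only: dist_norm norm_of_real)
      thus ?case using elim by auto
    qed
  qed
  have hc: "isCont h s0" using holomorphic_on_imp_continuous_on[OF h(1)] \<rho>(1)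
    by (simp add: continuous_on_interior)
  have "((\<lambda>\<sigma>. Im (h (Complex \<sigma> \<tau>) + c) - Im (Ln (Complex (\<sigma> - 1) \<tau>))) \<longlongrightarrow> Im (h s0 + c) - Im (Ln (Complex (1 / 2 - 1) \<tau>))) (at_right (1 / 2))"
    by (intro tendsto_intros Lnl isCont_tendsto_compose[OF hc]) (auto simp: s0_def intro!: tendsto_intros)
  moreover have "Complex (1 / 2 - 1) \<tau> = s0 - 1" by (simp add: s0_def complex_eq_iff)
  ultimately have "((\<lambda>\<sigma>. Im (h (Complex \<sigma> \<tau>) + c) - Im (Ln (Complex (\<sigma> - 1) \<tau>))) \<longlongrightarrow> v) (at_right (1 / 2))"
    by (simp add: v_def)
  hence lim: "((\<lambda>\<sigma>. arg_line \<sigma> \<tau>) \<longlongrightarrow> v) (at_right (1 / 2))"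
    by (rule Lim_transform_eventually) (use ev in \<open>eventually_elim; auto simp: arg_line_def c\<close>)
  define g where "g = (\<lambda>\<sigma>. if \<sigma> \<le> 1 / 2 then v else arg_line \<sigma> \<tau>)"
  have "is_zeta_arg_along \<tau> g"
    unfolding is_zeta_arg_along_def
  proof (intro conjI allI impI)
    show "continuous_on {1 / 2..} g"
      unfolding continuous_on_def
    proof
      fix \<sigma>' :: real assume s: "\<sigma>' \<in> {1 / 2..}"
      show "(g \<longlongrightarrow> g \<sigma>') (at \<sigma>' within {1 / 2..})"
      proof (cases "\<sigma>' = 1 / 2")
        case True
        have "(g \<longlongrightarrow> v) (at_right (1 / 2))"
          by (rule Lim_transform_eventually[OF lim]) (use eventually_at_right_less[of "1 / 2 :: real"] in \<open>eventually_elim; simp add: g_def\<close>)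
        thus ?thesis by (simp add: True g_def at_within_Ici_at_right)
      next
        case False
        hence s': "\<sigma>' > 1 / 2" using s by simp
        have "isCont l (Complex \<sigma>' \<tau>)"
          by (rule continuous_on_l[unfolded continuous_on_eq_continuous_at[OF open_halfspace_Re_gt], rule_format]) (use s' in simp)
        hence "((\<lambda>\<sigma>. l (Complex \<sigma> \<tau>)) \<longlongrightarrow> l (Complex \<sigma>' \<tau>)) (at \<sigma>')"
          by (rule isCont_tendsto_compose) (intro tendsto_intros)
        hence "((\<lambda>\<sigma>. arg_line \<sigma> \<tau>) \<longlongrightarrow> arg_line \<sigma>' \<tau>) (at \<sigma>')"
          unfolding arg_line_def by (intro tendsto_intros Lnl)
        moreover have "\<forall>\<^sub>F \<sigma> in at \<sigma>'. arg_line \<sigma> \<tau> = g \<sigma>"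
        proof -
          have "\<forall>\<^sub>F \<sigma> in at \<sigma>'. \<sigma> \<in> {1 / 2<..}"
            using eventually_at_in_open'[of "{1 / 2<..}" \<sigma>'] s' by auto
          thus ?thesis by eventually_elim (auto simp: g_def)
        qed
        ultimately have "(g \<longlongrightarrow> arg_line \<sigma>' \<tau>) (at \<sigma>')" by (rule Lim_transform_eventually)
        from tendsto_within_subset[OF this subset_UNIV] show ?thesis using s' by (simp add: g_def)
      qed
    qed
    fix \<sigma> :: real assume s: "1 / 2 \<le> \<sigma>"
    define s where "s = Complex \<sigma> \<tau>"
    have s1: "s - 1 \<noteq> 0" using ne1 by (simp add: s_def)
    have sm: "s - 1 = Complex (\<sigma> - 1) \<tau>" by (simp add: s_def complex_eq_iff)
    have "\<exists>w. zeta s = exp w \<and> g \<sigma> = Im w"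
    proof (cases "\<sigma> = 1 / 2")
      case True
      have ss: "s = s0" using True by (simp add: s_def s0_def)
      have "zeta s = zeta_reg s / (s - 1)" using s1 by (simp add: zeta_reg_def)
      also have "\<dots> = exp (h s + c - Ln (s - 1))"
        using ss s1 h(2)[of s] \<rho>(1) ec by (simp add: exp_diff exp_add)
      finally show ?thesis using True ss by (intro exI[of _ "h s + c - Ln (s - 1)"]) (simp add: g_def v_def)
    next
      case False
      hence "\<sigma> > 1 / 2" using s by simp
      have "zeta s = zeta_reg s / (s - 1)" using s1 by (simp add: zeta_reg_def)
      also have "\<dots> = exp (l s - Ln (s - 1))"
        using \<open>\<sigma> > 1 / 2\<close> s1 l_exp[of s] by (simp add: s_def exp_diff)
      finally show ?thesis using \<open>\<sigma> > 1 / 2\<close>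
        by (intro exI[of _ "l s - Ln (s - 1)"]) (auto simp: g_def arg_line_def s_def sm[unfolded s_def])
    qed
    then obtain w where "zeta s = exp w" "g \<sigma> = Im w" by blast
    thus "zeta (Complex \<sigma> \<tau>) = of_real (cmod (zeta (Complex \<sigma> \<tau>))) * cis (g \<sigma>)"
      by (simp add: s_def[symmetric] exp_eq_polar norm_mult)
  next
    have "((\<lambda>\<sigma>. Im (dser Lambda1 (Complex \<sigma> \<tau>))) \<longlongrightarrow> Im (of_real (Lambda1 1))) at_top"
      by (intro tendsto_intros dser_tendsto_at_top abs_Lambda1_le_1)
    hence "((\<lambda>\<sigma>. Im (dser Lambda1 (Complex \<sigma> \<tau>))) \<longlongrightarrow> 0) at_top" by simp
    moreover have "\<forall>\<^sub>F \<sigma> in at_top. Im (dser Lambda1 (Complex \<sigma> \<tau>)) = g \<sigma>"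
      using eventually_gt_at_top[of "1 :: real"]
    proof eventually_elim
      case (elim \<sigma>)
      have "Complex \<sigma> \<tau> - 1 = Complex (\<sigma> - 1) \<tau>" by (simp add: complex_eq_iff)
      thus ?case using l_dser[of "Complex \<sigma> \<tau>"] elim by (simp add: g_def arg_line_def)
    qed
    ultimately show "(g \<longlongrightarrow> 0) at_top" by (rule Lim_transform_eventually)
  qed
  hence "arg_zeta \<tau> = g (1 / 2)"
    unfolding arg_zeta_def
  proof (intro the_equality exI conjI)
    fix y assume "\<exists>g. is_zeta_arg_along \<tau> g \<and> y = g (1 / 2)"
    thus "y = g (1 / 2)" using is_zeta_arg_along_unique[OF _ \<open>is_zeta_arg_along \<tau> g\<close> \<tau>(2,1), of _ "1 / 2"] by auto
  qed simp_all
  hence "pi * S_zeta \<tau> = v" using \<tau> by (simp add: S_zeta_def g_def)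
  thus ?thesis using lim by simp
qed

end

section \<open>The kernel and its Fourier transform\<close>

lemma Re_cosh_Complex: "Re (cosh (Complex x y)) = cosh x * cos y"
  by (simp add: cosh_def Re_exp scaleR_conv_of_real field_simps)

lemma norm_K_ker: "norm (K_ker a (Complex x y)) = exp (- (a * cosh x * cos y))"
  by (simp add: K_ker_def Re_cosh_Complex)

lemma K_ker_of_real: "K_ker a (of_real x) = of_real (exp (- (a * cosh x)))"
proof -
  have "cosh (complex_of_real x) = of_real (cosh x)"
    by (simp add: cosh_def exp_of_real[symmetric] scaleR_conv_of_real)
  thus ?thesis by (simp add: K_ker_def exp_of_real[symmetric])
qed

lemma K_ker_deriv: "(K_ker a has_field_derivative - (of_real a * sinh z * K_ker a z)) (at z)"
  unfolding K_ker_def by (auto intro!: derivative_eq_intros)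

lemma continuous_K_ker: "continuous_on A (K_ker a)"
  unfolding K_ker_def by (intro continuous_intros)

text \<open>\<open>2 * cosh x - 2\<close> is the square of
  \<open>exp (x / 2) - exp (- (x / 2))\<close>, which is at least x for x \<ge> 0.\<close>

lemma cosh_ge_quadratic: "cosh (x::real) \<ge> 1 + x\<^sup>2 / 2"
proof -
  have main': "2 * y \<le> exp y - exp (- y)" if y: "y \<ge> 0" for y :: real
  proof -
    have q: "exp y \<ge> 1 + y + y\<^sup>2 / 2" using y by (rule exp_lower_Taylor_quadratic)
    have p: "1 + y + y\<^sup>2 / 2 > 0" using y by (intro add_pos_nonneg) auto
    have "1 / exp y \<le> 1 / (1 + y + y\<^sup>2 / 2)" using q p by (intro divide_left_mono) auto
    hence "exp (- y) \<le> 1 / (1 + y + y\<^sup>2 / 2)" by (simp only: exp_minus inverse_eq_divide)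
    also have "\<dots> \<le> 1 - y + y\<^sup>2 / 2"
    proof -
      have "(1 - y + y\<^sup>2 / 2) * (1 + y + y\<^sup>2 / 2) = 1 + (y\<^sup>2)\<^sup>2 / 4" by (simp add: power2_eq_square field_simps)
      hence "1 \<le> (1 - y + y\<^sup>2 / 2) * (1 + y + y\<^sup>2 / 2)" by simp
      thus ?thesis using p by (simp add: pos_divide_le_eq)
    qed
    finally show ?thesis using q by simp
  qed
  have main: "cosh x \<ge> 1 + x\<^sup>2 / 2" if "x \<ge> 0" for x :: real
  proof -
    have "(exp (x / 2) - exp (- (x / 2)))\<^sup>2 \<ge> x\<^sup>2"
    proof (rule power_mono[OF _ that])
      show "x \<le> exp (x / 2) - exp (- (x / 2))"
        using main'[of "x / 2"] that by simp
    qed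
    moreover have "(exp (x / 2) - exp (- (x / 2)))\<^sup>2 = 2 * cosh x - 2"
      by (simp add: power2_eq_square cosh_def algebra_simps exp_add[symmetric])
    ultimately show ?thesis by simp
  qed
  show ?thesis using main[of "\<bar>x\<bar>"] by simp
qed

lemma integrable_inverse_1_plus_square_lborel: "integrable lborel (\<lambda>x::real. inverse (1 + x\<^sup>2))"
  using integrable_inverse_1_plus_square by (simp add: set_integrable_def einterval_def)

lemma integrable_kernel_linear:
  fixes a b c d :: real
  assumes a: "a > 0" and b: "b > 0"
  shows "integrable lborel (\<lambda>u. exp (- (a * cosh (b * u))) * (c + d * \<bar>u\<bar>))"
proof (rule Bochner_Integration.integrable_bound)
  define e where "e = a * b\<^sup>2 / 2"
  have e: "e > 0" using a b by (simp add: e_def)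
  \<comment> \<open>The largest constant with
    \<open>m * (1 + u\<^sup>2)\<^sup>2 \<le> 1 + y + y\<^sup>2 / 2\<close> coefficient by
    coefficient, where \<open>y = e * u\<^sup>2\<close>; the right side is a lower bound for
    \<open>exp y\<close>.\<close>
  define m where "m = min 1 (min (e / 2) (e\<^sup>2 / 2))"
  have m: "m > 0" "m \<le> 1" "2 * m \<le> e" "m \<le> e\<^sup>2 / 2" using e by (auto simp: m_def min_def)
  show "integrable lborel (\<lambda>x. (\<bar>c\<bar> + \<bar>d\<bar>) / m * inverse (1 + x\<^sup>2))"
    by (intro integrable_mult_right integrable_inverse_1_plus_square_lborel)
  show "(\<lambda>u. exp (- (a * cosh (b * u))) * (c + d * \<bar>u\<bar>)) \<in> borel_measurable lborel"
    unfolding cosh_def by measurable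
  show "AE u in lborel. norm (exp (- (a * cosh (b * u))) * (c + d * \<bar>u\<bar>)) \<le> norm ((\<bar>c\<bar> + \<bar>d\<bar>) / m * inverse (1 + u\<^sup>2))"
  proof (rule AE_I2)
    fix u :: real
    have "a * ((b * u)\<^sup>2 / 2) \<le> a * cosh (b * u)"
      using a cosh_ge_quadratic[of "b * u"] by (intro mult_left_mono) auto
    hence "e * u\<^sup>2 \<le> a * cosh (b * u)" by (simp add: e_def power_mult_distrib)
    hence "exp (- (a * cosh (b * u))) \<le> exp (- (e * u\<^sup>2))" by simp
    also have "\<dots> \<le> 1 / (m * (1 + u\<^sup>2)\<^sup>2)"
    proof -
      define y where "y = e * u\<^sup>2"
      have "m * (1 + u\<^sup>2)\<^sup>2 = m + (2 * m) * u\<^sup>2 + m * (u\<^sup>2)\<^sup>2" by (simp add: power2_eq_square algebra_simps)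
      also have "\<dots> \<le> 1 + e * u\<^sup>2 + (e\<^sup>2 / 2) * (u\<^sup>2)\<^sup>2" using m by (intro add_mono mult_right_mono) auto
      also have "\<dots> = 1 + y + y\<^sup>2 / 2" by (simp add: y_def power_mult_distrib)
      also have "\<dots> \<le> exp y" using e by (intro exp_lower_Taylor_quadratic) (simp add: y_def)
      finally have "m * (1 + u\<^sup>2)\<^sup>2 \<le> exp y" .
      moreover have "m * (1 + u\<^sup>2)\<^sup>2 > 0" using m by (intro mult_pos_pos zero_less_power add_pos_nonneg) auto
      ultimately have "1 / exp y \<le> 1 / (m * (1 + u\<^sup>2)\<^sup>2)" by (intro divide_left_mono) auto
      thus ?thesis by (simp add: y_def exp_minus divide_inverse)
    qed
    finally have 1: "exp (- (a * cosh (b * u))) \<le> 1 / (m * (1 + u\<^sup>2)\<^sup>2)" .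
    have u1: "\<bar>u\<bar> \<le> 1 + u\<^sup>2"
    proof -
      have "(\<bar>u\<bar> - 1)\<^sup>2 \<ge> 0" by simp
      hence "\<bar>u\<bar> * 2 \<le> 1 + u\<^sup>2" by (simp add: power2_eq_square algebra_simps)
      thus ?thesis by (smt (verit) zero_le_power2)
    qed
    have "\<bar>c + d * \<bar>u\<bar>\<bar> \<le> \<bar>c\<bar> * 1 + \<bar>d\<bar> * \<bar>u\<bar>" by (simp add: abs_triangle_ineq[THEN order_trans] abs_mult)
    also have "\<dots> \<le> \<bar>c\<bar> * (1 + u\<^sup>2) + \<bar>d\<bar> * (1 + u\<^sup>2)" using u1 by (intro add_mono mult_left_mono) auto
    finally have 2: "\<bar>c + d * \<bar>u\<bar>\<bar> \<le> (\<bar>c\<bar> + \<bar>d\<bar>) * (1 + u\<^sup>2)" by (simp add: algebra_simps)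
    have "norm (exp (- (a * cosh (b * u))) * (c + d * \<bar>u\<bar>)) \<le> 1 / (m * (1 + u\<^sup>2)\<^sup>2) * ((\<bar>c\<bar> + \<bar>d\<bar>) * (1 + u\<^sup>2))"
      unfolding norm_mult using 1 2 m by (intro mult_mono) auto
    also have "\<dots> = (\<bar>c\<bar> + \<bar>d\<bar>) / m * inverse (1 + u\<^sup>2)"
    proof -
      have "1 + u\<^sup>2 \<noteq> 0" by (metis add_pos_nonneg less_irrefl zero_le_power2 zero_less_one)
      thus ?thesis using m by (simp add: divide_simps power2_eq_square)
    qed
    finally show "norm (exp (- (a * cosh (b * u))) * (c + d * \<bar>u\<bar>)) \<le> norm ((\<bar>c\<bar> + \<bar>d\<bar>) / m * inverse (1 + u\<^sup>2))"
      by (rule order_trans) (simp only: real_norm_def abs_ge_self)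
  qed
qed

lemma integrable_kernel: "(a::real) > 0 \<Longrightarrow> b > 0 \<Longrightarrow> integrable lborel (\<lambda>u. exp (- (a * cosh (b * u))))"
  using integrable_kernel_linear[of a b 1 0] by simp

text \<open>Integrals over the compact intervals are holomorphic by the Leibniz rule. The tail of
  the majorant \<open>G\<close> bounds the error independently of \<open>z\<close>, so the limit is
  uniform. General \<open>lo\<close> and \<open>hi\<close> let one statement cover the whole line
  and both rays.\<close>

lemma holomorphic_param_integral:
  fixes h h' :: "complex \<Rightarrow> real \<Rightarrow> complex"
  assumes U: "open U" "convex U" and X: "closed X"
    and lr: "\<And>n. {lo n..hi n} \<subseteq> X" "\<And>u. u \<in> X \<Longrightarrow> \<forall>\<^sub>F n in sequentially. u \<in> {lo n..hi n}"
    and deriv: "\<And>z u. z \<in> U \<Longrightarrow> u \<in> X \<Longrightarrow> ((\<lambda>z. h z u) has_field_derivative h' z u) (at z)"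
    and cont': "continuous_on (U \<times> X) (\<lambda>(z, u). h' z u)"
    and cont: "\<And>z. z \<in> U \<Longrightarrow> continuous_on X (h z)"
    and G: "set_integrable lborel X G" "\<And>z u. z \<in> U \<Longrightarrow> u \<in> X \<Longrightarrow> norm (h z u) \<le> G u"
  shows "(\<lambda>z. LINT u:X|lborel. h z u) holomorphic_on U"
    and "\<And>z. z \<in> U \<Longrightarrow> set_integrable lborel X (h z)"
proof -
  have Xb: "X \<in> sets borel" using X by simp
  show int: "set_integrable lborel X (h z)" if z: "z \<in> U" for z
  proof (rule set_integrable_bound[OF G(1)])
    show "set_borel_measurable lborel X (h z)"
      using set_measurable_continuous_on[OF Xb cont[OF z]] by (simp add: set_borel_measurable_def)
    show "AE x in lborel. x \<in> X \<longrightarrow> norm (h z x) \<le> norm (G x)"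
      using G(2)[OF z] by (intro AE_I2) (auto intro: order_trans[OF _ abs_ge_self])
  qed
  define I where "I = (\<lambda>n z. integral (cbox (lo n) (hi n)) (h z))"
  have hI: "I n holomorphic_on U" for n
    unfolding I_def
  proof (rule leibniz_rule_holomorphic[OF _ _ _ U(2)])
    show "((\<lambda>z. h z u) has_field_derivative h' z u) (at z within U)" if "z \<in> U" "u \<in> cbox (lo n) (hi n)" for z u
      using that lr(1)[of n] by (intro has_field_derivative_at_within[OF deriv]) auto
    show "h z integrable_on cbox (lo n) (hi n)" if "z \<in> U" for z
      using lr(1)[of n] continuous_on_subset[OF cont[OF that]] by (intro integrable_continuous) auto
    show "continuous_on (U \<times> cbox (lo n) (hi n)) (\<lambda>(z, u). h' z u)"
      using lr(1)[of n] by (intro continuous_on_subset[OF cont']) auto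
  qed
  define r where "r = (\<lambda>n. LINT u:X|lborel. (1 - indicator {lo n..hi n} u) * G u)"
  have r0: "r \<longlonglongrightarrow> 0"
  proof -
    have "(\<lambda>n. LINT u|lborel. indicator X u *\<^sub>R ((1 - indicator {lo n..hi n} u) * G u)) \<longlonglongrightarrow> (LINT u|(lborel :: real measure). (0::real))"
    proof (rule integral_dominated_convergence[where w = "\<lambda>u. norm (indicator X u *\<^sub>R G u)"])
      have Gm: "(\<lambda>u. indicator X u *\<^sub>R G u) \<in> borel_measurable lborel"
        using G(1) unfolding set_integrable_def by (rule borel_measurable_integrable)
      have "(\<lambda>u. (1 - indicator {lo n..hi n} u) * (indicator X u *\<^sub>R G u)) \<in> borel_measurable lborel" for n
        using Gm by measurable
      moreover have "(\<lambda>u. (1 - indicator {lo n..hi n} u) * (indicator X u *\<^sub>R G u)) = (\<lambda>u. indicator X u *\<^sub>R ((1 - indicator {lo n..hi n} u) * G u))" for n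
        by (auto simp: fun_eq_iff)
      ultimately show "(\<lambda>u. indicator X u *\<^sub>R ((1 - indicator {lo n..hi n} u) * G u)) \<in> borel_measurable lborel" for n
        by metis
      show "integrable lborel (\<lambda>u. norm (indicator X u *\<^sub>R G u))"
        using G(1) unfolding set_integrable_def by (rule integrable_norm)
      show "AE u in lborel. (\<lambda>n. indicator X u *\<^sub>R ((1 - indicator {lo n..hi n} u) * G u)) \<longlonglongrightarrow> 0"
      proof (rule AE_I2)
        fix u
        show "(\<lambda>n. indicator X u *\<^sub>R ((1 - indicator {lo n..hi n} u) * G u)) \<longlonglongrightarrow> 0"
        proof (cases "u \<in> X")
          case True
          show ?thesis
            by (rule tendsto_eventually, use lr(2)[OF True] in eventually_elim) simp
        qed simp
      qed
      show "AE x in lborel. norm (indicator X x *\<^sub>R ((1 - indicator {lo n..hi n} x) * G x)) \<le> norm (indicator X x *\<^sub>R G x)" for n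
        by (intro AE_I2) (auto simp: indicator_def)
    qed simp
    thus ?thesis by (simp add: r_def set_lebesgue_integral_def)
  qed
  have est: "norm (I n z - (LINT u:X|lborel. h z u)) \<le> r n" if z: "z \<in> U" for n z
  proof -
    have i1: "set_integrable lborel {lo n..hi n} (h z)"
      by (rule set_integrable_subset[OF int[OF z]]) (use lr in auto)
    have "I n z = (LINT u:{lo n..hi n}|lborel. h z u)"
      using set_borel_integral_eq_integral(2)[OF i1] by (simp add: I_def)
    hence "I n z - (LINT u:X|lborel. h z u) = (LINT u|lborel. indicator {lo n..hi n} u *\<^sub>R h z u - indicator X u *\<^sub>R h z u)"
      using i1 int[OF z] unfolding set_lebesgue_integral_def set_integrable_def by simp
    also have "norm \<dots> \<le> r n"
      unfolding r_def set_lebesgue_integral_def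
    proof (rule order_trans[OF integral_norm_bound Bochner_Integration.integral_mono])
      show "integrable lborel (\<lambda>u. norm (indicator {lo n..hi n} u *\<^sub>R h z u - indicator X u *\<^sub>R h z u))"
        using i1 int[OF z] unfolding set_integrable_def by (intro integrable_norm Bochner_Integration.integrable_diff)
      have "integrable lborel (\<lambda>u. indicator X u *\<^sub>R G u - indicator {lo n..hi n} u *\<^sub>R (indicator X u *\<^sub>R G u))"
        using G(1)[unfolded set_integrable_def]
        by (rule Bochner_Integration.integrable_diff[OF _ integrable_mult_indicator]) (use G(1)[unfolded set_integrable_def] in auto)
      thus "integrable lborel (\<lambda>u. indicator X u *\<^sub>R ((1 - indicator {lo n..hi n} u) * G u))"
        by (rule Bochner_Integration.integrable_cong[THEN iffD1, rotated -1]) (auto simp: algebra_simps)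
      fix u
      show "norm (indicator {lo n..hi n} u *\<^sub>R h z u - indicator X u *\<^sub>R h z u) \<le> indicator X u *\<^sub>R ((1 - indicator {lo n..hi n} u) * G u)"
        using lr(1)[of n] G(2)[OF z, of u] by (auto simp: indicator_def)
    qed
    finally show ?thesis .
  qed
  show "(\<lambda>z. LINT u:X|lborel. h z u) holomorphic_on U"
  proof (rule holomorphic_uniform_sequence[OF U(1) hI])
    fix x assume "x \<in> U"
    then obtain d where d: "d > 0" "cball x d \<subseteq> U" using U(1) open_contains_cball by blast
    have "uniform_limit (cball x d) I (\<lambda>z. LINT u:X|lborel. h z u) sequentially"
      unfolding uniform_limit_iff
    proof (intro allI impI)
      fix e :: real assume "e > 0"
      hence "\<forall>\<^sub>F n in sequentially. r n < e" using order_tendstoD(2)[OF r0] by blast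
      thus "\<forall>\<^sub>F n in sequentially. \<forall>z\<in>cball x d. dist (I n z) (LINT u:X|lborel. h z u) < e"
      proof eventually_elim
        case (elim n)
        show ?case
        proof
          fix z assume "z \<in> cball x d"
          hence "z \<in> U" using d by auto
          from le_less_trans[OF est[OF this] elim]
          show "dist (I n z) (LINT u:X|lborel. h z u) < e" by (simp only: dist_norm)
        qed
      qed
    qed
    thus "\<exists>d>0. cball x d \<subseteq> U \<and> uniform_limit (cball x d) I (\<lambda>z. LINT u:X|lborel. h z u) sequentially"
      using d by blast
  qed
qed

text \<open>
  The transform at \<open>\<lambda>\<close> is constant along real translations of the integration line, hence by
  analyticity also along imaginary ones.
\<close>

lemma K_hat_decay:
  assumes a: "a > 0"
  obtains C where "C > 0" "\<And>v. norm (K_hat a v) \<le> C * exp (- v)"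
proof -
  define C where "C = (LINT x|lborel. exp (- ((a * cos 1) * cosh x)))"
  have cos1: "cos (1::real) > 0" using cos_gt_zero[of 1] pi_gt3 by simp
  have ac: "a * cos 1 > 0" using a cos1 by simp
  have intC: "integrable lborel (\<lambda>x. exp (- ((a * cos 1) * cosh x)))"
    using integrable_kernel[OF ac, of 1] by simp
  have main: "norm (K_hat a v) \<le> C * exp (- v)" for v
  proof -
    define f where "f = (\<lambda>z. K_ker a z * exp (- (\<i> * of_real v * z)))"
    define f' where "f' = (\<lambda>z. - (of_real a * sinh z * K_ker a z) * exp (- (\<i> * of_real v * z)) + K_ker a z * (exp (- (\<i> * of_real v * z)) * (- (\<i> * of_real v))))"
    have df: "(f has_field_derivative f' z) (at z)" for z
      unfolding f_def f'_def by (auto intro!: derivative_eq_intros K_ker_deriv)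
    have cf: "continuous_on A f" for A unfolding f_def by (intro continuous_intros continuous_K_ker)
    have cf': "continuous_on A f'" for A
    proof -
      have "continuous_on A (sinh :: complex \<Rightarrow> complex)" unfolding sinh_def [abs_def] by (intro continuous_intros)
      thus ?thesis unfolding f'_def by (intro continuous_intros continuous_K_ker)
    qed
    \<comment> \<open>The height 5/4 exceeds 1, the imaginary shift wanted, and is below pi/2, so
      that \<open>cos (Im z)\<close> stays above \<open>\<kappa> > 0\<close> and the kernel decays
      on every shifted line.\<close>
    define U where "U = {z. - 1 < Re z \<and> Re z < 1 \<and> - (5 / 4) < Im z \<and> Im z < (5 / 4 :: real)}"
    have Ubox: "U = box (Complex (- 1) (- (5 / 4))) (Complex 1 (5 / 4))"
      by (auto simp: U_def in_box_complex_iff)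
    define \<kappa> where "\<kappa> = cos (5 / 4 :: real)"
    have \<kappa>: "\<kappa> > 0" unfolding \<kappa>_def using cos_gt_zero[of "5 / 4"] pi_gt3 by simp
    define G where "G = (\<lambda>u::real. exp (5 / 4 * \<bar>v\<bar>) * exp (- (a * \<kappa> * exp (- 1) * cosh (1 * u))))"
    have nf: "norm (f z) = exp (- (a * cosh (Re z) * cos (Im z))) * exp (v * Im z)" for z
      using norm_K_ker[of a "Re z" "Im z"] by (simp add: f_def norm_mult)
    have coshs: "cosh (x + u) \<ge> exp (- 1) * cosh u" if "\<bar>x\<bar> \<le> 1" for x u :: real
    proof -
      have "exp (- 1) * exp u \<le> exp (x + u)" "exp (- 1) * exp (- u) \<le> exp (- (x + u))"
        using that unfolding exp_add[symmetric] by auto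
      thus ?thesis by (simp add: cosh_def field_simps)
    qed
    have bd: "norm (f (z + of_real u)) \<le> G u" if z: "z \<in> U" for z u
    proof -
      have "cos \<bar>Im z\<bar> \<ge> \<kappa>" unfolding \<kappa>_def using z pi_gt3 by (intro cos_monotone_0_pi_le) (auto simp: U_def)
      hence c: "cos (Im z) \<ge> \<kappa>" by simp
      have ch: "cosh (Re z + u) \<ge> exp (- 1) * cosh u" using z by (intro coshs) (auto simp: U_def)
      have "a * (exp (- 1) * cosh u) * \<kappa> \<le> a * cosh (Re z + u) * cos (Im z)"
        using c ch a \<kappa> by (intro mult_mono) auto
      moreover have "v * Im z \<le> \<bar>v\<bar> * (5 / 4)"
      proof -
        have "v * Im z \<le> \<bar>v\<bar> * \<bar>Im z\<bar>" by (metis abs_ge_self abs_mult)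
        also have "\<dots> \<le> \<bar>v\<bar> * (5 / 4)" using z by (intro mult_left_mono) (auto simp: U_def)
        finally show ?thesis .
      qed
      ultimately show ?thesis unfolding nf G_def by (subst mult.commute) (intro mult_mono, auto simp: mult_ac)
    qed
    have "a * \<kappa> * exp (- 1) > 0" using a \<kappa> by simp
    hence intG: "integrable lborel G" unfolding G_def by (intro integrable_mult_right integrable_kernel) auto
    have G1: "set_integrable lborel UNIV G" using intG by (simp add: set_integrable_def)
    define I where "I = (\<lambda>z. LINT u:UNIV|lborel. f (z + of_real u))"
    have hol: "I holomorphic_on U" 
      unfolding I_def
    proof (rule holomorphic_param_integral(1)[where lo = "\<lambda>n. - real n" and hi = real and G = G and h' = "\<lambda>z u. f' (z + of_real u)"])
      show "open U" "convex U" unfolding Ubox by (auto simp: open_box convex_box)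
      show "\<forall>\<^sub>F n in sequentially. u \<in> {- real n..real n}" for u
        using eventually_ge_at_top[of "nat \<lceil>\<bar>u\<bar>\<rceil>"] by eventually_elim (auto simp: nat_le_iff abs_le_iff ceiling_le_iff)
      show "((\<lambda>z. f (z + of_real u)) has_field_derivative f' (z + of_real u)) (at z)" for z u
      proof -
        have "((\<lambda>z. z + complex_of_real u) has_field_derivative 1) (at z)" by (auto intro!: derivative_eq_intros)
        from DERIV_chain2[OF df this] show ?thesis by simp
      qed
      show "continuous_on (U \<times> UNIV) (\<lambda>(z, u). f' (z + complex_of_real u))"
        unfolding case_prod_unfold by (rule continuous_on_compose2[OF cf'[of UNIV]]) (auto intro!: continuous_intros)
      show "continuous_on UNIV (\<lambda>u. f (z + of_real u))" for z
        by (rule continuous_on_compose2[OF cf[of UNIV]]) (auto intro!: continuous_intros)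
    qed (use G1 bd in auto)
    have I: "I z = (LINT u|lborel. f (z + of_real u))" for z by (simp add: I_def set_lebesgue_integral_def)
    have real: "I (of_real x) = I 0" for x
      unfolding I using lborel_integral_real_affine[of 1 "\<lambda>u. f (of_real u)" x] by (simp add: add.commute)
    \<comment> \<open>On the line shifted to height -1 the exponential factor has norm
      \<open>exp (- v)\<close>, which is the decay claimed.\<close>
    have "I (- \<i>) - I 0 = 0"
    proof (rule analytic_continuation[of "\<lambda>z. I z - I 0" U "of_real ` {- 1 / 2..1 / 2}" 0 "- \<i>"])
      show "(\<lambda>z. I z - I 0) holomorphic_on U" by (intro holomorphic_intros hol)
      show "open U" "connected U" unfolding Ubox by (auto intro: convex_connected)
      show "(0::complex) islimpt of_real ` {- 1 / 2..1 / 2}"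
        unfolding islimpt_approachable
      proof (intro allI impI)
        fix e :: real assume "e > 0"
        thus "\<exists>x'\<in>complex_of_real ` {- 1 / 2..1 / 2}. x' \<noteq> 0 \<and> dist x' 0 < e"
          by (intro bexI[of _ "complex_of_real (min (1 / 2) (e / 2))"]) (auto simp: min_def)
      qed
      show "I z - I 0 = 0" if "z \<in> of_real ` {- 1 / 2..1 / 2}" for z using that real by auto
    qed (auto simp: U_def)
    moreover have "K_hat a v = I 0"
      unfolding K_hat_def fourier_def I f_def by simp
    ultimately have "norm (K_hat a v) = norm (LINT u|lborel. f (- \<i> + of_real u))" by (simp add: I)
    also have "\<dots> \<le> (LINT u|lborel. norm (f (- \<i> + of_real u)))" by (rule integral_norm_bound)
    also have "\<dots> = (LINT u|lborel. exp (- ((a * cos 1) * cosh u)) * exp (- v))"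
      by (simp add: nf mult_ac)
    also have "\<dots> = C * exp (- v)" by (simp add: C_def)
    finally show ?thesis .
  qed
  have "C \<ge> 0" unfolding C_def by (intro Bochner_Integration.integral_nonneg) auto
  show ?thesis
  proof (rule that[of "C + 1"])
    show "C + 1 > 0" using \<open>C \<ge> 0\<close> by simp
    show "norm (K_hat a v) \<le> (C + 1) * exp (- v)" for v
      by (rule order_trans[OF main]) (simp add: mult_right_mono)
  qed
qed

lemma scaled_kernel_transform:
  "(LINT u|lborel. of_real (exp (- (a * cosh (pi * u)))) * exp (- (\<i> * of_real v * of_real u))) = K_hat a (v / pi) / of_real pi"
proof -
  have "K_hat a (v / pi) = of_real pi * (LINT u|lborel. of_real (exp (- (a * cosh (pi * u)))) * exp (- (\<i> * of_real v * of_real u)))"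
    unfolding K_hat_def fourier_def K_ker_of_real
    by (subst lborel_integral_real_affine[of pi _ 0]) (simp_all add: scaleR_conv_of_real mult.assoc)
  thus ?thesis by simp
qed

section \<open>The convolution formula\<close>

definition kern :: "real \<Rightarrow> real \<Rightarrow> real" where
  "kern a u = exp (- (a * cosh (pi * u)))"

text \<open>The entire extension of \<open>kern\<close>: its primitive has to be evaluated at the
  complex point \<open>\<i> * (z - 1)\<close>, where the logarithm is singular.\<close>

definition ckern :: "real \<Rightarrow> complex \<Rightarrow> complex" where
  "ckern a z = K_ker a (of_real pi * z)"

definition hcoef :: "real \<Rightarrow> nat \<Rightarrow> real" where
  "hcoef a n = Lambda1 n * Re (K_hat a (ln (real n) / pi)) / pi"

lemma kern_nonneg [simp]: "kern a u \<ge> 0"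
  by (simp add: kern_def)

lemma ckern_of_real: "ckern a (of_real u) = of_real (kern a u)"
  using K_ker_of_real[of a "pi * u"] by (simp add: ckern_def kern_def)

lemma norm_ckern: "norm (ckern a (Complex x y)) = exp (- (a * cosh (pi * x) * cos (pi * y)))"
proof -
  have "of_real pi * Complex x y = Complex (pi * x) (pi * y)" by (simp add: complex_eq_iff)
  thus ?thesis by (simp add: ckern_def norm_K_ker)
qed

lemma ckern_deriv: "(ckern a has_field_derivative - (of_real a * sinh (of_real pi * z) * K_ker a (of_real pi * z)) * of_real pi) (at z)"
proof -
  have "((\<lambda>z. of_real pi * z) has_field_derivative of_real pi) (at z)" by (auto intro!: derivative_eq_intros)
  from DERIV_chain2[OF K_ker_deriv this] show ?thesis by (simp add: ckern_def [abs_def])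
qed

lemma ckern_holomorphic: "ckern a holomorphic_on A"
  using ckern_deriv by (auto simp: holomorphic_on_def field_differentiable_def intro: has_field_derivative_at_within)

lemma continuous_ckern: "continuous_on A (ckern a)"
  by (intro holomorphic_on_imp_continuous_on ckern_holomorphic)

lemma continuous_kern: "continuous_on A (kern a)"
  unfolding kern_def cosh_def [abs_def] by (intro continuous_intros)

lemma kern_measurable [measurable]: "kern a \<in> borel_measurable borel"
  by (rule borel_measurable_continuous_onI[OF continuous_kern])

lemma integrable_kern_linear: "a > 0 \<Longrightarrow> integrable lborel (\<lambda>u. kern a u * (c + d * \<bar>u\<bar>))"
  unfolding kern_def by (rule integrable_kernel_linear) auto

lemma integrable_kern: "a > 0 \<Longrightarrow> integrable lborel (kern a)"
  using integrable_kern_linear[of a 1 0] by simp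

lemma kern_le_outside:
  assumes "a > 0" "0 \<le> r" "r \<le> \<bar>u\<bar>"
  shows "kern a u \<le> exp (- (a * cosh (pi * r)))"
proof -
  have "cosh (pi * r) \<le> cosh \<bar>pi * u\<bar>"
    using assms by (subst cosh_real_nonneg_le_iff) (auto simp: abs_mult)
  thus ?thesis using assms by (simp add: kern_def)
qed

lemma integrable_kern_bounded:
  fixes g :: "real \<Rightarrow> 'b :: {banach, second_countable_topology, real_normed_field}"
  assumes "a > 0" "g \<in> borel_measurable borel" "\<And>u. norm (g u) \<le> c + d * \<bar>u\<bar>"
  shows "integrable lborel (\<lambda>u. of_real (kern a u) * g u)"
proof (rule Bochner_Integration.integrable_bound[OF integrable_kern_linear[OF assms(1), of c d]])
  show "(\<lambda>u. of_real (kern a u) * g u) \<in> borel_measurable lborel"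
    using assms(2) by measurable
  show "AE u in lborel. norm (of_real (kern a u) * g u) \<le> norm (kern a u * (c + d * \<bar>u\<bar>))"
  proof (rule AE_I2)
    fix u
    have "norm (of_real (kern a u) * g u) \<le> kern a u * (c + d * \<bar>u\<bar>)"
      unfolding norm_mult using assms(3)[of u] by (simp add: mult_left_mono)
    thus "norm (of_real (kern a u) * g u) \<le> norm (kern a u * (c + d * \<bar>u\<bar>))" by simp
  qed
qed

text \<open>Absolute convergence allows integration term by term, and the n-th power of the shift
  \<open>\<i> * u\<close> integrates to the transform of the kernel at the frequency ln n.\<close>

lemma dser_convolution:
  assumes a: "a > 0" and z: "Re z > 1"
  shows "integrable lborel (\<lambda>u. of_real (kern a u) * dser Lambda1 (z + \<i> * of_real u))"
    and "(LINT u|lborel. of_real (kern a u) * dser Lambda1 (z + \<i> * of_real u)) = dser (hcoef a) z"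
proof -
  define f where "f = (\<lambda>n u. of_real (kern a u) * (of_real (Lambda1 (Suc n)) * of_nat (Suc n) powr (- (z + \<i> * of_real u))) :: complex)"
  define L where "L = (\<lambda>n. ln (real (Suc n)))"
  have pw: "of_nat (Suc n) powr (- (z + \<i> * of_real u)) = of_nat (Suc n) powr (- z) * exp (- (\<i> * of_real (L n) * of_real u))" for n u
  proof -
    have "Ln (of_nat (Suc n)) = complex_of_real (L n)" using Ln_of_nat[of "Suc n"] by (simp add: L_def)
    thus ?thesis by (simp add: powr_def exp_add[symmetric] algebra_simps)
  qed
  have feq: "f n u = of_real (Lambda1 (Suc n)) * of_nat (Suc n) powr (- z) * (of_real (kern a u) * exp (- (\<i> * of_real (L n) * of_real u)))" for n u
    unfolding f_def pw by simp
  have ik: "integrable lborel (\<lambda>u. of_real (kern a u) * exp (- (\<i> * of_real (L n) * of_real u)) :: complex)" for n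
    by (rule integrable_kern_bounded[OF a, of _ 1 0]) (auto simp: borel_measurable_continuous_onI continuous_intros)
  have i1: "integrable lborel (f n)" for n
    unfolding feq by (rule integrable_mult_right[OF ik])
  have nf: "norm (f n u) = (\<bar>Lambda1 (Suc n)\<bar> * real (Suc n) powr (- Re z)) * kern a u" for n u
    unfolding f_def norm_mult[of "of_real (kern a u)"] norm_dser_term by simp
  have sm: "summable (\<lambda>n. \<bar>Lambda1 (Suc n)\<bar> * real (Suc n) powr (- Re z))"
    using dser_bounded_coeffs(1)[of Lambda1, OF abs_Lambda1_le_1 z] unfolding norm_dser_term .
  have s1: "AE u in lborel. summable (\<lambda>n. norm (f n u))"
    unfolding nf by (intro AE_I2 summable_mult2 sm)
  have s2: "summable (\<lambda>n. LINT u|lborel. norm (f n u))"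
    unfolding nf using summable_mult2[OF sm] by (simp del: of_nat_Suc)
  have sumf: "(\<Sum>n. f n u) = of_real (kern a u) * dser Lambda1 (z + \<i> * of_real u)" for u
    unfolding f_def dser_def
    using dser_bounded_coeffs(1)[of Lambda1 "z + \<i> * of_real u", OF abs_Lambda1_le_1] z
    by (intro suminf_mult) (auto dest: summable_norm_cancel)
  show "integrable lborel (\<lambda>u. of_real (kern a u) * dser Lambda1 (z + \<i> * of_real u))"
    using integrable_suminf[OF i1 s1 s2] by (simp add: sumf)
  have "(LINT u|lborel. of_real (kern a u) * dser Lambda1 (z + \<i> * of_real u)) = (\<Sum>n. LINT u|lborel. f n u)"
    using integral_suminf[OF i1 s1 s2] by (simp add: sumf)
  also have "(LINT u|lborel. f n u) = of_real (hcoef a (Suc n)) * of_nat (Suc n) powr (- z)" for n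
  proof -
    have "(LINT u|lborel. f n u) = of_real (Lambda1 (Suc n)) * of_nat (Suc n) powr (- z) * (K_hat a (L n / pi) / of_real pi)"
      unfolding feq by (subst integral_mult_right_zero) (simp only: kern_def scaled_kernel_transform)
    also have "K_hat a (L n / pi) = of_real (Re (K_hat a (L n / pi)))" by (simp only: K_hat_real)
    finally show ?thesis by (simp add: hcoef_def L_def)
  qed
  hence "(\<Sum>n. LINT u|lborel. f n u) = dser (hcoef a) z" by (simp add: dser_def)
  finally show "(LINT u|lborel. of_real (kern a u) * dser Lambda1 (z + \<i> * of_real u)) = dser (hcoef a) z" .
qed

text \<open>Linear growth of \<open>f\<close> is dominated by the kernel. This is applied to
  \<open>l\<close> on the whole line and to \<open>Ln (s - 1)\<close> on the two rays that avoid the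
  pole.\<close>

lemma holomorphic_kern_convolution:
  assumes f: "f holomorphic_on S" "open S" and U: "open U" "convex U" and a: "a > 0"
    and X: "closed X" "\<And>n. {lo n..hi n} \<subseteq> X" "\<And>u. u \<in> X \<Longrightarrow> \<forall>\<^sub>F n in sequentially. u \<in> {lo n..hi n}"
    and S: "\<And>z u. z \<in> U \<Longrightarrow> u \<in> X \<Longrightarrow> z + \<i> * of_real u \<in> S"
    and b: "\<And>z u. z \<in> U \<Longrightarrow> u \<in> X \<Longrightarrow> norm (f (z + \<i> * of_real u)) \<le> c + d * \<bar>u\<bar>"
  shows "(\<lambda>z. LINT u:X|lborel. of_real (kern a u) * f (z + \<i> * of_real u)) holomorphic_on U"
    and "\<And>z. z \<in> U \<Longrightarrow> set_integrable lborel X (\<lambda>u. of_real (kern a u) * f (z + \<i> * of_real u))"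
proof -
  have Xb: "X \<in> sets borel" using X(1) by simp
  have df: "((\<lambda>z. of_real (kern a u) * f (z + \<i> * of_real u)) has_field_derivative of_real (kern a u) * deriv f (z + \<i> * of_real u)) (at z)"
    if "z \<in> U" "u \<in> X" for z u
  proof -
    have "(f has_field_derivative deriv f (z + \<i> * of_real u)) (at (z + \<i> * of_real u))"
      by (rule holomorphic_derivI[OF f S[OF that]])
    moreover have "((\<lambda>z. z + \<i> * of_real u) has_field_derivative 1) (at z)" by (auto intro!: derivative_eq_intros)
    ultimately have "((\<lambda>z. f (z + \<i> * of_real u)) has_field_derivative deriv f (z + \<i> * of_real u) * 1) (at z)"
      by (rule DERIV_chain2)
    thus ?thesis by (auto intro!: derivative_eq_intros)
  qed
  have c1: "continuous_on (U \<times> X) (\<lambda>(z, u). of_real (kern a u) * deriv f (z + \<i> * of_real u))"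
    unfolding case_prod_unfold
  proof (intro continuous_intros)
    show "continuous_on (U \<times> X) (\<lambda>x. kern a (snd x))"
      by (rule continuous_on_compose2[OF continuous_kern[of UNIV]]) (auto intro!: continuous_intros)
    show "continuous_on (U \<times> X) (\<lambda>x. deriv f (fst x + \<i> * of_real (snd x)))"
      by (rule continuous_on_compose2[OF holomorphic_on_imp_continuous_on[OF holomorphic_deriv[OF f]]])
         (auto intro!: continuous_intros S)
  qed
  have c2: "continuous_on X (\<lambda>u. of_real (kern a u) * f (z + \<i> * of_real u))" if "z \<in> U" for z
  proof (intro continuous_intros continuous_kern)
    show "continuous_on X (\<lambda>u. f (z + \<i> * of_real u))"
      by (rule continuous_on_compose2[OF holomorphic_on_imp_continuous_on[OF f(1)]])
         (use that in \<open>auto intro!: continuous_intros S\<close>)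
  qed
  have G: "set_integrable lborel X (\<lambda>u. kern a u * (c + d * \<bar>u\<bar>))"
    unfolding set_integrable_def using integrable_kern_linear[OF a] Xb by (intro integrable_mult_indicator) auto
  have bd: "norm (of_real (kern a u) * f (z + \<i> * of_real u)) \<le> kern a u * (c + d * \<bar>u\<bar>)" if "z \<in> U" "u \<in> X" for z u
    unfolding norm_mult using b[OF that] by (simp add: mult_left_mono)
  show "(\<lambda>z. LINT u:X|lborel. of_real (kern a u) * f (z + \<i> * of_real u)) holomorphic_on U"
    by (rule holomorphic_param_integral(1)[OF U X df c1 c2 G bd])
  show "set_integrable lborel X (\<lambda>u. of_real (kern a u) * f (z + \<i> * of_real u))" if "z \<in> U" for z
    by (rule holomorphic_param_integral(2)[OF U X df c1 c2 G bd that])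
qed

text \<open>
  The logarithmic singularity met on the line \<open>Re z = 1\<close> is removed by an integration by parts against
  \<open>\<Phi> u - \<Phi> u\<^sub>0\<close>, where \<open>\<Phi>\<close> is a primitive of the kernel and \<open>u\<^sub>0 = \<i> (z - 1)\<close> the singular point:
  what is left is the difference quotient of \<open>\<Phi>\<close>, which is entire in \<open>z\<close>.
\<close>

definition pole_rem :: "real \<Rightarrow> real \<Rightarrow> complex \<Rightarrow> complex" where
  "pole_rem a t z = integral (cbox (- t - 1, 0) (- t + 1, 1))
     (\<lambda>p. ckern a (\<i> * (z - 1) + of_real (snd p) * (of_real (fst p) - \<i> * (z - 1))))"

lemma pole_rem_holomorphic: "pole_rem a t holomorphic_on UNIV"
  unfolding pole_rem_def [abs_def]
proof (rule leibniz_rule_holomorphic)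
  define k' where "k' = (\<lambda>z. - (of_real a * sinh (of_real pi * z) * K_ker a (of_real pi * z)) * of_real pi)"
  have ck: "continuous_on A k'" for A
  proof -
    have 1: "continuous_on A (\<lambda>z. sinh (of_real pi * z) :: complex)" for A
      unfolding sinh_def by (intro continuous_intros)
    have 2: "continuous_on A (\<lambda>z. K_ker a (of_real pi * z))" for A
      unfolding K_ker_def cosh_def by (intro continuous_intros)
    show ?thesis unfolding k'_def by (intro continuous_intros 1 2)
  qed
  show "((\<lambda>z. ckern a (\<i> * (z - 1) + of_real (snd p) * (of_real (fst p) - \<i> * (z - 1)))) has_field_derivative
      k' (\<i> * (z - 1) + of_real (snd p) * (of_real (fst p) - \<i> * (z - 1))) * (\<i> * (1 - of_real (snd p)))) (at z within UNIV)" for z and p :: "real \<times> real"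
  proof -
    have "((\<lambda>z. \<i> * (z - 1) + of_real (snd p) * (of_real (fst p) - \<i> * (z - 1))) has_field_derivative (\<i> * (1 - of_real (snd p)))) (at z)"
      by (auto intro!: derivative_eq_intros simp: algebra_simps)
    from DERIV_chain2[OF ckern_deriv this] show ?thesis by (simp add: k'_def)
  qed
  show "continuous_on (UNIV \<times> cbox (- t - 1, 0) (- t + 1, 1)) (\<lambda>(z, p). k' (\<i> * (z - 1) + of_real (snd p) * (of_real (fst p) - \<i> * (z - 1))) * (\<i> * (1 - of_real (snd p))))"
    unfolding case_prod_unfold by (intro continuous_intros continuous_on_compose2[OF ck[of UNIV]]) auto
  show "(\<lambda>p. ckern a (\<i> * (z - 1) + of_real (snd p) * (of_real (fst p) - \<i> * (z - 1)))) integrable_on cbox (- t - 1, 0) (- t + 1, 1)" for z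
    by (intro integrable_continuous continuous_on_compose2[OF continuous_ckern[of UNIV]]) (auto intro!: continuous_intros)
qed auto

text \<open>The fundamental theorem of calculus on the segment from \<open>u0\<close> to
  \<open>u\<close> turns the inner integral into the difference quotient;
  \<open>Re z \<noteq> 1\<close> keeps \<open>u0\<close> off the real line. The window is centred at
  \<open>- t\<close>, where the vertical line through a point of height \<open>t\<close> meets the
  real axis.\<close>

lemma pole_rem_eq:
  assumes \<Phi>: "\<And>z. (\<Phi> has_field_derivative ckern a z) (at z)" and z: "Re z \<noteq> 1"
  shows "pole_rem a t z = integral {- t - 1..- t + 1} (\<lambda>u. (\<Phi> (of_real u) - \<Phi> (\<i> * (z - 1))) / (of_real u - \<i> * (z - 1)))"
proof -
  define u0 where "u0 = \<i> * (z - 1)"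
  have c: "continuous_on (cbox (- t - 1, 0) (- t + 1, 1)) (\<lambda>p. ckern a (u0 + of_real (snd p) * (of_real (fst p) - u0)))"
    by (intro continuous_on_compose2[OF continuous_ckern[of UNIV]]) (auto intro!: continuous_intros)
  have "pole_rem a t z = integral (cbox (- t - 1) (- t + 1)) (\<lambda>u. integral (cbox 0 1) (\<lambda>x. ckern a (u0 + of_real x * (of_real u - u0))))"
    unfolding pole_rem_def u0_def[symmetric] by (subst integral_prod_continuous[OF c]) simp
  also have "(\<lambda>u. integral (cbox 0 1) (\<lambda>x. ckern a (u0 + of_real x * (of_real u - u0)))) = (\<lambda>u. (\<Phi> (of_real u) - \<Phi> u0) / (of_real u - u0))"
  proof
    fix u :: real
    have "Im u0 \<noteq> 0" using z by (simp add: u0_def)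
    hence nz: "of_real u - u0 \<noteq> 0" by (auto simp: complex_eq_iff)
    have "((\<lambda>x. ckern a (u0 + of_real x * (of_real u - u0))) has_integral
        (\<Phi> (u0 + of_real 1 * (of_real u - u0)) / (of_real u - u0) - \<Phi> (u0 + of_real 0 * (of_real u - u0)) / (of_real u - u0))) {0..1}"
    proof (rule fundamental_theorem_of_calculus)
      fix x :: real
      have "((\<lambda>w. u0 + w * (of_real u - u0)) has_field_derivative (of_real u - u0)) (at (of_real x))"
        by (auto intro!: derivative_eq_intros)
      from DERIV_chain2[OF \<Phi> this]
      have "((\<lambda>w. \<Phi> (u0 + w * (of_real u - u0)) / (of_real u - u0)) has_field_derivative ckern a (u0 + of_real x * (of_real u - u0))) (at (of_real x))"
        using nz by (auto intro!: derivative_eq_intros)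
      from has_vector_derivative_real_field[OF this]
      show "((\<lambda>x. \<Phi> (u0 + of_real x * (of_real u - u0)) / (of_real u - u0)) has_vector_derivative ckern a (u0 + of_real x * (of_real u - u0))) (at x within {0..1})"
        by (rule has_vector_derivative_at_within)
    qed simp
    thus "integral (cbox 0 1) (\<lambda>x. ckern a (u0 + of_real x * (of_real u - u0))) = (\<Phi> (of_real u) - \<Phi> u0) / (of_real u - u0)"
      by (simp add: integral_unique diff_divide_distrib)
  qed
  finally show ?thesis by (simp add: u0_def)
qed

text \<open>The boundary terms of that integration by parts. At the ends of the window the argument
  of \<open>Ln\<close> has imaginary part \<open>Im z - t\<close> plus or minus 1, so for
  \<open>Im z\<close> near \<open>t\<close> these terms continue past
  \<open>Re z = 1\<close>.\<close>

definition pole_ends :: "(complex \<Rightarrow> complex) \<Rightarrow> real \<Rightarrow> complex \<Rightarrow> complex" where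
  "pole_ends \<Phi> t z =
     (\<Phi> (of_real (- t + 1)) - \<Phi> (\<i> * (z - 1))) * Ln (z - 1 + \<i> * of_real (- t + 1)) -
     (\<Phi> (of_real (- t - 1)) - \<Phi> (\<i> * (z - 1))) * Ln (z - 1 + \<i> * of_real (- t - 1))"

text \<open>Since \<open>z - 1 + \<i> * u\<close> equals \<open>\<i> * (u - u0)\<close>, the
  logarithm has derivative \<open>1 / (u - u0)\<close> in \<open>u\<close>; normalising the
  primitive of the kernel to vanish at \<open>u0\<close> cancels this singularity.\<close>

lemma pole_mid_eq:
  assumes \<Phi>: "\<And>z. (\<Phi> has_field_derivative ckern a z) (at z)" and z: "Re z > 1"
  shows "integral {- t - 1..- t + 1} (\<lambda>u. of_real (kern a u) * Ln (z - 1 + \<i> * of_real u)) = pole_ends \<Phi> t z - pole_rem a t z"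
proof -
  define u0 where "u0 = \<i> * (z - 1)"
  have nz: "of_real u - u0 \<noteq> 0" for u
  proof -
    have "Im u0 \<noteq> 0" using z by (simp add: u0_def)
    thus ?thesis by (auto simp: complex_eq_iff)
  qed
  have nn: "z - 1 + \<i> * of_real u \<notin> \<real>\<^sub>\<le>\<^sub>0" for u using z by (simp add: complex_nonpos_Reals_iff)
  have c\<Phi>: "continuous_on A \<Phi>" for A
    using \<Phi> by (meson DERIV_isCont continuous_at_imp_continuous_on)
  have h: "((\<lambda>u. of_real (kern a u) * Ln (z - 1 + \<i> * of_real u) + (\<Phi> (of_real u) - \<Phi> u0) / (of_real u - u0)) has_integral
     ((\<Phi> (of_real (- t + 1)) - \<Phi> u0) * Ln (z - 1 + \<i> * of_real (- t + 1)) - (\<Phi> (of_real (- t - 1)) - \<Phi> u0) * Ln (z - 1 + \<i> * of_real (- t - 1)))) {- t - 1..- t + 1}"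
  proof (rule fundamental_theorem_of_calculus)
    fix u :: real
    have e: "z - 1 + \<i> * of_real u = \<i> * (of_real u - u0)" by (simp add: u0_def algebra_simps)
    have "((\<lambda>w. (\<Phi> w - \<Phi> u0) * Ln (z - 1 + \<i> * w)) has_field_derivative
        ckern a (of_real u) * Ln (z - 1 + \<i> * of_real u) + (\<Phi> (of_real u) - \<Phi> u0) * (\<i> / (z - 1 + \<i> * of_real u))) (at (of_real u))"
      using nn[of u] by (auto intro!: derivative_eq_intros \<Phi> simp: algebra_simps divide_inverse)
    also have "\<i> / (z - 1 + \<i> * of_real u) = 1 / (of_real u - u0)" unfolding e by simp
    finally have "((\<lambda>w. (\<Phi> w - \<Phi> u0) * Ln (z - 1 + \<i> * w)) has_field_derivative
        of_real (kern a u) * Ln (z - 1 + \<i> * of_real u) + (\<Phi> (of_real u) - \<Phi> u0) / (of_real u - u0)) (at (of_real u))"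
      by (simp add: ckern_of_real)
    from has_vector_derivative_real_field[OF this]
    show "((\<lambda>u. (\<Phi> (of_real u) - \<Phi> u0) * Ln (z - 1 + \<i> * of_real u)) has_vector_derivative
        of_real (kern a u) * Ln (z - 1 + \<i> * of_real u) + (\<Phi> (of_real u) - \<Phi> u0) / (of_real u - u0)) (at u within {- t - 1..- t + 1})"
      by (rule has_vector_derivative_at_within)
  qed simp
  have i1: "(\<lambda>u. of_real (kern a u) * Ln (z - 1 + \<i> * of_real u)) integrable_on {- t - 1..- t + 1}"
    by (intro integrable_continuous_real continuous_intros continuous_kern) (use nn in auto)
  have i2: "(\<lambda>u. (\<Phi> (of_real u) - \<Phi> u0) / (of_real u - u0)) integrable_on {- t - 1..- t + 1}"
    by (intro integrable_continuous_real continuous_intros continuous_on_compose2[OF c\<Phi>[of UNIV]]) (use nz in auto)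
  have "pole_rem a t z = integral {- t - 1..- t + 1} (\<lambda>u. (\<Phi> (of_real u) - \<Phi> u0) / (of_real u - u0))"
    using pole_rem_eq[OF \<Phi>, of z t] z by (simp add: u0_def)
  moreover have "integral {- t - 1..- t + 1} (\<lambda>u. of_real (kern a u) * Ln (z - 1 + \<i> * of_real u) + (\<Phi> (of_real u) - \<Phi> u0) / (of_real u - u0)) = pole_ends \<Phi> t z"
    using integral_unique[OF h] by (simp add: pole_ends_def u0_def)
  ultimately show ?thesis
    using Henstock_Kurzweil_Integration.integral_add[OF i1 i2] by (simp add: algebra_simps)
qed

lemma norm_Ln_linear:
  assumes "norm w \<ge> 1 / 2"
  shows "norm (Ln w) \<le> norm w + 5"
proof -
  have w: "w \<noteq> 0" using assms by auto
  have "ln (norm w) \<le> norm w" using ln_le_minus_one[of "norm w"] w by simp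
  moreover have "ln (1 / 2) \<le> ln (norm w)" using assms by (intro ln_mono) auto
  moreover have "ln (1 / 2 :: real) \<ge> - 1" using ln_le_minus_one[of 2] by (simp add: ln_div)
  ultimately have "\<bar>Re (Ln w)\<bar> \<le> norm w + 1" using norm_ge_zero[of w] by (simp add: Re_Ln[OF w] del: norm_ge_zero)
  moreover have "\<bar>Im (Ln w)\<bar> \<le> 4" using abs_Im_Ln_le_pi[OF w] pi_less_4 by linarith
  ultimately show ?thesis using cmod_le[of "Ln w"] by linarith
qed


text \<open>One majorant serves the whole closed half-plane. Continuity up to its boundary later
  permits the step onto the line \<open>Re s = 1 / 2\<close>.\<close>

lemma dser_half_plane:
  assumes sm: "summable (\<lambda>n. \<bar>c (Suc n)\<bar> * real (Suc n) powr (- \<sigma>))"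
  shows "dser c holomorphic_on {s. Re s > \<sigma>}" and "continuous_on {s. Re s \<ge> \<sigma>} (dser c)"
    and "\<And>s. Re s \<ge> \<sigma> \<Longrightarrow> summable (\<lambda>n. norm (of_real (c (Suc n)) * of_nat (Suc n) powr (- s) :: complex))"
proof -
  define p where "p = (\<lambda>n s. \<Sum>i<n. of_real (c (Suc i)) * of_nat (Suc i) powr (- s) :: complex)"
  have bd: "norm (of_real (c (Suc n)) * of_nat (Suc n) powr (- s) :: complex) \<le> \<bar>c (Suc n)\<bar> * real (Suc n) powr (- \<sigma>)" if "Re s \<ge> \<sigma>" for n s
    unfolding norm_dser_term using that by (intro mult_left_mono powr_mono) auto
  show "summable (\<lambda>n. norm (of_real (c (Suc n)) * of_nat (Suc n) powr (- s) :: complex))" if "Re s \<ge> \<sigma>" for s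
    by (rule summable_comparison_test'[OF sm, of 0]) (use bd[OF that] in simp)
  have ul: "uniform_limit {s. Re s \<ge> \<sigma>} p (dser c) sequentially"
    unfolding p_def dser_def [abs_def] by (rule Weierstrass_m_test[OF _ sm]) (use bd in auto)
  have hp: "p n holomorphic_on A" for n A
    unfolding p_def by (intro holomorphic_intros) (auto simp del: of_nat_Suc)
  show "continuous_on {s. Re s \<ge> \<sigma>} (dser c)"
    by (rule uniform_limit_theorem[OF _ ul]) (auto intro!: always_eventually holomorphic_on_imp_continuous_on hp)
  show "dser c holomorphic_on {s. Re s > \<sigma>}"
  proof (rule holomorphic_uniform_sequence[OF open_halfspace_Re_gt hp])
    fix x assume "x \<in> {s. Re s > \<sigma>}"
    then obtain d where d: "d > 0" "cball x d \<subseteq> {s. Re s > \<sigma>}"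
      using open_halfspace_Re_gt open_contains_cball by blast
    have "uniform_limit (cball x d) p (dser c) sequentially"
      by (rule uniform_limit_on_subset[OF ul]) (use d in auto)
    thus "\<exists>d>0. cball x d \<subseteq> {s. Re s > \<sigma>} \<and> uniform_limit (cball x d) p (dser c) sequentially"
      using d by blast
  qed
qed

lemma lborel_integral_split3:
  fixes g :: "real \<Rightarrow> 'a :: euclidean_space"
  assumes g: "integrable lborel g" and b: "b1 < b2"
  shows "(LINT u|lborel. g u) = (LINT u:{..b1}|lborel. g u) + integral {b1..b2} g + (LINT u:{b2..}|lborel. g u)"
proof -
  have si: "set_integrable lborel A g" if "A \<in> sets borel" for A
    unfolding set_integrable_def using g that by (intro integrable_mult_indicator) auto
  have "(LINT u|lborel. g u) = (LINT u|lborel. indicator {..b1} u *\<^sub>R g u + indicator {b1<..<b2} u *\<^sub>R g u + indicator {b2..} u *\<^sub>R g u)"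
    using b by (intro Bochner_Integration.integral_cong) (auto simp: indicator_def)
  also have "\<dots> = (LINT u:{..b1}|lborel. g u) + (LINT u:{b1<..<b2}|lborel. g u) + (LINT u:{b2..}|lborel. g u)"
    using si[of "{..b1}"] si[of "{b1<..<b2}"] si[of "{b2..}"] unfolding set_integrable_def set_lebesgue_integral_def by simp
  also have "(LINT u:{b1<..<b2}|lborel. g u) = integral {b1..b2} g"
    using set_borel_integral_eq_integral(2)[OF si[of "{b1<..<b2}"]] by (simp add: integral_open_interval_real)
  finally show ?thesis .
qed

context zeta_log
begin

text \<open>For \<open>Re z > 1\<close> the identity comes from splitting \<open>l\<close> into
  Dirichlet series and \<open>Ln (s - 1)\<close> and cutting the integral of the latter at the ends
  of the window. Both sides are holomorphic in a box that reaches towards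
  \<open>Re z = 1 / 2\<close>, so the identity persists there.\<close>

lemma kern_log_convolution:
  assumes a: "a > 0" and sm: "summable (\<lambda>n. \<bar>hcoef a (Suc n)\<bar> * real (Suc n) powr (- (1 / 2)))"
    and \<Phi>: "\<And>z. (\<Phi> has_field_derivative ckern a z) (at z)"
    and z: "1 / 2 < Re z" "Re z < 2" "\<bar>Im z - t\<bar> < 1 / 2"
  shows "integrable lborel (\<lambda>u. of_real (kern a u) * l (z + \<i> * of_real u))"
    and "set_integrable lborel {..- t - 1} (\<lambda>u. of_real (kern a u) * Ln (z - 1 + \<i> * of_real u))"
    and "set_integrable lborel {- t + 1..} (\<lambda>u. of_real (kern a u) * Ln (z - 1 + \<i> * of_real u))"
    and "(LINT u|lborel. of_real (kern a u) * l (z + \<i> * of_real u)) = dser (hcoef a) z +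
       (LINT u:{..- t - 1}|lborel. of_real (kern a u) * Ln (z - 1 + \<i> * of_real u)) +
       (LINT u:{- t + 1..}|lborel. of_real (kern a u) * Ln (z - 1 + \<i> * of_real u)) +
       pole_ends \<Phi> t z - pole_rem a t z"
proof -
  define \<delta> where "\<delta> = (Re z - 1 / 2) / 2"
  have \<delta>: "\<delta> > 0" "1 / 2 + \<delta> < Re z" using z by (auto simp: \<delta>_def field_simps)
  \<comment> \<open>The half-height is 1/2: as \<open>u + t\<close> has absolute value at least 1 on
    the rays, the argument of \<open>Ln\<close> keeps the distance 1/2 from the real axis.\<close>
  define U where "U = box (Complex (1 / 2 + \<delta>) (t - 1 / 2)) (Complex 2 (t + 1 / 2))"
  have Uiff: "w \<in> U \<longleftrightarrow> 1 / 2 + \<delta> < Re w \<and> Re w < 2 \<and> t - 1 / 2 < Im w \<and> Im w < t + 1 / 2" for w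
    by (auto simp: U_def in_box_complex_iff)
  have U: "open U" "convex U" by (auto simp: U_def open_box convex_box)
  have "t - 1 / 2 < Im z" "Im z < t + 1 / 2" using z(3) by linarith+
  hence zU: "z \<in> U" using z \<delta> by (simp add: Uiff)
  obtain C where C: "C > 0" "\<And>\<sigma> \<tau>. 1 / 2 + \<delta> \<le> \<sigma> \<Longrightarrow> \<sigma> \<le> 2 \<Longrightarrow> norm (l (Complex \<sigma> \<tau>)) \<le> C * ln (\<bar>\<tau>\<bar> + 2)"
    using l_growth[OF \<delta>(1)] by blast
  have lb: "norm (l (w + \<i> * of_real u)) \<le> C * (\<bar>t\<bar> + 2) + C * \<bar>u\<bar>" if w: "w \<in> U" for w u
  proof -
    have "w + \<i> * of_real u = Complex (Re w) (Im w + u)" by (simp add: complex_eq_iff)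
    hence "norm (l (w + \<i> * of_real u)) \<le> C * ln (\<bar>Im w + u\<bar> + 2)" using C(2)[of "Re w" "Im w + u"] w by (simp add: Uiff)
    also have "ln (\<bar>Im w + u\<bar> + 2) \<le> \<bar>Im w + u\<bar> + 1" by (rule order_trans[OF ln_le_minus_one]) auto
    also have "\<dots> \<le> \<bar>t\<bar> + 2 + \<bar>u\<bar>" using w by (auto simp: Uiff abs_if)
    finally show ?thesis using C(1) by (simp add: algebra_simps)
  qed
  have ev: "\<forall>\<^sub>F n in sequentially. real n \<ge> x" for x :: real
    using eventually_ge_at_top[of "nat \<lceil>x\<rceil>"] by eventually_elim (simp add: nat_le_iff ceiling_le_iff)
  have conv1: "(\<lambda>w. LINT u:UNIV|lborel. of_real (kern a u) * l (w + \<i> * of_real u)) holomorphic_on U"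
    "\<And>w. w \<in> U \<Longrightarrow> set_integrable lborel UNIV (\<lambda>u. of_real (kern a u) * l (w + \<i> * of_real u))"
  proof -
    have e: "\<forall>\<^sub>F n in sequentially. u \<in> {- real n..real n}" for u
      using ev[of "\<bar>u\<bar>"] by eventually_elim auto
    have S: "w + \<i> * of_real u \<in> {s. 1 / 2 < Re s}" if "w \<in> U" for w u using that \<delta> by (simp add: Uiff)
    note * = holomorphic_kern_convolution[OF l_holo open_halfspace_Re_gt U a closed_UNIV subset_UNIV e S lb]
    show "(\<lambda>w. LINT u:UNIV|lborel. of_real (kern a u) * l (w + \<i> * of_real u)) holomorphic_on U" by (rule *(1))
    show "set_integrable lborel UNIV (\<lambda>u. of_real (kern a u) * l (w + \<i> * of_real u))" if "w \<in> U" for w by (rule *(2)[OF _ _ that])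
  qed
  have Lnh: "(\<lambda>s. Ln (s - 1)) holomorphic_on {s. Im s \<noteq> 0}"
    by (intro holomorphic_intros) (auto simp: complex_nonpos_Reals_iff)
  have opI: "open {s. Im s \<noteq> 0}"
  proof -
    have "{s. Im s \<noteq> 0} = {s. Im s < 0} \<union> {s. Im s > 0}" by auto
    thus ?thesis by (simp add: open_Un open_halfspace_Im_lt open_halfspace_Im_gt)
  qed
  have Lb: "norm (Ln (w + \<i> * of_real u - 1)) \<le> (\<bar>t\<bar> + 8) + 1 * \<bar>u\<bar>" if w: "w \<in> U" and u: "u \<le> - t - 1 \<or> u \<ge> - t + 1" for w u
  proof -
    define v where "v = w + \<i> * of_real u - 1"
    have "\<bar>Im v\<bar> \<ge> 1 / 2" using w u by (auto simp: v_def Uiff abs_if)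
    hence "norm v \<ge> 1 / 2" using abs_Im_le_cmod[of v] by linarith
    hence "norm (Ln v) \<le> norm v + 5" by (rule norm_Ln_linear)
    also have "norm v \<le> \<bar>Re v\<bar> + \<bar>Im v\<bar>" by (rule cmod_le)
    also have "\<bar>Re v\<bar> \<le> 1" using w \<delta> by (auto simp: v_def Uiff abs_if)
    also have "\<bar>Im v\<bar> \<le> \<bar>t\<bar> + 1 / 2 + \<bar>u\<bar>" using w by (auto simp: v_def Uiff abs_if)
    finally show ?thesis by (simp add: v_def)
  qed
  have Sx: "w + \<i> * of_real u \<in> {s. Im s \<noteq> 0}" if w: "w \<in> U" and u: "u \<le> - t - 1 \<or> u \<ge> - t + 1" for w u
    using w u by (auto simp: Uiff)
  have sh: "w + \<i> * of_real u - 1 = w - 1 + \<i> * of_real u" for w u by simp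
  have conv2: "(\<lambda>w. LINT u:{..- t - 1}|lborel. of_real (kern a u) * Ln (w - 1 + \<i> * of_real u)) holomorphic_on U"
    "\<And>w. w \<in> U \<Longrightarrow> set_integrable lborel {..- t - 1} (\<lambda>u. of_real (kern a u) * Ln (w - 1 + \<i> * of_real u))"
  proof -
    have e: "\<forall>\<^sub>F n in sequentially. u \<in> {- real n..- t - 1}" if "u \<in> {..- t - 1}" for u
      using ev[of "- u"] by eventually_elim (use that in auto)
    have s: "{- real n..- t - 1} \<subseteq> {..- t - 1}" for n by auto
    note * = holomorphic_kern_convolution[where f = "\<lambda>s. Ln (s - 1)" and X = "{..- t - 1}" and lo = "\<lambda>n. - real n" and hi = "\<lambda>_. - t - 1",
        OF Lnh opI U a closed_atMost s e Sx Lb, unfolded sh]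
    show "(\<lambda>w. LINT u:{..- t - 1}|lborel. of_real (kern a u) * Ln (w - 1 + \<i> * of_real u)) holomorphic_on U" by (rule *(1)) auto
    show "set_integrable lborel {..- t - 1} (\<lambda>u. of_real (kern a u) * Ln (w - 1 + \<i> * of_real u))" if "w \<in> U" for w by (rule *(2)) (use that in auto)
  qed
  have conv3: "(\<lambda>w. LINT u:{- t + 1..}|lborel. of_real (kern a u) * Ln (w - 1 + \<i> * of_real u)) holomorphic_on U"
    "\<And>w. w \<in> U \<Longrightarrow> set_integrable lborel {- t + 1..} (\<lambda>u. of_real (kern a u) * Ln (w - 1 + \<i> * of_real u))"
  proof -
    have e: "\<forall>\<^sub>F n in sequentially. u \<in> {- t + 1..real n}" if "u \<in> {- t + 1..}" for u
      using ev[of u] by eventually_elim (use that in auto)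
    have s: "{- t + 1..real n} \<subseteq> {- t + 1..}" for n by auto
    note * = holomorphic_kern_convolution[where f = "\<lambda>s. Ln (s - 1)" and X = "{- t + 1..}" and lo = "\<lambda>_. - t + 1" and hi = real,
        OF Lnh opI U a closed_atLeast s e Sx Lb, unfolded sh]
    show "(\<lambda>w. LINT u:{- t + 1..}|lborel. of_real (kern a u) * Ln (w - 1 + \<i> * of_real u)) holomorphic_on U" by (rule *(1)) auto
    show "set_integrable lborel {- t + 1..} (\<lambda>u. of_real (kern a u) * Ln (w - 1 + \<i> * of_real u))" if "w \<in> U" for w by (rule *(2)) (use that in auto)
  qed
  show int1: "integrable lborel (\<lambda>u. of_real (kern a u) * l (z + \<i> * of_real u))"
    using conv1(2)[OF zU] by (simp add: set_integrable_def)
  show "set_integrable lborel {..- t - 1} (\<lambda>u. of_real (kern a u) * Ln (z - 1 + \<i> * of_real u))" by (rule conv2(2)[OF zU])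
  show "set_integrable lborel {- t + 1..} (\<lambda>u. of_real (kern a u) * Ln (z - 1 + \<i> * of_real u))" by (rule conv3(2)[OF zU])
  define A where "A = (\<lambda>w. LINT u:UNIV|lborel. of_real (kern a u) * l (w + \<i> * of_real u))"
  define B where "B = (\<lambda>w. dser (hcoef a) w +
       (LINT u:{..- t - 1}|lborel. of_real (kern a u) * Ln (w - 1 + \<i> * of_real u)) +
       (LINT u:{- t + 1..}|lborel. of_real (kern a u) * Ln (w - 1 + \<i> * of_real u)) +
       pole_ends \<Phi> t w - pole_rem a t w)"
  have h\<Phi>: "\<Phi> holomorphic_on UNIV" using \<Phi> by (auto simp: holomorphic_on_open)
  have hends: "pole_ends \<Phi> t holomorphic_on U"
  proof -
    have 1: "(\<lambda>w. \<Phi> (\<i> * (w - 1))) holomorphic_on U"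
      by (rule holomorphic_on_compose_gen[OF _ h\<Phi>, unfolded o_def]) (auto intro!: holomorphic_intros)
    have 2: "(\<lambda>w. Ln (w - 1 + \<i> * of_real x)) holomorphic_on U" if "x = - t + 1 \<or> x = - t - 1" for x
      using that by (intro holomorphic_intros) (auto simp: complex_nonpos_Reals_iff Uiff)
    show ?thesis unfolding pole_ends_def [abs_def] by (intro holomorphic_intros 1 2) auto
  qed
  have hB: "B holomorphic_on U"
    unfolding B_def
  proof (intro holomorphic_intros conv2(1) conv3(1) hends)
    show "dser (hcoef a) holomorphic_on U"
      using dser_half_plane(1)[OF sm] by (rule holomorphic_on_subset) (use \<delta> in \<open>auto simp: Uiff\<close>)
    show "pole_rem a t holomorphic_on U" using pole_rem_holomorphic by (rule holomorphic_on_subset) simp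
  qed
  have "A z = B z"
  proof (rule analytic_continuation_open[of "U \<inter> {w. Re w > 1}" U A B])
    show "open (U \<inter> {w. Re w > 1})" by (intro open_Int U open_halfspace_Re_gt)
    have "\<delta> < 3 / 4" using z by (simp add: \<delta>_def)
    hence "Complex (3 / 2) t \<in> U \<inter> {w. Re w > 1}" by (simp add: Uiff)
    thus "U \<inter> {w. Re w > 1} \<noteq> {}" by blast
    show "connected U" using U by (intro convex_connected)
    show "A holomorphic_on U" unfolding A_def by (rule conv1(1))
    fix w assume w: "w \<in> U \<inter> {w. Re w > 1}"
    have lw: "l (w + \<i> * of_real u) = dser Lambda1 (w + \<i> * of_real u) + Ln (w - 1 + \<i> * of_real u)" for u
      using l_dser[of "w + \<i> * of_real u"] w by (simp add: sh)
    have i1: "integrable lborel (\<lambda>u. of_real (kern a u) * l (w + \<i> * of_real u))"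
      using conv1(2)[of w] w by (simp add: set_integrable_def)
    have i2: "integrable lborel (\<lambda>u. of_real (kern a u) * dser Lambda1 (w + \<i> * of_real u))"
      using w by (intro dser_convolution(1) a) auto
    have i3: "integrable lborel (\<lambda>u. of_real (kern a u) * Ln (w - 1 + \<i> * of_real u))"
      using Bochner_Integration.integrable_diff[OF i1 i2] by (simp add: lw algebra_simps)
    have b12: "- t - 1 < - t + 1" by simp
    have mid: "integral {- t - 1..- t + 1} (\<lambda>u. of_real (kern a u) * Ln (w - 1 + \<i> * of_real u)) = pole_ends \<Phi> t w - pole_rem a t w"
      using w by (intro pole_mid_eq \<Phi>) auto
    have "A w = (LINT u|lborel. of_real (kern a u) * dser Lambda1 (w + \<i> * of_real u) + of_real (kern a u) * Ln (w - 1 + \<i> * of_real u))"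
      by (simp add: A_def set_lebesgue_integral_def lw distrib_left)
    also have "\<dots> = dser (hcoef a) w + (LINT u|lborel. of_real (kern a u) * Ln (w - 1 + \<i> * of_real u))"
      using w by (subst Bochner_Integration.integral_add[OF i2 i3]) (simp add: dser_convolution(2)[OF a])
    also have "(LINT u|lborel. of_real (kern a u) * Ln (w - 1 + \<i> * of_real u)) =
       (LINT u:{..- t - 1}|lborel. of_real (kern a u) * Ln (w - 1 + \<i> * of_real u)) + (pole_ends \<Phi> t w - pole_rem a t w) +
       (LINT u:{- t + 1..}|lborel. of_real (kern a u) * Ln (w - 1 + \<i> * of_real u))"
      by (simp only: lborel_integral_split3[OF i3 b12] mid)
    finally show "A w = B w" by (simp add: B_def)
  qed (use U zU hB in auto)
  thus "(LINT u|lborel. of_real (kern a u) * l (z + \<i> * of_real u)) = dser (hcoef a) z +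
       (LINT u:{..- t - 1}|lborel. of_real (kern a u) * Ln (z - 1 + \<i> * of_real u)) +
       (LINT u:{- t + 1..}|lborel. of_real (kern a u) * Ln (z - 1 + \<i> * of_real u)) +
       pole_ends \<Phi> t z - pole_rem a t z"
    by (simp add: A_def B_def set_lebesgue_integral_def)
qed

end

section \<open>Size of the pole contribution near the critical line\<close>

definition pole_err :: "real \<Rightarrow> real \<Rightarrow> real" where
  "pole_err a t = exp (- (a * cosh (pi * (t - 1)))) + 1 / (2 * (a * cosh (pi * t)))"

text \<open>A concave function lies above its chord. This replaces
  \<open>exp (- (c * cos (pi * v)))\<close> by an exponential with an elementary primitive, valid up
  to \<open>v = 1 / 2\<close>, where the decay of the kernel stops.\<close>

lemma cos_pi_ge_linear:
  assumes "0 \<le> v" "v \<le> 1 / 2"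
  shows "cos (pi * v) \<ge> 1 - 2 * v"
proof -
  have "concave_on {0..1 / 2} (\<lambda>v. cos (pi * v))"
  proof (rule f''_le0_imp_concave)
    fix x :: real assume x: "x \<in> {0..1 / 2}"
    show "((\<lambda>v. cos (pi * v)) has_real_derivative - sin (pi * x) * pi) (at x)"
      by (auto intro!: derivative_eq_intros)
    show "((\<lambda>x. - sin (pi * x) * pi) has_real_derivative - (cos (pi * x) * pi * pi)) (at x)"
      by (auto intro!: derivative_eq_intros)
    have "cos (pi * x) \<ge> 0" using x by (intro cos_ge_zero) (auto intro: order_trans[of _ 0])
    thus "- (cos (pi * x) * pi * pi) \<le> 0" by simp
  qed simp
  from concave_onD_Icc[OF this, of "2 * v"] assms show ?thesis by simp
qed

lemma ln_shift_le: "ln (\<bar>t + u\<bar> + 2) \<le> ln (\<bar>t\<bar> + 2) + \<bar>u\<bar>" for t u :: real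
proof -
  have "\<bar>t + u\<bar> + 2 \<le> (\<bar>t\<bar> + 2) * (1 + \<bar>u\<bar>)"
  proof -
    have "(\<bar>t\<bar> + 2) * (1 + \<bar>u\<bar>) = \<bar>t\<bar> + 2 + \<bar>u\<bar> + (\<bar>t\<bar> + 1) * \<bar>u\<bar>" by (simp add: algebra_simps)
    moreover have "0 \<le> (\<bar>t\<bar> + 1) * \<bar>u\<bar>" by simp
    ultimately show ?thesis by linarith
  qed
  hence "ln (\<bar>t + u\<bar> + 2) \<le> ln ((\<bar>t\<bar> + 2) * (1 + \<bar>u\<bar>))" by (intro ln_mono) auto
  also have "\<dots> = ln (\<bar>t\<bar> + 2) + ln (1 + \<bar>u\<bar>)" by (rule ln_mult_pos) auto
  also have "ln (1 + \<bar>u\<bar>) \<le> \<bar>u\<bar>" by (rule ln_add_one_self_le_self) simp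
  finally show ?thesis by simp
qed

text \<open>The path from \<open>u\<close> to the singular point runs along the real axis to
  \<open>- t\<close> and vertically from there. On the real piece, of length at most 1, the kernel
  is at most its value at \<open>t - 1\<close>. The vertical piece costs at most the integral of
  \<open>exp (- (c * (1 - 2 * v)))\<close>, hence \<open>1 / (2 * c)\<close> with
  \<open>c = a * cosh (pi * t)\<close>. These are the two summands of
  \<open>pole_err\<close>.\<close>

lemma primitive_variation_near_pole:
  assumes a: "a > 0" and \<Phi>: "\<And>z. (\<Phi> has_field_derivative ckern a z) (at z)" and t: "t \<ge> 1" and w: "0 < w" "w \<le> 1 / 4"
    and u: "u \<in> {- t - 1..- t + 1}"
  shows "norm (\<Phi> (of_real u) - \<Phi> (Complex (- t) (w - 1 / 2))) \<le> pole_err a t"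
proof -
  have 1: "norm (\<Phi> (of_real u) - \<Phi> (of_real (- t))) \<le> exp (- (a * cosh (pi * (t - 1)))) * norm (of_real u - of_real (- t) :: complex)"
  proof (rule field_differentiable_bound)
    show "convex (complex_of_real ` {- t - 1..- t + 1})"
      by (rule convex_linear_image) (auto intro: linearI simp: scaleR_conv_of_real)
    show "(\<Phi> has_field_derivative ckern a z) (at z within complex_of_real ` {- t - 1..- t + 1})" for z
      by (rule has_field_derivative_at_within[OF \<Phi>])
    fix z assume "z \<in> complex_of_real ` {- t - 1..- t + 1}"
    then obtain x where x: "z = of_real x" "x \<in> {- t - 1..- t + 1}" by blast
    have "kern a x \<le> exp (- (a * cosh (pi * (t - 1))))" using x t by (intro kern_le_outside a) auto
    thus "norm (ckern a z) \<le> exp (- (a * cosh (pi * (t - 1))))" by (simp add: x ckern_of_real)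
  qed (use u in auto)
  have "norm (of_real u - of_real (- t) :: complex) \<le> 1"
    using u norm_of_real[of "u + t", where ?'a = complex] by (auto simp: abs_le_iff)
  hence 1: "norm (\<Phi> (of_real u) - \<Phi> (of_real (- t))) \<le> exp (- (a * cosh (pi * (t - 1))))"
    by (intro order_trans[OF 1] mult_left_le) auto
  define c where "c = a * cosh (pi * t)"
  have c: "c > 0" using a by (simp add: c_def)
  have 2: "norm (\<Phi> (Complex (- t) (- (1 / 2 - w))) - \<Phi> (Complex (- t) (- 0))) \<le> exp (- (c * (1 - 2 * (1 / 2 - w)))) / (2 * c) - exp (- (c * (1 - 2 * 0))) / (2 * c)"
  proof (rule differentiable_bound_general[where f = "\<lambda>v. \<Phi> (Complex (- t) (- v))" and f' = "\<lambda>v. - \<i> * ckern a (Complex (- t) (- v))" and \<phi>' = "\<lambda>v. exp (- (c * (1 - 2 * v)))"])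
    have d: "((\<lambda>v. \<Phi> (Complex (- t) (- v))) has_vector_derivative - \<i> * ckern a (Complex (- t) (- v))) (at v)" for v
    proof -
      have e: "Complex (- t) (- v) = of_real (- t) + - \<i> * of_real v" for v by (simp add: complex_eq_iff)
      have "((\<lambda>x. of_real (- t) + - \<i> * x) has_field_derivative - \<i>) (at (of_real v))" by (auto intro!: derivative_eq_intros)
      from DERIV_chain2[OF \<Phi> this]
      have "((\<lambda>x. \<Phi> (of_real (- t) + - \<i> * x)) has_field_derivative - \<i> * ckern a (of_real (- t) + - \<i> * of_real v)) (at (of_real v))"
        by (simp add: mult.commute)
      from has_vector_derivative_real_field[OF this] show ?thesis unfolding e .
    qed
    show "((\<lambda>v. \<Phi> (Complex (- t) (- v))) has_vector_derivative - \<i> * ckern a (Complex (- t) (- v))) (at v)" for v by (rule d)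
    show "continuous_on {0..1 / 2 - w} (\<lambda>v. \<Phi> (Complex (- t) (- v)))"
      by (intro continuous_at_imp_continuous_on ballI has_vector_derivative_continuous[OF d])
    have d2: "((\<lambda>v. exp (- (c * (1 - 2 * v))) / (2 * c)) has_real_derivative exp (- (c * (1 - 2 * v)))) (at v)" for v
      using c by (auto intro!: derivative_eq_intros)
    show "((\<lambda>v. exp (- (c * (1 - 2 * v))) / (2 * c)) has_vector_derivative exp (- (c * (1 - 2 * v)))) (at v)" for v
      using d2 by (simp add: has_real_derivative_iff_has_vector_derivative)
    show "continuous_on {0..1 / 2 - w} (\<lambda>v. exp (- (c * (1 - 2 * v))) / (2 * c))"
      using c by (intro continuous_intros) auto
    fix v :: real assume v: "0 < v" "v < 1 / 2 - w"
    have "norm (- \<i> * ckern a (Complex (- t) (- v))) = exp (- (c * cos (pi * v)))"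
      by (simp add: norm_mult norm_ckern c_def)
    also have "\<dots> \<le> exp (- (c * (1 - 2 * v)))" using cos_pi_ge_linear[of v] v w c by simp
    finally show "norm (- \<i> * ckern a (Complex (- t) (- v))) \<le> exp (- (c * (1 - 2 * v)))" .
  qed (use w in auto)
  also have "\<dots> \<le> 1 / (2 * c) - 0" using c w by (intro diff_mono divide_right_mono) auto
  finally have "norm (\<Phi> (Complex (- t) (w - 1 / 2)) - \<Phi> (of_real (- t))) \<le> 1 / (2 * c)"
    by (simp add: complex_of_real_def)
  moreover have "norm (\<Phi> (of_real u) - \<Phi> (Complex (- t) (w - 1 / 2))) \<le>
     norm (\<Phi> (of_real u) - \<Phi> (of_real (- t))) + norm (\<Phi> (Complex (- t) (w - 1 / 2)) - \<Phi> (of_real (- t)))"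
    using norm_triangle_ineq4[of "\<Phi> (of_real u) - \<Phi> (of_real (- t))" "\<Phi> (Complex (- t) (w - 1 / 2)) - \<Phi> (of_real (- t))"] by simp
  ultimately show ?thesis using 1 by (simp add: pole_err_def c_def)
qed

text \<open>21 = 13 + 8: two boundary logarithms of norm at most 3/2 + 5, and a difference quotient
  with denominator at least 1/4 over a window of length 2. The bound \<open>w \<le> 1 / 4\<close>
  provides this denominator.\<close>

lemma pole_terms_bound:
  assumes a: "a > 0" and \<Phi>: "\<And>z. (\<Phi> has_field_derivative ckern a z) (at z)" and t: "t \<ge> 1" and w: "0 < w" "w \<le> 1 / 4"
  shows "norm (pole_ends \<Phi> t (Complex (1 / 2 + w) t) - pole_rem a t (Complex (1 / 2 + w) t)) \<le> 21 * pole_err a t"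
proof -
  define z where "z = Complex (1 / 2 + w) t"
  define u0 where "u0 = Complex (- t) (w - 1 / 2)"
  have u0: "\<i> * (z - 1) = u0" by (simp add: z_def u0_def complex_eq_iff)
  note var = primitive_variation_near_pole[OF a \<Phi> t w, folded u0_def]
  have e0: "pole_err a t \<ge> 0" using a by (simp add: pole_err_def)
  have Lnb: "norm (Ln (z - 1 + \<i> * of_real x)) \<le> 13 / 2" if x: "x = - t + 1 \<or> x = - t - 1" for x
  proof -
    have "\<bar>Im (z - 1 + \<i> * of_real x)\<bar> = 1" "\<bar>Re (z - 1 + \<i> * of_real x)\<bar> \<le> 1 / 2"
      using x w by (auto simp: z_def)
    hence "norm (z - 1 + \<i> * of_real x) \<ge> 1 / 2" "norm (z - 1 + \<i> * of_real x) \<le> 3 / 2"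
      using abs_Im_le_cmod[of "z - 1 + \<i> * of_real x"] cmod_le[of "z - 1 + \<i> * of_real x"] by linarith+
    thus ?thesis using norm_Ln_linear[of "z - 1 + \<i> * of_real x"] by linarith
  qed
  have "norm (pole_ends \<Phi> t z) \<le> norm ((\<Phi> (of_real (- t + 1)) - \<Phi> u0) * Ln (z - 1 + \<i> * of_real (- t + 1))) + norm ((\<Phi> (of_real (- t - 1)) - \<Phi> u0) * Ln (z - 1 + \<i> * of_real (- t - 1)))"
    unfolding pole_ends_def u0 by (rule norm_triangle_ineq4)
  also have "\<dots> \<le> pole_err a t * (13 / 2) + pole_err a t * (13 / 2)"
    unfolding norm_mult using e0 by (intro add_mono mult_mono var Lnb) auto
  finally have 1: "norm (pole_ends \<Phi> t z) \<le> 13 * pole_err a t" by simp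
  have d: "norm (of_real u - u0) \<ge> 1 / 4" for u
    using abs_Im_le_cmod[of "of_real u - u0"] w by (simp add: u0_def)
  have c\<Phi>: "continuous_on A \<Phi>" for A
    using \<Phi> by (meson DERIV_isCont continuous_at_imp_continuous_on)
  have "norm (integral {- t - 1..- t + 1} (\<lambda>u. (\<Phi> (of_real u) - \<Phi> u0) / (of_real u - u0))) \<le> 4 * pole_err a t * (- t + 1 - (- t - 1))"
  proof (rule integral_bound)
    show "continuous_on {- t - 1..- t + 1} (\<lambda>u. (\<Phi> (of_real u) - \<Phi> u0) / (of_real u - u0))"
    proof (intro continuous_intros continuous_on_compose2[OF c\<Phi>[of UNIV]])
      show "\<forall>u\<in>{- t - 1..- t + 1}. of_real u - u0 \<noteq> 0"
      proof
        fix u :: real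
        show "of_real u - u0 \<noteq> 0" using d[of u] by auto
      qed
    qed auto
    fix u assume u: "u \<in> {- t - 1..- t + 1}"
    have "norm ((\<Phi> (of_real u) - \<Phi> u0) / (of_real u - u0)) \<le> pole_err a t / (1 / 4)"
      unfolding norm_divide using var[OF u] d[of u] e0 by (intro frac_le) auto
    thus "norm ((\<Phi> (of_real u) - \<Phi> u0) / (of_real u - u0)) \<le> 4 * pole_err a t" by simp
  qed simp
  moreover have "pole_rem a t z = integral {- t - 1..- t + 1} (\<lambda>u. (\<Phi> (of_real u) - \<Phi> u0) / (of_real u - u0))"
    using pole_rem_eq[OF \<Phi>, of z t] w by (simp add: u0 z_def[THEN arg_cong, of Re])
  ultimately have 2: "norm (pole_rem a t z) \<le> 8 * pole_err a t" by simp
  show ?thesis using 1 2 norm_triangle_ineq4[of "pole_ends \<Phi> t z" "pole_rem a t z"] by (simp add: z_def)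
qed

section \<open>Passage to the critical line\<close>

context zeta_log
begin

text \<open>Subtracting the convolution with the argument of \<open>s - 1\<close> cancels both ray
  integrals of \<open>kern_log_convolution\<close>. Left over are the pole terms, at most 21 times
  \<open>pole_err\<close>, and the argument on the window, at most 4 in absolute value over length
  2; hence 29.\<close>

lemma arg_line_convolution:
  assumes a: "a > 0" and sm: "summable (\<lambda>n. \<bar>hcoef a (Suc n)\<bar> * real (Suc n) powr (- (1 / 2)))"
    and t: "t \<ge> 1" and w: "0 < w" "w \<le> 1 / 4"
  shows "integrable lborel (\<lambda>u. kern a u * arg_line (1 / 2 + w) (t + u))"
    and "\<bar>(LINT u|lborel. kern a u * arg_line (1 / 2 + w) (t + u)) - Im (dser (hcoef a) (Complex (1 / 2 + w) t))\<bar> \<le> 29 * pole_err a t"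
proof -
  obtain \<Phi> where \<Phi>: "\<And>z. (\<Phi> has_field_derivative ckern a z) (at z)"
    using holomorphic_convex_primitive'[OF convex_UNIV open_UNIV ckern_holomorphic] by (metis UNIV_I)
  define z where "z = Complex (1 / 2 + w) t"
  have z1: "z + \<i> * of_real u = Complex (1 / 2 + w) (t + u)" for u by (simp add: z_def complex_eq_iff)
  have z2: "z - 1 + \<i> * of_real u = Complex (1 / 2 + w - 1) (t + u)" for u by (simp add: z_def complex_eq_iff)
  have zc: "1 / 2 < Re z" "Re z < 2" "\<bar>Im z - t\<bar> < 1 / 2" using w by (auto simp: z_def)
  note conv = kern_log_convolution[OF a sm \<Phi> zc]
  define gl where "gl = (\<lambda>u. kern a u * Im (l (z + \<i> * of_real u)))"
  define gL where "gL = (\<lambda>u. kern a u * Im (Ln (z - 1 + \<i> * of_real u)))"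
  have il: "integrable lborel gl"
  proof -
    have "integrable lborel (\<lambda>u. Im (of_real (kern a u) * l (z + \<i> * of_real u)))"
      using conv(1) by (rule integrable_Im)
    thus ?thesis by (simp add: gl_def)
  qed
  have Im4: "\<bar>Im (Ln (z - 1 + \<i> * of_real u))\<bar> \<le> 4" for u
  proof -
    have "z - 1 + \<i> * of_real u \<noteq> 0" using w by (simp add: z2 complex_eq_iff)
    from abs_Im_Ln_le_pi[OF this] show ?thesis using pi_less_4 by linarith
  qed
  have iL: "integrable lborel gL"
  proof -
    have [measurable]: "(\<lambda>u. z - 1 + \<i> * of_real u) \<in> borel_measurable borel"
      by (intro borel_measurable_continuous_onI continuous_intros)
    have "integrable lborel (\<lambda>u. of_real (kern a u) * Im (Ln (z - 1 + \<i> * of_real u)))"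
      by (rule integrable_kern_bounded[OF a, of _ 4 0]) (use Im4 in \<open>auto intro!: measurable_compose[OF _ Ln_measurable]\<close>)
    thus ?thesis by (simp add: gL_def)
  qed
  have eq: "kern a u * arg_line (1 / 2 + w) (t + u) = gl u - gL u" for u
    by (simp add: arg_line_def gl_def gL_def z1 z2 right_diff_distrib)
  show "integrable lborel (\<lambda>u. kern a u * arg_line (1 / 2 + w) (t + u))"
    unfolding eq by (rule Bochner_Integration.integrable_diff[OF il iL])
  have Il: "(LINT u|lborel. gl u) = Im (LINT u|lborel. of_real (kern a u) * l (z + \<i> * of_real u))"
    using integral_Im[OF conv(1)] by (simp add: gl_def)
  have Iset: "(LINT u:X|lborel. gL u) = Im (LINT u:X|lborel. of_real (kern a u) * Ln (z - 1 + \<i> * of_real u))"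
    if "set_integrable lborel X (\<lambda>u. of_real (kern a u) * Ln (z - 1 + \<i> * of_real u))" for X
    using integral_Im[OF that[unfolded set_integrable_def]]
    by (simp add: gL_def set_lebesgue_integral_def)
  have b12: "- t - 1 < - t + 1" by simp
  have "(LINT u|lborel. kern a u * arg_line (1 / 2 + w) (t + u)) = (LINT u|lborel. gl u) - (LINT u|lborel. gL u)"
    unfolding eq by (rule Bochner_Integration.integral_diff[OF il iL])
  also have "(LINT u|lborel. gL u) = (LINT u:{..- t - 1}|lborel. gL u) + integral {- t - 1..- t + 1} gL + (LINT u:{- t + 1..}|lborel. gL u)"
    by (rule lborel_integral_split3[OF iL b12])
  finally have main: "(LINT u|lborel. kern a u * arg_line (1 / 2 + w) (t + u)) =
      Im (dser (hcoef a) z) + Im (pole_ends \<Phi> t z - pole_rem a t z) - integral {- t - 1..- t + 1} gL"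
    unfolding Il conv(4) Iset[OF conv(2)] Iset[OF conv(3)] by simp
  have "\<bar>Im (pole_ends \<Phi> t z - pole_rem a t z)\<bar> \<le> 21 * pole_err a t"
    using pole_terms_bound[OF a \<Phi> t w] abs_Im_le_cmod[of "pole_ends \<Phi> t z - pole_rem a t z"] by (simp only: z_def)
  moreover have "\<bar>integral {- t - 1..- t + 1} gL\<bar> \<le> 8 * pole_err a t"
  proof -
    define E where "E = exp (- (a * cosh (pi * (t - 1))))"
    have "set_integrable lborel {- t - 1..- t + 1} gL"
      unfolding set_integrable_def using iL by (intro integrable_mult_indicator) auto
    hence hk: "(gL has_integral integral {- t - 1..- t + 1} gL) (cbox (- t - 1) (- t + 1))"
      using set_borel_integral_eq_integral(1) by (simp add: has_integral_integral)
    have "norm (gL u) \<le> 4 * E" if "u \<in> cbox (- t - 1) (- t + 1)" for u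
    proof -
      have "kern a u \<le> E" unfolding E_def using that t by (intro kern_le_outside a) auto
      hence "kern a u * \<bar>Im (Ln (z - 1 + \<i> * of_real u))\<bar> \<le> E * 4" using Im4[of u] by (intro mult_mono) (auto simp: E_def)
      thus ?thesis by (simp add: gL_def abs_mult)
    qed
    hence "norm (integral {- t - 1..- t + 1} gL) \<le> 4 * E * measure lborel (cbox (- t - 1) (- t + 1))"
      by (intro has_integral_bound[OF _ hk]) (auto simp: E_def)
    moreover have "E \<le> pole_err a t" using a by (simp add: E_def pole_err_def)
    ultimately show ?thesis by simp
  qed
  ultimately show "\<bar>(LINT u|lborel. kern a u * arg_line (1 / 2 + w) (t + u)) - Im (dser (hcoef a) (Complex (1 / 2 + w) t))\<bar> \<le> 29 * pole_err a t"
    unfolding main z_def[symmetric] by linarith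
qed

text \<open>The countable exceptional set is cut out so that measurability follows from a pointwise limit.\<close>

definition S_reg :: "real \<Rightarrow> real" where
  "S_reg \<tau> = (if \<tau> \<in> insert 0 zeta_ordinates then 0 else S_zeta \<tau>)"

text \<open>The 4 keeps the distance \<open>1 / real (n + 4)\<close> to the critical line within the
  bound 1/4 of \<open>arg_line_convolution\<close>.\<close>

definition arg_reg :: "nat \<Rightarrow> real \<Rightarrow> real" where
  "arg_reg n \<tau> = (if \<tau> \<in> insert 0 zeta_ordinates then 0 else arg_line (1 / 2 + 1 / real (n + 4)) \<tau>)"

lemma arg_reg_tendsto: "(\<lambda>n. arg_reg n \<tau>) \<longlonglongrightarrow> pi * S_reg \<tau>"
proof (cases "\<tau> \<in> insert 0 zeta_ordinates")
  case False
  have "filterlim (\<lambda>n. 1 / 2 + 1 / real (n + 4)) (at_right (1 / 2)) sequentially"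
    unfolding filterlim_at by (intro conjI always_eventually allI) (auto, real_asymp)
  hence "(\<lambda>n. arg_line (1 / 2 + 1 / real (n + 4)) \<tau>) \<longlonglongrightarrow> pi * S_zeta \<tau>"
    using False by (intro filterlim_compose[OF arg_line_tendsto_S]) auto
  thus ?thesis using False by (simp add: arg_reg_def S_reg_def)
qed (simp add: arg_reg_def S_reg_def)

lemma exceptional_set_borel: "insert 0 zeta_ordinates \<in> sets borel"
  by (rule sets.countable) (auto simp: countable_zeta_ordinates)

lemma arg_line_measurable: assumes "\<sigma> > 1 / 2" "\<sigma> \<noteq> 1" shows "arg_line \<sigma> \<in> borel_measurable borel"
proof -
  have e: "Complex x \<tau> = of_real x + \<i> * of_real \<tau>" for x \<tau> by (simp add: complex_eq_iff)
  have 1: "(\<lambda>\<tau>. l (Complex \<sigma> \<tau>)) \<in> borel_measurable borel"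
    by (rule borel_measurable_continuous_onI, rule continuous_on_compose2[OF continuous_on_l])
       (use assms in \<open>auto simp: e intro!: continuous_intros\<close>)
  have 2: "(\<lambda>\<tau>. Ln (Complex (\<sigma> - 1) \<tau>)) \<in> borel_measurable borel"
    by (rule measurable_compose[OF _ Ln_measurable], rule borel_measurable_continuous_onI) (auto simp: e intro!: continuous_intros)
  show ?thesis unfolding arg_line_def [abs_def] using 1 2 by measurable
qed

lemma arg_reg_measurable: "arg_reg n \<in> borel_measurable borel"
proof -
  have "1 / real (n + 4) < 1 / 2" by (simp add: field_simps)
  hence "1 / 2 + 1 / real (n + 4) \<noteq> 1" by linarith
  hence "arg_line (1 / 2 + 1 / real (n + 4)) \<in> borel_measurable borel" by (intro arg_line_measurable) simp_all
  thus ?thesis unfolding arg_reg_def [abs_def] using exceptional_set_borel by (intro measurable_If_set) auto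
qed

lemma S_reg_measurable: "(\<lambda>\<tau>. pi * S_reg \<tau>) \<in> borel_measurable borel"
  by (rule borel_measurable_LIMSEQ_real[OF arg_reg_tendsto arg_reg_measurable])

lemma arg_reg_growth:
  "\<exists>C>0. (\<forall>n \<tau>. \<bar>arg_reg n \<tau>\<bar> \<le> C * ln (\<bar>\<tau>\<bar> + 2)) \<and> (\<forall>\<tau>. \<bar>pi * S_reg \<tau>\<bar> \<le> C * ln (\<bar>\<tau>\<bar> + 2))"
proof -
  obtain C where C: "C > 0" "\<And>\<sigma> \<tau>. 1 / 2 < \<sigma> \<Longrightarrow> \<sigma> \<le> 2 \<Longrightarrow> \<bar>Im (l (Complex \<sigma> \<tau>))\<bar> \<le> C * ln (\<bar>\<tau>\<bar> + 2)"
    using Im_l_growth by blast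
  have ln2: "ln 2 \<le> ln (\<bar>\<tau>\<bar> + 2)" for \<tau> :: real by (intro ln_mono) auto
  have main: "\<bar>arg_reg n \<tau>\<bar> \<le> (C + 4 / ln 2) * ln (\<bar>\<tau>\<bar> + 2)" for n \<tau>
  proof (cases "\<tau> \<in> insert 0 zeta_ordinates")
    case True
    have "0 \<le> (C + 4 / ln 2) * ln (\<bar>\<tau>\<bar> + 2)" using C by (intro mult_nonneg_nonneg) auto
    thus ?thesis using True by (simp add: arg_reg_def)
  next
    case False
    define \<sigma> where "\<sigma> = 1 / 2 + 1 / real (n + 4)"
    have s: "1 / 2 < \<sigma>" "\<sigma> \<le> 2" by (auto simp: \<sigma>_def field_simps)
    have "Complex (\<sigma> - 1) \<tau> \<noteq> 0" using False by (auto simp: complex_eq_iff)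
    moreover have "arg_reg n \<tau> = Im (l (Complex \<sigma> \<tau>)) - Im (Ln (Complex (\<sigma> - 1) \<tau>))"
      using False by (simp add: arg_reg_def arg_line_def \<sigma>_def)
    ultimately have "\<bar>arg_reg n \<tau>\<bar> \<le> C * ln (\<bar>\<tau>\<bar> + 2) + 4"
      using abs_Im_Ln_le_pi[of "Complex (\<sigma> - 1) \<tau>"] C(2)[OF s, of \<tau>] pi_less_4 by linarith
    also have "4 \<le> 4 / ln 2 * ln (\<bar>\<tau>\<bar> + 2)" using ln2[of \<tau>] by (simp add: field_simps)
    finally show ?thesis by (simp add: distrib_right)
  qed
  have "\<bar>pi * S_reg \<tau>\<bar> \<le> (C + 4 / ln 2) * ln (\<bar>\<tau>\<bar> + 2)" for \<tau>
    by (rule tendsto_upperbound[OF tendsto_rabs[OF arg_reg_tendsto]]) (use main in \<open>auto intro!: always_eventually\<close>)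
  moreover have "C + 4 / ln 2 > 0" using C(1) by (intro add_pos_pos divide_pos_pos) auto
  ultimately show ?thesis using main by blast
qed

text \<open>Dominated convergence as the line approaches \<open>Re s = 1 / 2\<close>, with a
  majorant from the logarithmic growth of the argument; the Dirichlet series converges along by
  continuity up to the boundary.\<close>

lemma S_reg_convolution:
  assumes a: "a > 0" and sm: "summable (\<lambda>n. \<bar>hcoef a (Suc n)\<bar> * real (Suc n) powr (- (1 / 2)))" and t: "t \<ge> 1"
  shows "integrable lborel (\<lambda>u. kern a u * (pi * S_reg (t + u)))"
    and "\<bar>(LINT u|lborel. kern a u * (pi * S_reg (t + u))) - Im (dser (hcoef a) (Complex (1 / 2) t))\<bar> \<le> 29 * pole_err a t"
proof -
  obtain C where C: "C > 0" "\<And>n \<tau>. \<bar>arg_reg n \<tau>\<bar> \<le> C * ln (\<bar>\<tau>\<bar> + 2)" using arg_reg_growth by blast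
  define W where "W = (\<lambda>u. kern a u * (C * ln (\<bar>t\<bar> + 2) + C * \<bar>u\<bar>))"
  have iW: "integrable lborel W" unfolding W_def by (rule integrable_kern_linear[OF a])
  have m1: "(\<lambda>u. kern a u * (pi * S_reg (t + u))) \<in> borel_measurable lborel"
    using measurable_compose[OF _ S_reg_measurable, of "\<lambda>u. t + u" borel] by measurable
  have m2: "(\<lambda>u. kern a u * arg_reg n (t + u)) \<in> borel_measurable lborel" for n
    using measurable_compose[OF _ arg_reg_measurable, of "\<lambda>u. t + u" borel] by measurable
  have lim: "AE u in lborel. (\<lambda>n. kern a u * arg_reg n (t + u)) \<longlonglongrightarrow> kern a u * (pi * S_reg (t + u))"
    by (intro AE_I2 tendsto_intros arg_reg_tendsto)
  have bd: "AE u in lborel. norm (kern a u * arg_reg n (t + u)) \<le> W u" for n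
  proof (rule AE_I2)
    fix u
    have "\<bar>arg_reg n (t + u)\<bar> \<le> C * (ln (\<bar>t\<bar> + 2) + \<bar>u\<bar>)"
      using C(1) ln_shift_le[of t u] by (intro order_trans[OF C(2)] mult_left_mono) auto
    thus "norm (kern a u * arg_reg n (t + u)) \<le> W u"
      by (simp add: W_def abs_mult mult_left_mono distrib_left[symmetric])
  qed
  show "integrable lborel (\<lambda>u. kern a u * (pi * S_reg (t + u)))"
    by (rule integrable_dominated_convergence[OF m1 m2 iW lim bd])
  have L1: "(\<lambda>n. LINT u|lborel. kern a u * arg_reg n (t + u)) \<longlonglongrightarrow> (LINT u|lborel. kern a u * (pi * S_reg (t + u)))"
    by (rule integral_dominated_convergence[OF m1 m2 iW lim bd])
  have eqn: "(LINT u|lborel. kern a u * arg_reg n (t + u)) = (LINT u|lborel. kern a u * arg_line (1 / 2 + 1 / real (n + 4)) (t + u))" for n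
  \<comment> \<open>The two integrands differ on a countable set only.\<close>
  proof (rule integral_discrete_difference[of "(\<lambda>x. x - t) ` insert 0 zeta_ordinates"])
    show "countable ((\<lambda>x. x - t) ` insert 0 zeta_ordinates)" using countable_zeta_ordinates by simp
    fix u :: real assume "u \<notin> (\<lambda>x. x - t) ` insert 0 zeta_ordinates"
    hence "t + u \<notin> insert 0 zeta_ordinates" by (metis add_diff_cancel_left' imageI)
    thus "kern a u * arg_reg n (t + u) = kern a u * arg_line (1 / 2 + 1 / real (n + 4)) (t + u)" by (simp add: arg_reg_def)
  qed auto
  have L2: "(\<lambda>n. Im (dser (hcoef a) (Complex (1 / 2 + 1 / real (n + 4)) t))) \<longlonglongrightarrow> Im (dser (hcoef a) (Complex (1 / 2) t))"
  proof -
    have "(\<lambda>n. 1 / 2 + 1 / real (n + 4)) \<longlonglongrightarrow> 1 / 2" by real_asymp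
    hence "(\<lambda>n. Complex (1 / 2 + 1 / real (n + 4)) t) \<longlonglongrightarrow> Complex (1 / 2) t" by (intro tendsto_intros)
    thus ?thesis by (intro tendsto_Im continuous_on_tendsto_compose[OF dser_half_plane(2)[OF sm]]) auto
  qed
  have est: "\<bar>(LINT u|lborel. kern a u * arg_reg n (t + u)) - Im (dser (hcoef a) (Complex (1 / 2 + 1 / real (n + 4)) t))\<bar> \<le> 29 * pole_err a t" for n
    unfolding eqn by (rule arg_line_convolution(2)[OF a sm t]) (auto simp: field_simps)
  show "\<bar>(LINT u|lborel. kern a u * (pi * S_reg (t + u))) - Im (dser (hcoef a) (Complex (1 / 2) t))\<bar> \<le> 29 * pole_err a t"
    by (rule tendsto_upperbound[OF tendsto_rabs[OF tendsto_diff[OF L1 L2]]]) (use est in \<open>auto intro!: always_eventually\<close>)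
qed

end

section \<open>Large values\<close>

definition wt :: "real \<Rightarrow> nat \<Rightarrow> real" where
  "wt a n = Lambda1 n / sqrt (real n) * Re (K_hat a (ln (real n) / pi))"

lemma hcoef_eq_wt: "hcoef a n * real n powr (- (1 / 2)) = wt a n / pi"
proof -
  have "real n powr (- (1 / 2)) = 1 / sqrt (real n)"
    by (simp only: powr_minus_divide powr_half_sqrt of_nat_0_le_iff)
  thus ?thesis by (simp only: hcoef_def wt_def) simp
qed

lemma wt_eq_0: "\<not> primepow n \<Longrightarrow> wt a n = 0"
  by (simp add: wt_def Lambda1_def mangoldt_def)

lemma Omega_prime_power: "prime p \<Longrightarrow> Omega (p ^ j) = j"
  by (simp add: Omega_def prime_factorization_prime_power)

definition odd_primepows :: "nat set" where
  "odd_primepows = (\<lambda>(p, k). p ^ (2 * k + 1)) ` ({p. prime p} \<times> UNIV)"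

lemma inj_odd_primepows: "inj_on (\<lambda>(p, k). p ^ (2 * k + 1)) ({p::nat. prime p} \<times> UNIV)"
proof (rule inj_onI, clarify)
  fix p q k m :: nat assume "prime p" "prime q" and eq: "p ^ (2 * k + 1) = q ^ (2 * m + 1)"
  hence "aprimedivisor (p ^ (2 * k + 1)) = p" "aprimedivisor (q ^ (2 * m + 1)) = q"
    by (intro aprimedivisor_prime_power; simp)+
  hence "p = q" using eq by simp
  moreover have "2 * k + 1 = 2 * m + 1"
    using \<open>prime p\<close> \<open>prime q\<close> arg_cong[OF eq, of Omega] by (simp only: Omega_prime_power)
  ultimately show "p = q \<and> k = m" by simp
qed

lemma S0_eq: "S0 a = 1 / pi * (\<Sum>\<^sub>\<infinity>(p, k)\<in>{p. prime p} \<times> UNIV. (-1) ^ k * wt a (p ^ (2 * k + 1)))"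
  by (simp add: S0_def wt_def Let_def mult.assoc)

text \<open>
  For odd prime powers, convergence is already contained in \<open>S0 a > 0\<close>: the infinite sum of a family
  that is not summable is \<open>0\<close>.
\<close>

lemma summable_wt:
  assumes a: "a > 0" and S0: "S0 a > 0"
  shows "(\<lambda>n. \<bar>wt a n\<bar>) summable_on UNIV"
proof -
  have "(\<lambda>(p, k). (-1) ^ k * wt a (p ^ (2 * k + 1))) summable_on {p. prime p} \<times> UNIV"
  proof (rule ccontr)
    assume "\<not> ?thesis"
    hence "S0 a = 0" unfolding S0_eq by (simp add: infsum_not_exists)
    thus False using S0 by simp
  qed
  hence "(\<lambda>x. norm ((\<lambda>(p, k). (-1) ^ k * wt a (p ^ (2 * k + 1))) x)) summable_on {p. prime p} \<times> UNIV"
    by (subst (asm) summable_on_iff_abs_summable_on_real)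
  moreover have "(\<lambda>x. norm ((\<lambda>(p, k). (-1) ^ k * wt a (p ^ (2 * k + 1))) x)) = (\<lambda>n. \<bar>wt a n\<bar>) \<circ> (\<lambda>(p, k). p ^ (2 * k + 1))"
    by (auto simp: fun_eq_iff abs_mult power_abs)
  ultimately have "((\<lambda>n. \<bar>wt a n\<bar>) \<circ> (\<lambda>(p, k). p ^ (2 * k + 1))) summable_on {p. prime p} \<times> UNIV" by metis
  hence odd: "(\<lambda>n. \<bar>wt a n\<bar>) summable_on odd_primepows"
    unfolding odd_primepows_def by (subst summable_on_reindex[OF inj_odd_primepows])
  \<comment> \<open>Even prime powers are squares. \<open>K_hat_decay\<close> bounds the weight at n
    by a multiple of n^(- 1/2 - 1/pi), which is summable over squares but not over primes; hence the
    separate treatment of the odd powers above.\<close>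
  obtain C where C: "C > 0" "\<And>v. norm (K_hat a v) \<le> C * exp (- v)" using K_hat_decay[OF a] by blast
  have "summable (\<lambda>m. norm \<bar>wt a (m\<^sup>2)\<bar>)"
  proof (rule summable_comparison_test')
    show "summable (\<lambda>m. C * real m powr (- 1 - 2 / pi))"
      using pi_gt_zero by (intro summable_mult) (simp add: summable_real_powr_iff)
    fix m :: nat assume m: "m \<ge> 1"
    have e: "exp (- (ln (real (m\<^sup>2)) / pi)) = real m powr (- (2 / pi))"
      using m by (simp add: powr_def ln_realpow)
    have "\<bar>wt a (m\<^sup>2)\<bar> = Lambda1 (m\<^sup>2) * \<bar>Re (K_hat a (ln (real (m\<^sup>2)) / pi))\<bar> / real m"
      using Lambda1_nonneg[of "m\<^sup>2"] by (simp add: wt_def abs_mult real_sqrt_abs)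
    also have "\<dots> \<le> 1 * (C * real m powr (- (2 / pi))) / real m"
      using C(2)[of "ln (real (m\<^sup>2)) / pi"] abs_Re_le_cmod[of "K_hat a (ln (real (m\<^sup>2)) / pi)"] Lambda1_nonneg[of "m\<^sup>2"] Lambda1_le_1[of "m\<^sup>2"]
      unfolding e by (intro divide_right_mono mult_mono) auto
    also have "\<dots> = C * real m powr (- 1 - 2 / pi)"
      using m by (simp add: powr_diff powr_minus divide_inverse)
    finally show "norm (norm \<bar>wt a (m\<^sup>2)\<bar>) \<le> C * real m powr (- 1 - 2 / pi)" by simp
  qed
  hence "((\<lambda>n. \<bar>wt a n\<bar>) \<circ> (\<lambda>m. m\<^sup>2)) summable_on UNIV"
    unfolding o_def by (rule norm_summable_imp_summable_on)
  moreover have "inj (\<lambda>m::nat. m\<^sup>2)" by (rule injI) simp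
  ultimately have sq: "(\<lambda>n. \<bar>wt a n\<bar>) summable_on range (\<lambda>m. m\<^sup>2)"
    by (subst summable_on_reindex)
  have "(\<lambda>n. \<bar>wt a n\<bar>) summable_on odd_primepows \<union> (range (\<lambda>m. m\<^sup>2) - odd_primepows)"
    by (rule summable_on_Un_disjoint[OF odd summable_on_subset_banach[OF sq]]) auto
  thus ?thesis
  proof (rule summable_on_cong_neutral[THEN iffD1, rotated -1])
    fix n assume n: "n \<in> UNIV - (odd_primepows \<union> (range (\<lambda>m. m\<^sup>2) - odd_primepows))"
    have "\<not> primepow n"
    proof
      assume "primepow n"
      then obtain p k where pk: "prime p" "k > 0" "n = p ^ k" by (auto simp: primepow_def)
      show False
      proof (cases "even k")
        case True
        then obtain j where "k = j * 2" by (auto elim: evenE)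
        hence "n = (p ^ j)\<^sup>2" using pk by (simp add: power_mult)
        thus False using n by blast
      next
        case False
        then obtain j where "k = 2 * j + 1" by (auto elim: oddE)
        hence "n \<in> odd_primepows" using pk by (auto simp: odd_primepows_def intro!: image_eqI[of _ _ "(p, j)"])
        thus False using n by blast
      qed
    qed
    thus "\<bar>wt a n\<bar> = 0" by (simp add: wt_eq_0)
  qed auto
qed

lemma summable_on_wt_imp_summable:
  assumes "(\<lambda>n. \<bar>wt a n\<bar>) summable_on UNIV"
  shows "summable (\<lambda>n. \<bar>wt a n\<bar>)"
    and "summable (\<lambda>n. \<bar>hcoef a (Suc n)\<bar> * real (Suc n) powr (- (1 / 2)))"
proof -
  show 1: "summable (\<lambda>n. \<bar>wt a n\<bar>)" using assms by (rule summable_on_imp_summable)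
  have "\<bar>hcoef a (Suc n)\<bar> * real (Suc n) powr (- (1 / 2)) = \<bar>wt a (Suc n)\<bar> / pi" for n
  proof -
    have "\<bar>hcoef a (Suc n)\<bar> * real (Suc n) powr (- (1 / 2)) = \<bar>hcoef a (Suc n) * real (Suc n) powr (- (1 / 2))\<bar>"
      by (simp add: abs_mult)
    thus ?thesis unfolding hcoef_eq_wt by simp
  qed
  thus "summable (\<lambda>n. \<bar>hcoef a (Suc n)\<bar> * real (Suc n) powr (- (1 / 2)))"
    using 1 by (simp add: summable_divide summable_Suc_iff[of "\<lambda>n. \<bar>wt a n\<bar>"] del: of_nat_Suc)
qed

lemma Im_i_power_odd: "Im (\<i> ^ (2 * k + 1)) = (-1) ^ k"
  by (simp add: power_mult)

lemma Im_i_power_even: "even j \<Longrightarrow> Im (\<i> ^ j) = 0"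
  by (auto elim!: evenE simp: power_mult)

text \<open>Even powers of \<i> are real, so only odd prime powers survive, with the sign
  \<open>(-1) ^ k\<close>; absolute convergence makes the order of summation immaterial.\<close>

lemma sums_S0:
  assumes sm: "(\<lambda>n. \<bar>wt a n\<bar>) summable_on UNIV"
  shows "(\<lambda>n. Im (\<i> ^ Omega n) * wt a n) sums (pi * S0 a)"
proof -
  have Im1: "\<bar>Im (\<i> ^ j)\<bar> \<le> 1" for j using abs_Im_le_cmod[of "\<i> ^ j"] by (simp add: norm_power)
  define e where "e = (\<lambda>n. Im (\<i> ^ Omega n) * wt a n)"
  have "e summable_on UNIV"
  proof (rule abs_summable_summable, rule summable_on_comparison_test[OF sm])
    show "norm (e n) \<le> \<bar>wt a n\<bar>" for n
      using mult_right_mono[OF Im1[of "Omega n"], of "\<bar>wt a n\<bar>"] by (simp add: e_def abs_mult)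
  qed auto
  hence "(e has_sum infsum e UNIV) UNIV" by (rule has_sum_infsum)
  hence "e sums infsum e UNIV" by (rule has_sum_imp_sums)
  also have "infsum e UNIV = infsum e odd_primepows"
  proof (rule infsum_cong_neutral)
    fix n assume n: "n \<in> UNIV - odd_primepows"
    show "e n = 0"
    proof (cases "primepow n")
      case True
      then obtain p k where pk: "prime p" "k > 0" "n = p ^ k" by (auto simp: primepow_def)
      have "even k"
      proof (rule ccontr)
        assume "odd k"
        then obtain j where "k = 2 * j + 1" by (auto elim: oddE)
        hence "n \<in> odd_primepows" using pk by (auto simp: odd_primepows_def intro!: image_eqI[of _ _ "(p, j)"])
        thus False using n by blast
      qed
      thus ?thesis using pk by (simp add: e_def Omega_prime_power Im_i_power_even)
    qed (simp add: e_def wt_eq_0)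
  qed auto
  also have "\<dots> = (\<Sum>\<^sub>\<infinity>x\<in>{p. prime p} \<times> UNIV. e ((\<lambda>(p, k). p ^ (2 * k + 1)) x))"
    unfolding odd_primepows_def by (subst infsum_reindex[OF inj_odd_primepows]) (simp add: o_def)
  also have "\<dots> = (\<Sum>\<^sub>\<infinity>(p, k)\<in>{p. prime p} \<times> UNIV. (-1) ^ k * wt a (p ^ (2 * k + 1)))"
  proof (rule infsum_cong)
    fix x :: "nat \<times> nat" assume "x \<in> {p. prime p} \<times> UNIV"
    then obtain p k where x: "x = (p, k)" "prime p" by auto
    have "Omega (p ^ (2 * k + 1)) = 2 * k + 1" using x by (intro Omega_prime_power)
    thus "e ((\<lambda>(p, k). p ^ (2 * k + 1)) x) = (\<lambda>(p, k). (-1) ^ k * wt a (p ^ (2 * k + 1))) x"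
      by (simp only: x prod.case e_def Im_i_power_odd)
  qed
  also have "\<dots> = pi * S0 a" by (simp add: S0_eq)
  finally show ?thesis by (simp add: e_def)
qed

lemma S0_eq_Im_series:
  assumes sm: "(\<lambda>n. \<bar>wt a n\<bar>) summable_on UNIV"
  shows "S0 a = 1 / pi * Im (\<Sum>n. let m = n + 2 in
           \<i> ^ Omega m * of_real (Lambda1 m / sqrt (real m)) * K_hat a (ln (real m) / pi))"
proof -
  define f where "f = (\<lambda>m. \<i> ^ Omega m * of_real (Lambda1 m / sqrt (real m)) * K_hat a (ln (real m) / pi))"
  have f: "f m = \<i> ^ Omega m * of_real (wt a m)" for m
    by (simp add: f_def wt_def K_hat_real mult.assoc)
  have "summable (\<lambda>m. norm (f m))"
    using summable_on_wt_imp_summable(1)[OF sm] by (simp add: f norm_mult norm_power)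
  hence sf: "summable f" by (rule summable_norm_cancel)
  have "f 0 = 0" "f 1 = 0" by (simp_all add: f_def Lambda1_def)
  hence "(\<Sum>n. f (n + 2)) = suminf f"
    using suminf_split_initial_segment[OF sf, of 2] by (simp add: numeral_2_eq_2)
  moreover have "Im (suminf f) = pi * S0 a"
    using sums_S0[OF sm] sums_Im[OF summable_sums[OF sf]] by (simp add: f sums_iff)
  ultimately show ?thesis by (simp add: f_def Let_def)
qed

lemma Im_dser_half:
  assumes sm: "(\<lambda>n. \<bar>wt a n\<bar>) summable_on UNIV"
  shows "(\<lambda>n. wt a n * Im (cis (- (t * ln (real n))))) sums (pi * Im (dser (hcoef a) (Complex (1 / 2) t)))"
proof -
  define f where "f = (\<lambda>n. of_real (hcoef a n) * of_nat n powr (- Complex (1 / 2) t) :: complex)"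
  have "summable (\<lambda>n. norm (f (Suc n)))"
    unfolding f_def by (rule dser_half_plane(3)[OF summable_on_wt_imp_summable(2)[OF sm]]) simp
  hence "(\<lambda>n. f (Suc n)) sums dser (hcoef a) (Complex (1 / 2) t)"
    unfolding dser_def f_def by (intro summable_sums) (rule summable_norm_cancel)
  moreover have "f 0 = 0" by (simp add: f_def)
  ultimately have "f sums dser (hcoef a) (Complex (1 / 2) t)" by (simp add: sums_Suc_iff)
  hence "(\<lambda>n. pi * Im (f n)) sums (pi * Im (dser (hcoef a) (Complex (1 / 2) t)))"
    by (intro sums_mult sums_Im)
  moreover have "pi * Im (f n) = wt a n * Im (cis (- (t * ln (real n))))" for n
  proof (cases "n = 0")
    case True thus ?thesis by (simp add: f_def wt_def)
  next
    case False
    have "Im (of_nat n powr (- Complex (1 / 2) t) :: complex) = real n powr (- (1 / 2)) * sin (- (t * ln (real n)))"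
      using False by (simp add: powr_def Im_exp mult.commute)
    hence "pi * Im (f n) = pi * (hcoef a n * real n powr (- (1 / 2))) * sin (- (t * ln (real n)))" by (simp add: f_def)
    thus ?thesis unfolding hcoef_eq_wt by simp
  qed
  ultimately show ?thesis by simp
qed

text \<open>If \<open>p powr (- \<i> * t)\<close> is close to \<open>s * \<i>\<close> for the small
  primes, its j-th power is close to \<open>(s * \<i>) ^ j\<close>, and
  \<open>s * Im ((s * \<i>) ^ j) = Im (\<i> ^ j)\<close> for both signs since even powers are real.
  So \<open>s\<close> times the series nearly reproduces \<open>S0 a\<close>.\<close>

lemma Im_dser_large:
  assumes sm: "(\<lambda>n. \<bar>wt a n\<bar>) summable_on UNIV" and S0: "S0 a > 0" and s: "s = 1 \<or> s = -1"
  obtains A \<epsilon> where "finite A" "\<And>p. p \<in> A \<Longrightarrow> prime (p::nat)" "\<epsilon> > 0"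
    "\<And>t. (\<forall>p\<in>A. norm (cis (t * ln (real p)) - cis (- (s * pi / 2))) < \<epsilon>) \<Longrightarrow>
       s * Im (dser (hcoef a) (Complex (1 / 2) t)) \<ge> 3 / 4 * S0 a"
proof -
  define W where "W = (\<Sum>n. \<bar>wt a n\<bar>)"
  have sw: "summable (\<lambda>n. \<bar>wt a n\<bar>)" by (rule summable_on_wt_imp_summable(1)[OF sm])
  have W0: "W \<ge> 0" unfolding W_def by (rule suminf_nonneg[OF sw]) simp
  obtain N where N: "\<And>n. n \<ge> N \<Longrightarrow> norm (\<Sum>i. \<bar>wt a (i + n)\<bar>) < S0 a / 8"
    using suminf_exist_split[OF _ sw, of "S0 a / 8"] S0 by auto
  have tail: "(\<Sum>i. \<bar>wt a (i + N)\<bar>) < S0 a / 8" using N[of N] by simp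
  \<comment> \<open>A prime power below \<open>N\<close> has exponent at most \<open>N\<close>, so
    the head of the series errs by at most \<open>N * \<epsilon> * W \<le> S0 a / 8\<close>; the
    added ones keep the denominator positive.\<close>
  define \<epsilon> where "\<epsilon> = S0 a / (8 * (real N + 1) * (W + 1))"
  have \<epsilon>: "\<epsilon> > 0" unfolding \<epsilon>_def using S0 W0 by (intro divide_pos_pos mult_pos_pos) auto
  define A where "A = {p. prime p \<and> p \<le> N}"
  show ?thesis
  proof (rule that[OF _ _ \<epsilon>, of A])
    show "finite A" unfolding A_def by simp
    show "prime p" if "p \<in> A" for p using that by (simp add: A_def)
    fix t assume t: "\<forall>p\<in>A. norm (cis (t * ln (real p)) - cis (- (s * pi / 2))) < \<epsilon>"
    define d where "d = (\<lambda>n. s * (wt a n * Im (cis (- (t * ln (real n))))) - Im (\<i> ^ Omega n) * wt a n)"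
    have sd: "d sums (s * (pi * Im (dser (hcoef a) (Complex (1 / 2) t))) - pi * S0 a)"
      unfolding d_def by (intro sums_diff sums_mult Im_dser_half sums_S0 sm)
    have sd': "suminf d = pi * (s * Im (dser (hcoef a) (Complex (1 / 2) t))) - pi * S0 a"
      using sums_unique[OF sd] by (simp add: mult_ac)
    have s1: "\<bar>s\<bar> = 1" "s * s = 1" using s by auto
    have d2: "\<bar>d n\<bar> \<le> 2 * \<bar>wt a n\<bar>" for n
    proof -
      have "d n = (s * Im (cis (- (t * ln (real n)))) - Im (\<i> ^ Omega n)) * wt a n" by (simp add: d_def algebra_simps)
      moreover have "\<bar>s * Im (cis (- (t * ln (real n)))) - Im (\<i> ^ Omega n)\<bar> \<le> 1 + 1"
      proof (rule order_trans[OF abs_triangle_ineq4 add_mono])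
        show "\<bar>s * Im (cis (- (t * ln (real n))))\<bar> \<le> 1" by (simp add: abs_mult s1)
        show "\<bar>Im (\<i> ^ Omega n)\<bar> \<le> 1" using abs_Im_le_cmod[of "\<i> ^ Omega n"] by (simp add: norm_power)
      qed
      ultimately show ?thesis by (simp add: abs_mult mult_right_mono)
    qed
    have d1: "\<bar>d n\<bar> \<le> real N * \<epsilon> * \<bar>wt a n\<bar>" if n: "n < N" for n
    proof (cases "primepow n")
      case True
      then obtain p j where pj: "prime p" "j > 0" "n = p ^ j" by (auto simp: primepow_def)
      have "p \<le> n" using self_le_power[OF prime_ge_1_nat[OF pj(1)] pj(2)] pj(3) by simp
      hence pA: "p \<in> A" using pj n by (simp add: A_def)
      have jN: "j \<le> N"
      proof -
        have "j < p ^ j" using power_gt_expt[of p j] prime_gt_Suc_0_nat[OF pj(1)] by simp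
        thus ?thesis using pj n by simp
      qed
      define x where "x = cis (- (t * ln (real p)))"
      define y where "y = of_real s * \<i>"
      have yc: "y = cis (s * pi / 2)" using s by (auto simp: y_def cis_conv_exp complex_eq_iff Re_exp Im_exp)
      have "x - y = cnj (cis (t * ln (real p)) - cis (- (s * pi / 2)))" unfolding x_def yc by (simp add: cis_cnj)
      hence "norm (x - y) = norm (cis (t * ln (real p)) - cis (- (s * pi / 2)))" by (metis complex_mod_cnj)
      hence xy: "norm (x - y) < \<epsilon>" using t pA by simp
      have "norm (x ^ j - y ^ j) \<le> real j * norm (x - y)"
        by (rule norm_power_diff) (auto simp: x_def y_def norm_mult s1)
      also have "\<dots> \<le> real N * \<epsilon>" using xy jN \<epsilon> by (intro mult_mono) auto
      finally have xyj: "norm (x ^ j - y ^ j) \<le> real N * \<epsilon>" .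
      have xj: "x ^ j = cis (- (t * ln (real n)))" using pj prime_gt_0_nat[OF pj(1)]
        by (simp add: x_def Complex.DeMoivre ln_realpow mult_ac)
      have "s * Im (y ^ j) = Im (\<i> ^ j)"
      proof (cases "even j")
        case True
        hence "y ^ j = \<i> ^ j" using s by (auto simp: y_def)
        thus ?thesis using True by (simp add: Im_i_power_even)
      next
        case False
        hence "y ^ j = of_real s * \<i> ^ j" using s by (auto simp: y_def)
        thus ?thesis using s1 by (simp add: mult.assoc[symmetric])
      qed
      moreover have "Omega n = j" using pj by (simp add: Omega_prime_power)
      ultimately have "d n = s * Im (x ^ j - y ^ j) * wt a n" by (simp add: d_def xj algebra_simps)
      hence "\<bar>d n\<bar> = \<bar>Im (x ^ j - y ^ j)\<bar> * \<bar>wt a n\<bar>" by (simp only: abs_mult s1 mult_1)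
      also have "\<dots> \<le> real N * \<epsilon> * \<bar>wt a n\<bar>"
        using xyj abs_Im_le_cmod[of "x ^ j - y ^ j"] by (intro mult_right_mono) linarith+
      finally show ?thesis .
    qed (simp add: d_def wt_eq_0)
    have sad: "summable (\<lambda>n. \<bar>d n\<bar>)"
      by (rule summable_comparison_test'[OF summable_mult[OF sw, of 2], of 0]) (use d2 in simp)
    have "\<bar>suminf d\<bar> \<le> (\<Sum>n. \<bar>d n\<bar>)" by (rule summable_rabs[OF sad])
    also have "\<dots> = (\<Sum>i. \<bar>d (i + N)\<bar>) + (\<Sum>i<N. \<bar>d i\<bar>)" by (rule suminf_split_initial_segment[OF sad])
    also have "(\<Sum>i. \<bar>d (i + N)\<bar>) \<le> (\<Sum>i. 2 * \<bar>wt a (i + N)\<bar>)"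
      by (intro suminf_le d2 summable_mult summable_ignore_initial_segment[OF sad] summable_ignore_initial_segment[OF sw])
    also have "\<dots> = 2 * (\<Sum>i. \<bar>wt a (i + N)\<bar>)" by (intro suminf_mult summable_ignore_initial_segment[OF sw])
    also have "\<dots> \<le> 2 * (S0 a / 8)" using tail by simp
    also have "(\<Sum>i<N. \<bar>d i\<bar>) \<le> (\<Sum>i<N. real N * \<epsilon> * \<bar>wt a i\<bar>)" by (intro sum_mono d1) simp
    also have "\<dots> = real N * \<epsilon> * (\<Sum>i<N. \<bar>wt a i\<bar>)" by (simp add: sum_distrib_left)
    also have "\<dots> \<le> (real N + 1) * \<epsilon> * (W + 1)"
    proof (intro mult_mono)
      have "(\<Sum>i<N. \<bar>wt a i\<bar>) \<le> W" unfolding W_def by (rule sum_le_suminf[OF sw]) auto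
      thus "(\<Sum>i<N. \<bar>wt a i\<bar>) \<le> W + 1" by simp
    qed (use \<epsilon> in \<open>auto intro!: sum_nonneg\<close>)
    also have "\<dots> = S0 a / 8"
    proof -
      have "x * (S / (8 * x * y)) * y = S / 8" if "x \<noteq> 0" "y \<noteq> 0" for x y S :: real using that by simp
      moreover have "real N + 1 \<noteq> 0" "W + 1 \<noteq> 0" using W0 by linarith+
      ultimately show ?thesis unfolding \<epsilon>_def by blast
    qed
    finally have "\<bar>suminf d\<bar> \<le> 3 / 8 * S0 a" by simp
    hence "pi * S0 a - 3 / 8 * S0 a \<le> pi * (s * Im (dser (hcoef a) (Complex (1 / 2) t)))"
      unfolding sd' by linarith
    \<comment> \<open>The 3/8 counts the tail twice and the head once. Since pi > 3 this is at most
      a quarter of \<open>pi * S0 a\<close>.\<close>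
    moreover have "3 / 8 * S0 a \<le> pi * (S0 a / 4)" using S0 pi_gt3 by simp
    moreover have "pi * (3 / 4 * S0 a) = pi * S0 a - pi * (S0 a / 4)" by (simp add: algebra_simps)
    ultimately have "pi * (3 / 4 * S0 a) \<le> pi * (s * Im (dser (hcoef a) (Complex (1 / 2) t)))" by linarith
    thus "s * Im (dser (hcoef a) (Complex (1 / 2) t)) \<ge> 3 / 4 * S0 a"
      by (rule mult_left_le_imp_le) simp
  qed
qed

section \<open>From the Dirichlet series to values of S in a window\<close>

lemma pole_err_tendsto_0:
  assumes "a > 0"
  shows "((\<lambda>t. pole_err a t) \<longlongrightarrow> 0) at_top"
proof -
  have c: "filterlim (\<lambda>t. a * cosh (pi * (t - b))) at_top at_top" for b :: real
  proof (rule filterlim_tendsto_pos_mult_at_top[OF tendsto_const assms])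
    have "filterlim (\<lambda>t. pi * (t - b)) at_top at_top" by real_asymp
    thus "filterlim (\<lambda>t. cosh (pi * (t - b))) at_top at_top" by (rule filterlim_compose[OF cosh_real_at_top])
  qed
  have 1: "((\<lambda>t. exp (- (a * cosh (pi * (t - 1))))) \<longlongrightarrow> 0) at_top"
    by (rule filterlim_compose[OF exp_at_bot]) (use c[of 1] in \<open>simp add: filterlim_uminus_at_bot\<close>)
  have "((\<lambda>t. inverse (a * cosh (pi * (t - 0)))) \<longlongrightarrow> 0) at_top"
    by (rule filterlim_compose[OF tendsto_inverse_0_at_top[OF filterlim_ident] c])
  hence "((\<lambda>t. inverse (a * cosh (pi * (t - 0))) / 2) \<longlongrightarrow> 0 / 2) at_top" by (intro tendsto_intros) auto
  moreover have "inverse (a * cosh (pi * (t - 0))) / 2 = 1 / (2 * (a * cosh (pi * t)))" for t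
    by (simp add: field_simps)
  ultimately have 2: "((\<lambda>t. 1 / (2 * (a * cosh (pi * t)))) \<longlongrightarrow> 0) at_top" by (simp only: div_0)
  show ?thesis unfolding pole_err_def using tendsto_add[OF 1 2] by simp
qed

lemma kern_integral: "(LINT u|lborel. kern a u) = Re (K_hat a 0) / pi"
proof -
  have "complex_of_real (LINT u|lborel. kern a u) = (LINT u|lborel. of_real (kern a u))" by simp
  also have "\<dots> = K_hat a 0 / of_real pi" using scaled_kernel_transform[of a 0] by (simp add: kern_def)
  finally have "complex_of_real (LINT u|lborel. kern a u) = K_hat a 0 / of_real pi" .
  from arg_cong[OF this, of Re] show ?thesis by simp
qed

lemma K_hat_0_nonneg: "Re (K_hat a 0) \<ge> 0"
proof -
  have "Re (K_hat a 0) = pi * (LINT u|lborel. kern a u)" by (simp add: kern_integral)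
  moreover have "0 \<le> (LINT u|lborel. kern a u)" by (intro Bochner_Integration.integral_nonneg) simp
  ultimately show ?thesis by simp
qed

text \<open>One factor is small outside the window; the other remains to integrate the growth of
  S.\<close>

lemma kern_split: "kern a u = kern (a / 2) u * kern (a / 2) u"
  by (simp add: kern_def exp_add[symmetric])

text \<open>If \<open>s * S_zeta\<close> were at most \<open>Bd\<close> throughout the window, the
  convolution would be at most \<open>Bd * K0 \<le> S / pi\<close> plus a tail. The threshold is
  smaller by the factor pi than the value S / K0 natural here, and this slack pays for all errors:
  1/3 + 1/8 + 29/240 < 3/4.\<close>

lemma (in zeta_log) large_value_in_window:
  assumes a: "a \<ge> 1" and sm: "summable (\<lambda>n. \<bar>hcoef a (Suc n)\<bar> * real (Suc n) powr (- (1 / 2)))"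
    and s: "s = 1 \<or> s = -1" and S: "S > 0" and A: "finite A" "\<And>p. p \<in> A \<Longrightarrow> prime (p::nat)" and \<epsilon>: "\<epsilon> > 0"
    and large: "\<And>t. (\<forall>p\<in>A. norm (cis (t * ln (real p)) - cis (- (s * pi / 2))) < \<epsilon>) \<Longrightarrow>
       s * Im (dser (hcoef a) (Complex (1 / 2) t)) \<ge> 3 / 4 * S"
  shows "\<exists>c0. \<forall>\<^sub>F T in at_top. \<exists>\<tau>. \<bar>\<tau> - T\<bar> \<le> 1 / pi * ln (ln (ln T)) + c0 \<and> s * S_zeta \<tau> > S / (pi * Re (K_hat a 0))"
proof -
  have a0: "a > 0" using a by simp
  obtain c where c: "\<And>T. \<exists>t. \<bar>t - T\<bar> \<le> c \<and> (\<forall>p\<in>A. norm (cis (t * ln (real p)) - cis (- (s * pi / 2))) < \<epsilon>)"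
    using Kronecker_primes_relatively_dense[OF A \<epsilon>, of "- (s * pi / 2)"] by blast
  obtain C where C: "C > 0" "\<And>\<tau>. \<bar>pi * S_reg \<tau>\<bar> \<le> C * ln (\<bar>\<tau>\<bar> + 2)" using arg_reg_growth by blast
  define K0 where "K0 = Re (K_hat a 0)"
  have iK: "(LINT u|lborel. kern a u) = K0 / pi" by (simp add: kern_integral K0_def)
  have K0: "K0 \<ge> 0" unfolding K0_def by (rule K_hat_0_nonneg)
  define Bd where "Bd = S / (pi * K0)"
  have Bd0: "Bd \<ge> 0" unfolding Bd_def using S K0 by simp
  \<comment> \<open>For \<open>K0 = 0\<close> the convention on division by zero makes
    \<open>Bd\<close> equal to 0.\<close>
  have BdK: "Bd * K0 \<le> S / pi" using S by (cases "K0 = 0") (auto simp: Bd_def)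
  define I0 where "I0 = (LINT u|lborel. kern (a / 2) u)"
  define I1 where "I1 = (LINT u|lborel. kern (a / 2) u * \<bar>u\<bar>)"
  have i0: "integrable lborel (kern (a / 2))" using a by (intro integrable_kern) simp
  have i1: "integrable lborel (\<lambda>u. kern (a / 2) u * \<bar>u\<bar>)" using integrable_kern_linear[of "a / 2" 0 1] a by simp
  have I0: "I0 \<ge> 0" unfolding I0_def by (intro Bochner_Integration.integral_nonneg) simp
  define tl where "tl = (\<lambda>T. exp (- 2 * ln (ln T)) * (C * ln (T + c + 2) * I0 + C * I1))"
  have tl0: "(tl \<longlongrightarrow> 0) at_top"
  proof -
    have 1: "((\<lambda>T::real. exp (- 2 * ln (ln T)) * ln (T + c + 2)) \<longlongrightarrow> 0) at_top" by real_asymp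
    have 2: "((\<lambda>T::real. exp (- 2 * ln (ln T))) \<longlongrightarrow> 0) at_top" by real_asymp
    have "((\<lambda>T. (exp (- 2 * ln (ln T)) * ln (T + c + 2)) * (C * I0) + exp (- 2 * ln (ln T)) * (C * I1)) \<longlongrightarrow> 0 * (C * I0) + 0 * (C * I1)) at_top"
      by (intro tendsto_intros 1 2)
    thus ?thesis by (simp add: tl_def [abs_def] algebra_simps)
  qed
  have "\<forall>\<^sub>F t in at_top. pole_err a t < S / 240"
    using order_tendstoD(2)[OF pole_err_tendsto_0[OF a0], of "S / 240"] S by simp
  then obtain t1 where t1: "\<And>t. t \<ge> t1 \<Longrightarrow> pole_err a t < S / 240" by (auto simp: eventually_at_top_linorder)
  \<comment> \<open>\<open>c\<close> bounds the distance from \<open>T\<close> to the good point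
    \<open>t\<close>; \<open>ln 8 / pi\<close> widens the window around \<open>t\<close> so that
    \<open>exp (pi * h) = 8 * ln (ln T)\<close>.\<close>
  define c0 where "c0 = c + ln 8 / pi"
  have ev: "\<forall>\<^sub>F T::real in at_top. tl T < S / 8 \<and> T \<ge> t1 + c \<and> T \<ge> 1 + c \<and> ln (ln T) \<ge> 1"
  proof (intro eventually_conj)
    show "\<forall>\<^sub>F T in at_top. tl T < S / 8" using order_tendstoD(2)[OF tl0, of "S / 8"] S by simp
    show "\<forall>\<^sub>F T::real in at_top. ln (ln T) \<ge> 1" by real_asymp
  qed (rule eventually_ge_at_top)+
  have "\<forall>\<^sub>F T in at_top. \<exists>\<tau>. \<bar>\<tau> - T\<bar> \<le> 1 / pi * ln (ln (ln T)) + c0 \<and> s * S_zeta \<tau> > Bd"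
    using ev
  proof eventually_elim
    case (elim T)
    define h where "h = 1 / pi * ln (ln (ln T)) + ln 8 / pi"
    have lll: "ln (ln (ln T)) \<ge> 0" using elim by simp
    have h0: "h \<ge> 0" unfolding h_def using lll by (intro add_nonneg_nonneg mult_nonneg_nonneg divide_nonneg_nonneg) auto
    obtain t where t: "\<bar>t - T\<bar> \<le> c" "\<forall>p\<in>A. norm (cis (t * ln (real p)) - cis (- (s * pi / 2))) < \<epsilon>" using c by blast
    have tT: "t \<ge> 1" "t \<ge> t1" "t \<le> T + c" using t(1) elim by linarith+
    have s1: "\<bar>s\<bar> = 1" using s by auto
    \<comment> \<open>This is (ln T)^(-2), reached because
      \<open>cosh (pi * h) \<ge> 4 * ln (ln T)\<close> and \<open>a / 2 \<ge> 1 / 2\<close>.\<close>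
    define E where "E = exp (- 2 * ln (ln T))"
    have kout: "kern (a / 2) u \<le> E" if "\<bar>u\<bar> \<ge> h" for u
    proof -
      have "kern (a / 2) u \<le> exp (- (a / 2 * cosh (pi * h)))" using that h0 a by (intro kern_le_outside) auto
      also have "\<dots> \<le> E"
      proof -
        have "pi * h = ln (ln (ln T)) + ln 8" by (simp add: h_def field_simps)
        hence "exp (pi * h) = ln (ln T) * 8" using elim by (simp add: exp_add)
        moreover have "exp (pi * h) / 2 \<le> cosh (pi * h)" by (simp add: cosh_def)
        ultimately have ch: "4 * ln (ln T) \<le> cosh (pi * h)" by linarith
        have "1 / 2 * (4 * ln (ln T)) \<le> a / 2 * cosh (pi * h)" using a ch elim by (intro mult_mono) auto
        thus ?thesis by (simp add: E_def)
      qed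
      finally show ?thesis .
    qed
    \<comment> \<open>A majorant of the signed integrand in case the claim fails: the first summand
      serves inside the window, the second outside. Both are nonnegative, so either may be added
      freely.\<close>
    define R where "R = (\<lambda>u. kern a u * (pi * Bd) + E * (C * ln (\<bar>t\<bar> + 2) * kern (a / 2) u + C * (kern (a / 2) u * \<bar>u\<bar>)))"
    have iR: "integrable lborel R"
      unfolding R_def using integrable_kern[OF a0] i0 i1 by (intro Bochner_Integration.integrable_add integrable_mult_right integrable_mult_left)
    have IR: "(LINT u|lborel. R u) = K0 / pi * (pi * Bd) + E * (C * ln (\<bar>t\<bar> + 2) * I0 + C * I1)"
      unfolding R_def using integrable_kern[OF a0] i0 i1 by (simp add: iK I0_def I1_def)
    note conv = S_reg_convolution[OF a0 sm tT(1)]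
    show ?case
    proof (rule ccontr)
      assume neg: "\<not> ?case"
      \<comment> \<open>At exceptional points \<open>S_reg\<close> is 0, which does not exceed
        \<open>Bd\<close> because \<open>Bd \<ge> 0\<close>.\<close>
      have win: "s * S_reg (t + u) \<le> Bd" if u: "\<bar>u\<bar> \<le> h" for u
      proof (cases "t + u \<in> insert 0 zeta_ordinates")
        case False
        have "\<bar>t + u - T\<bar> \<le> 1 / pi * ln (ln (ln T)) + c0" using u t(1) unfolding h_def c0_def by linarith
        hence "s * S_zeta (t + u) \<le> Bd" using neg not_le by blast
        thus ?thesis using False by (simp add: S_reg_def)
      qed (simp add: S_reg_def Bd0)
      have pw: "s * (kern a u * (pi * S_reg (t + u))) \<le> R u" for u
      proof -
        have Lp: "0 \<le> ln (\<bar>t\<bar> + 2)" by simp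
        show ?thesis
        proof (cases "\<bar>u\<bar> \<le> h")
          case True
          have "s * (kern a u * (pi * S_reg (t + u))) = kern a u * (pi * (s * S_reg (t + u)))" by simp
          also have "\<dots> \<le> kern a u * (pi * Bd)" using win[OF True] by (intro mult_left_mono) auto
          also have "\<dots> \<le> R u" unfolding R_def using C(1) Lp by (simp add: E_def)
          finally show ?thesis .
        next
          case False
          have "s * (kern a u * (pi * S_reg (t + u))) \<le> \<bar>s * (kern a u * (pi * S_reg (t + u)))\<bar>" by simp
          also have "\<dots> = kern a u * \<bar>pi * S_reg (t + u)\<bar>" using s1 by (simp add: abs_mult)
          also have "\<dots> \<le> kern a u * (C * (ln (\<bar>t\<bar> + 2) + \<bar>u\<bar>))"
            using C(1) ln_shift_le[of t u] by (intro mult_left_mono order_trans[OF C(2)]) auto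
          also have "\<dots> \<le> (E * kern (a / 2) u) * (C * (ln (\<bar>t\<bar> + 2) + \<bar>u\<bar>))"
            unfolding kern_split[of a u] using kout[of u] False C(1) Lp by (intro mult_right_mono mult_nonneg_nonneg) auto
          also have "\<dots> \<le> R u" unfolding R_def using Bd0 by (simp add: algebra_simps)
          finally show ?thesis .
        qed
      qed
      have "3 / 4 * S \<le> s * Im (dser (hcoef a) (Complex (1 / 2) t))" by (rule large[OF t(2)])
      also have "\<dots> \<le> s * (LINT u|lborel. kern a u * (pi * S_reg (t + u))) + 29 * pole_err a t"
        using conv(2) s by auto
      also have "s * (LINT u|lborel. kern a u * (pi * S_reg (t + u))) = (LINT u|lborel. s * (kern a u * (pi * S_reg (t + u))))" by simp
      also have "\<dots> \<le> (LINT u|lborel. R u)"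
        by (intro Bochner_Integration.integral_mono integrable_mult_right conv(1) iR pw)
      also have "\<dots> = Bd * K0 + E * (C * ln (\<bar>t\<bar> + 2) * I0 + C * I1)" by (simp add: IR)
      also have "E * (C * ln (\<bar>t\<bar> + 2) * I0 + C * I1) \<le> tl T"
      proof -
        have "ln (\<bar>t\<bar> + 2) \<le> ln (T + c + 2)" using tT by (intro ln_mono) auto
        thus ?thesis unfolding tl_def E_def using C(1) I0 by (intro mult_left_mono add_right_mono mult_right_mono) auto
      qed
      also have "tl T < S / 8" using elim by simp
      finally have "3 / 4 * S < S / pi + S / 8 + 29 * (S / 240)"
        using BdK t1[OF tT(2)] by simp
      moreover have "S / pi \<le> S / 3" using S pi_gt3 by (intro divide_left_mono) auto
      ultimately show False using S by simp
    qed
  qed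
  thus ?thesis unfolding Bd_def K0_def by blast
qed

lemma large_values_S_zeta:
  assumes RH: riemann_hypothesis and a: "a \<ge> 1" and S0: "S0 a > 0" and s: "s = 1 \<or> s = -1"
  shows "\<exists>c0. \<forall>\<^sub>F T in at_top. \<exists>\<tau>. \<bar>\<tau> - T\<bar> \<le> 1 / pi * ln (ln (ln T)) + c0 \<and> s * S_zeta \<tau> > S0 a / (pi * Re (K_hat a 0))"
proof -
  have a0: "a > 0" using a by simp
  have sm: "(\<lambda>n. \<bar>wt a n\<bar>) summable_on UNIV" by (rule summable_wt[OF a0 S0])
  obtain l where "zeta_log l" by (rule RH_imp_zeta_log[OF RH])
  then interpret zeta_log l .
  obtain A \<epsilon> where "finite A" "\<And>p. p \<in> A \<Longrightarrow> prime (p::nat)" "\<epsilon> > 0"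
    "\<And>t. (\<forall>p\<in>A. norm (cis (t * ln (real p)) - cis (- (s * pi / 2))) < \<epsilon>) \<Longrightarrow>
       s * Im (dser (hcoef a) (Complex (1 / 2) t)) \<ge> 3 / 4 * S0 a"
    by (rule Im_dser_large[OF sm S0 s]) blast
  thus ?thesis by (rule large_value_in_window[OF a summable_on_wt_imp_summable(2)[OF sm] s S0])
qed

text \<open>The maximum is taken as a supremum in \<open>ereal\<close>: no boundedness is
  presupposed, and an empty window would give minus infinity and falsify the inequality rather than
  make it vacuous. One point of the window for each sign suffices.\<close>

theorem theorem2:
  fixes a :: real
  assumes "riemann_hypothesis"
    and "a \<ge> 1"
    and "S0 a > 0"
  shows "S0 a = 1 / pi * Im (\<Sum>n. let m = n + 2 in
           \<i> ^ Omega m * of_real (Lambda1 m / sqrt (real m)) * K_hat a (ln (real m) / pi)) \<and>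
    (\<forall>\<epsilon>. 0 < \<epsilon> \<and> \<epsilon> < min (1 / 2) (S0 a) \<longrightarrow>
      (\<exists>c\<^sub>0 T\<^sub>0. \<forall>T\<ge>T\<^sub>0. let H = 1 / pi * ln (ln (ln T)) + c\<^sub>0 in
         (SUP t\<in>{t. \<bar>t - T\<bar> \<le> H}. ereal (S_zeta t)) > ereal ((S0 a - \<epsilon>) / (pi * Re (K_hat a 0))) \<and>
         (SUP t\<in>{t. \<bar>t - T\<bar> \<le> H}. ereal (- S_zeta t)) > ereal ((S0 a - \<epsilon>) / (pi * Re (K_hat a 0)))))"
proof (intro conjI allI impI)
  have a0: "a > 0" using assms by simp
  show "S0 a = 1 / pi * Im (\<Sum>n. let m = n + 2 in
           \<i> ^ Omega m * of_real (Lambda1 m / sqrt (real m)) * K_hat a (ln (real m) / pi))"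
    by (rule S0_eq_Im_series[OF summable_wt[OF a0 assms(3)]])
  fix \<epsilon> assume \<epsilon>: "0 < \<epsilon> \<and> \<epsilon> < min (1 / 2) (S0 a)"
  define q where "q = S0 a / (pi * Re (K_hat a 0))"
  \<comment> \<open>Since \<open>Re (K_hat a 0) \<ge> 0\<close>, values above the threshold without
    \<epsilon> exceed the one with it.\<close>
  have q: "(S0 a - \<epsilon>) / (pi * Re (K_hat a 0)) \<le> q"
    unfolding q_def using \<epsilon> K_hat_0_nonneg[of a] by (intro divide_right_mono) auto
  obtain c1 where c1: "\<forall>\<^sub>F T in at_top. \<exists>\<tau>. \<bar>\<tau> - T\<bar> \<le> 1 / pi * ln (ln (ln T)) + c1 \<and> 1 * S_zeta \<tau> > q"
    using large_values_S_zeta[OF assms, of 1] unfolding q_def by auto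
  obtain c2 where c2: "\<forall>\<^sub>F T in at_top. \<exists>\<tau>. \<bar>\<tau> - T\<bar> \<le> 1 / pi * ln (ln (ln T)) + c2 \<and> - 1 * S_zeta \<tau> > q"
    using large_values_S_zeta[OF assms, of "- 1"] unfolding q_def by auto
  define c0 where "c0 = max c1 c2"
  have "\<forall>\<^sub>F T in at_top. (\<exists>\<tau>. \<bar>\<tau> - T\<bar> \<le> 1 / pi * ln (ln (ln T)) + c0 \<and> S_zeta \<tau> > q) \<and>
     (\<exists>\<tau>. \<bar>\<tau> - T\<bar> \<le> 1 / pi * ln (ln (ln T)) + c0 \<and> - S_zeta \<tau> > q)"
    using c1 c2
  proof eventually_elim
    case (elim T)
    then obtain x y where "\<bar>x - T\<bar> \<le> 1 / pi * ln (ln (ln T)) + c1" "S_zeta x > q"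
      "\<bar>y - T\<bar> \<le> 1 / pi * ln (ln (ln T)) + c2" "- S_zeta y > q" by auto
    thus ?case unfolding c0_def by (intro conjI exI[of _ x] exI[of _ y]) linarith+
  qed
  then obtain T0 where T0: "\<And>T. T \<ge> T0 \<Longrightarrow> (\<exists>\<tau>. \<bar>\<tau> - T\<bar> \<le> 1 / pi * ln (ln (ln T)) + c0 \<and> S_zeta \<tau> > q) \<and>
     (\<exists>\<tau>. \<bar>\<tau> - T\<bar> \<le> 1 / pi * ln (ln (ln T)) + c0 \<and> - S_zeta \<tau> > q)"
    unfolding eventually_at_top_linorder by blast
  have sup: "ereal ((S0 a - \<epsilon>) / (pi * Re (K_hat a 0))) < (SUP t\<in>{t. \<bar>t - T\<bar> \<le> H}. ereal (g t))"
    if "\<bar>\<tau> - T\<bar> \<le> H" "g \<tau> > q" for g :: "real \<Rightarrow> real" and \<tau> T H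
    unfolding less_SUP_iff using that q by (intro bexI[of _ \<tau>]) auto
  show "\<exists>c\<^sub>0 T\<^sub>0. \<forall>T\<ge>T\<^sub>0. let H = 1 / pi * ln (ln (ln T)) + c\<^sub>0 in
         (SUP t\<in>{t. \<bar>t - T\<bar> \<le> H}. ereal (S_zeta t)) > ereal ((S0 a - \<epsilon>) / (pi * Re (K_hat a 0))) \<and>
         (SUP t\<in>{t. \<bar>t - T\<bar> \<le> H}. ereal (- S_zeta t)) > ereal ((S0 a - \<epsilon>) / (pi * Re (K_hat a 0)))"
    unfolding Let_def
  proof (rule exI[of _ c0], rule exI[of _ T0], intro allI impI)
    fix T assume "T0 \<le> T"
    from T0[OF this] obtain x y where x: "\<bar>x - T\<bar> \<le> 1 / pi * ln (ln (ln T)) + c0" "S_zeta x > q"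
      and y: "\<bar>y - T\<bar> \<le> 1 / pi * ln (ln (ln T)) + c0" "- S_zeta y > q" by blast
    show "(SUP t\<in>{t. \<bar>t - T\<bar> \<le> 1 / pi * ln (ln (ln T)) + c0}. ereal (S_zeta t)) > ereal ((S0 a - \<epsilon>) / (pi * Re (K_hat a 0))) \<and>
         (SUP t\<in>{t. \<bar>t - T\<bar> \<le> 1 / pi * ln (ln (ln T)) + c0}. ereal (- S_zeta t)) > ereal ((S0 a - \<epsilon>) / (pi * Re (K_hat a 0)))"
      using sup[of x T _ S_zeta, OF x] sup[of y T _ "\<lambda>t. - S_zeta t", OF y] by (rule conjI)
  qed
qed

end
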